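(* Let $n=m=1$, so that $A,B,C,D,Q,S,R\in\mathbb{R}$, and suppose that $D=0$ and $B=1$. Then: (i) If $R<0$, then Problem (LQ)$^0$ is not solvable. (ii) If $R=0$, then Problem (LQ)$^0$ is solvable if and only if $Q=S(2A+C^2)$. In this case, the pairs $$(\Theta,v(\cdot))\quad\text{with}\quad\Theta<-(2A+C^2)/2,\quad v(\cdot)\in L^2_{\mathbb{F}}(\mathbb{R})$$ are all the closed-loop optimal strategies of Problem (LQ)$^0$. (iii) If $R>0$, then Problem (LQ)$^0$ is solvable if and only if $\Sigma:=R(2A+C^2)^2-4S(2A+C^2)+4Q>0$. In this case, $$\left(-\frac{2A+C^2+\sqrt{\Sigma/R}}{2},\ 0\right)$$ is the unique closed-loop optimal strategy of Problem (LQ)$^0$.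
   Context: $(\Omega,\mathcal{F},\mathbb{F},\mathbb{P})$ is a complete filtered probability space carrying a standard one-dimensional Brownian motion $W=\{W(t);t\geq0\}$; $\mathbb{F}$ is the natural filtration of $W$ augmented by all $\mathbb{P}$-null sets. $L^2_{\mathbb{F}}(\mathbb{R})$ is the space of $\mathbb{F}$-progressively measurable $\varphi:[0,\infty)\times\Omega\to\mathbb{R}$ with $\mathbb{E}\int_0^\infty|\varphi(t)|^2dt<\infty$. Problem (LQ)$^0$ (one-dimensional state and control): for $x\in\mathbb{R}$ and $u\in L^2_{\mathbb{F}}(\mathbb{R})$ let $X(\cdot)=X(\cdot;x,u(\cdot))$ solve $$dX(t)=[AX(t)+Bu(t)]dt+[CX(t)+Du(t)]dW(t),\ t\geq0,\qquad X(0)=x.$$ Let $\mathcal{U}_{ad}(x)=\{u(\cdot)\in L^2_{\mathbb{F}}(\mathbb{R}):\mathbb{E}\int_0^\infty|X(t;x,u(\cdot))|^2dt<\infty\}$ and $$J^0(x;u(\cdot))=\mathbb{E}\int_0^\infty\big[QX(t)^2+2SX(t)u(t)+Ru(t)^2\big]dt.$$ The problem is, given $x$, to minimize $J^0(x;\cdot)$ over $\mathcal{U}_{ad}(x)$. A number $\Theta\in\mathbb{R}$ is a stabilizer of $[A,C;B,D]$ if for every $x\in\mathbb{R}$ the solution of $dX=(A+B\Theta)X\,dt+(C+D\Theta)X\,dW$, $X(0)=x$, satisfies $\mathbb{E}\int_0^\infty|X(t)|^2dt<\infty$. The problem is open-loop solvable if for every $x\in\mathbb{R}$ there is $u^*\in\mathcal{U}_{ad}(x)$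 with $J^0(x;u^* )\leq J^0(x;u)$ for all $u\in\mathcal{U}_{ad}(x)$. A closed-loop optimal strategy is a pair $(\Theta^*,v^*(\cdot))\in\mathbb{R}\times L^2_{\mathbb{F}}(\mathbb{R})$ with $\Theta^*$ a stabilizer of $[A,C;B,D]$ and $J^0(x;\Theta^*X^*+v^* )\leq J^0(x;u)$ for all $x\in\mathbb{R}$, $u\in\mathcal{U}_{ad}(x)$, where $X^*$ solves $dX^*=[(A+B\Theta^* )X^*+Bv^*]dt+[(C+D\Theta^* )X^*+Dv^*]dW$, $X^*(0)=x$. The problem is closed-loop solvable if a closed-loop optimal strategy exists. "Solvable" may be read as open-loop solvable or as closed-loop solvable (the two notions are equivalent when a stabilizer exists, as is the case here). *)

theory Defs
  imports "HOL-Probability.Probability"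
begin

(* A process is a function  phi :: real => 'a => real  (time first); only its values at times
   t >= 0 are ever used. *)

definition natural_filtration ::
    "'a measure \<Rightarrow> (real \<Rightarrow> 'a \<Rightarrow> real) \<Rightarrow> real \<Rightarrow> 'a measure" where
  "natural_filtration M W t =
     sigma (space M) {W s -` B \<inter> space M | s B. s \<in> {0..t} \<and> B \<in> sets borel}"

definition augmented_filtration ::
    "'a measure \<Rightarrow> (real \<Rightarrow> 'a \<Rightarrow> real) \<Rightarrow> real \<Rightarrow> 'a measure" where
  "augmented_filtration M W t =
     sigma (space M) (sets (natural_filtration M W t) \<union> null_sets M)"

locale brownian_space = prob_space M + complete_measure M
  for M :: "'a measure" +
  fixes W :: "real \<Rightarrow> 'a \<Rightarrow> real"
  assumes W_measurable: "\<And>t. 0 \<le> t \<Longrightarrow> W t \<in> borel_measurable M"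
    and W_zero: "AE \<omega> in M. W 0 \<omega> = 0"
    and W_continuous: "AE \<omega> in M. continuous_on {0..} (\<lambda>t. W t \<omega>)"
    and W_increment: "\<And>s t. 0 \<le> s \<Longrightarrow> s < t \<Longrightarrow>
          distributed M lborel (\<lambda>\<omega>. W t \<omega> - W s \<omega>) (normal_density 0 (sqrt (t - s)))"
    and W_independent: "\<And>s t. 0 \<le> s \<Longrightarrow> s < t \<Longrightarrow>
          indep_set (sets (natural_filtration M W s))
            (sets (vimage_algebra (space M) (\<lambda>\<omega>. W t \<omega> - W s \<omega>) borel))"

definition progressive ::
    "'a measure \<Rightarrow> (real \<Rightarrow> 'a \<Rightarrow> real) \<Rightarrow> (real \<Rightarrow> 'a \<Rightarrow> real) \<Rightarrow> bool" where
  "progressive M W \<phi> \<longleftrightarrow>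
     (\<forall>T\<ge>0. (\<lambda>(t, \<omega>). \<phi> t \<omega>) \<in>
        borel_measurable (restrict_space borel {0..T} \<Otimes>\<^sub>M augmented_filtration M W T))"

definition L2F ::
    "'a measure \<Rightarrow> (real \<Rightarrow> 'a \<Rightarrow> real) \<Rightarrow> (real \<Rightarrow> 'a \<Rightarrow> real) set" where
  "L2F M W = {\<phi>. progressive M W \<phi> \<and>
     (\<integral>\<^sup>+\<omega>. (\<integral>\<^sup>+t\<in>{0..}. ennreal ((\<phi> t \<omega>)\<^sup>2) \<partial>lborel) \<partial>M) < \<infinity>}"

(* The data n, t, xi encode the elementary process
   sum_{i<n} xi_i 1_{(t_i, t_{i+1}]}  on [0,T]. *)

definition elementary_data ::
    "'a measure \<Rightarrow> (real \<Rightarrow> 'a \<Rightarrow> real) \<Rightarrow> real \<Rightarrow> nat \<Rightarrow> (nat \<Rightarrow> real) \<Rightarrow> (nat \<Rightarrow> 'a \<Rightarrow> real) \<Rightarrow> bool" where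
  "elementary_data M W T n t \<xi> \<longleftrightarrow>
     0 \<le> t 0 \<and> (\<forall>i<n. t i \<le> t (Suc i)) \<and> t n \<le> T \<and>
     (\<forall>i<n. \<xi> i \<in> borel_measurable (augmented_filtration M W (t i)) \<and>
            (\<exists>K. \<forall>\<omega>\<in>space M. \<bar>\<xi> i \<omega>\<bar> \<le> K))"

definition elementary_process ::
    "nat \<Rightarrow> (nat \<Rightarrow> real) \<Rightarrow> (nat \<Rightarrow> 'a \<Rightarrow> real) \<Rightarrow> real \<Rightarrow> 'a \<Rightarrow> real" where
  "elementary_process n t \<xi> s \<omega> = (\<Sum>i<n. \<xi> i \<omega> * indicator {t i<..t (Suc i)} s)"

definition elementary_integral ::
    "(real \<Rightarrow> 'a \<Rightarrow> real) \<Rightarrow> nat \<Rightarrow> (nat \<Rightarrow> real) \<Rightarrow> (nat \<Rightarrow> 'a \<Rightarrow> real) \<Rightarrow> 'a \<Rightarrow> real" where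
  "elementary_integral W n t \<xi> \<omega> = (\<Sum>i<n. \<xi> i \<omega> * (W (t (Suc i)) \<omega> - W (t i) \<omega>))"

(* I is a version of the Ito integral of phi over [0,T] against W, for integrands with
   E int_0^T phi^2 dt < oo: it is the L^2(P)-limit of the integrals of elementary processes
   converging to phi in L^2([0,T] x Omega). By the Ito isometry I is a.s. unique. *)

definition has_ito_integral ::
    "'a measure \<Rightarrow> (real \<Rightarrow> 'a \<Rightarrow> real) \<Rightarrow> real \<Rightarrow> (real \<Rightarrow> 'a \<Rightarrow> real) \<Rightarrow> ('a \<Rightarrow> real) \<Rightarrow> bool" where
  "has_ito_integral M W T \<phi> I \<longleftrightarrow>
     progressive M W \<phi> \<and> I \<in> borel_measurable M \<and>
     (\<exists>n t \<xi>. (\<forall>k. elementary_data M W T (n k) (t k) (\<xi> k)) \<and>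
        (\<lambda>k. \<integral>\<^sup>+\<omega>. (\<integral>\<^sup>+s\<in>{0..T}.
            ennreal ((\<phi> s \<omega> - elementary_process (n k) (t k) (\<xi> k) s \<omega>)\<^sup>2) \<partial>lborel) \<partial>M) \<longlonglongrightarrow> 0 \<and>
        (\<lambda>k. \<integral>\<^sup>+\<omega>. ennreal ((I \<omega> - elementary_integral W (n k) (t k) (\<xi> k) \<omega>)\<^sup>2) \<partial>M) \<longlonglongrightarrow> 0)"

(* X is a strong solution of  dX = (A X + B u) dt + (C X + D u) dW,  X(0) = x.  The local
   square-integrability of X puts the diffusion term in the domain of the Ito integral above. *)

definition solves_sde ::
    "'a measure \<Rightarrow> (real \<Rightarrow> 'a \<Rightarrow> real) \<Rightarrow> real \<Rightarrow> real \<Rightarrow> real \<Rightarrow> real \<Rightarrow> real \<Rightarrow>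
     (real \<Rightarrow> 'a \<Rightarrow> real) \<Rightarrow> (real \<Rightarrow> 'a \<Rightarrow> real) \<Rightarrow> bool" where
  "solves_sde M W A B C D x u X \<longleftrightarrow>
     progressive M W X \<and>
     (AE \<omega> in M. continuous_on {0..} (\<lambda>t. X t \<omega>)) \<and>
     (\<forall>T\<ge>0. (\<integral>\<^sup>+\<omega>. (\<integral>\<^sup>+t\<in>{0..T}. ennreal ((X t \<omega>)\<^sup>2) \<partial>lborel) \<partial>M) < \<infinity>) \<and>
     (\<forall>t\<ge>0. \<exists>I. has_ito_integral M W t (\<lambda>s \<omega>. C * X s \<omega> + D * u s \<omega>) I \<and>
        (AE \<omega> in M. X t \<omega> = x + (LBINT s:{0..t}. A * X s \<omega> + B * u s \<omega>) + I \<omega>))"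

(* X(.; x, u). For u in L2F the solution exists and is unique up to indistinguishability, so
   nothing below depends on the representative chosen. *)

definition state ::
    "'a measure \<Rightarrow> (real \<Rightarrow> 'a \<Rightarrow> real) \<Rightarrow> real \<Rightarrow> real \<Rightarrow> real \<Rightarrow> real \<Rightarrow> real \<Rightarrow>
     (real \<Rightarrow> 'a \<Rightarrow> real) \<Rightarrow> real \<Rightarrow> 'a \<Rightarrow> real" where
  "state M W A B C D x u = (SOME X. solves_sde M W A B C D x u X)"

definition admissible ::
    "'a measure \<Rightarrow> (real \<Rightarrow> 'a \<Rightarrow> real) \<Rightarrow> real \<Rightarrow> real \<Rightarrow> real \<Rightarrow> real \<Rightarrow> real \<Rightarrow>
     (real \<Rightarrow> 'a \<Rightarrow> real) set" where
  "admissible M W A B C D x = {u \<in> L2F M W.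
     (\<integral>\<^sup>+\<omega>. (\<integral>\<^sup>+t\<in>{0..}. ennreal ((state M W A B C D x u t \<omega>)\<^sup>2) \<partial>lborel) \<partial>M) < \<infinity>}"

definition cost ::
    "'a measure \<Rightarrow> (real \<Rightarrow> 'a \<Rightarrow> real) \<Rightarrow> real \<Rightarrow> real \<Rightarrow> real \<Rightarrow> real \<Rightarrow> real \<Rightarrow> real \<Rightarrow> real \<Rightarrow>
     real \<Rightarrow> (real \<Rightarrow> 'a \<Rightarrow> real) \<Rightarrow> real" where
  "cost M W A B C D Q S R x u =
     (let X = state M W A B C D x u in
      LINT \<omega>|M. (LBINT t:{0..}.
        Q * (X t \<omega>)\<^sup>2 + 2 * S * X t \<omega> * u t \<omega> + R * (u t \<omega>)\<^sup>2))"

definition stabilizer ::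
    "'a measure \<Rightarrow> (real \<Rightarrow> 'a \<Rightarrow> real) \<Rightarrow> real \<Rightarrow> real \<Rightarrow> real \<Rightarrow> real \<Rightarrow> real \<Rightarrow> bool" where
  "stabilizer M W A B C D \<Theta> \<longleftrightarrow>
     (\<forall>x. (\<integral>\<^sup>+\<omega>. (\<integral>\<^sup>+t\<in>{0..}. ennreal
        ((state M W (A + B * \<Theta>) 0 (C + D * \<Theta>) 0 x (\<lambda>_ _. 0) t \<omega>)\<^sup>2) \<partial>lborel) \<partial>M) < \<infinity>)"

definition open_loop_solvable ::
    "'a measure \<Rightarrow> (real \<Rightarrow> 'a \<Rightarrow> real) \<Rightarrow> real \<Rightarrow> real \<Rightarrow> real \<Rightarrow> real \<Rightarrow> real \<Rightarrow> real \<Rightarrow> real \<Rightarrow> bool" where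
  "open_loop_solvable M W A B C D Q S R \<longleftrightarrow>
     (\<forall>x. \<exists>u\<^sub>0\<in>admissible M W A B C D x. \<forall>u\<in>admissible M W A B C D x.
        cost M W A B C D Q S R x u\<^sub>0 \<le> cost M W A B C D Q S R x u)"

definition closed_loop_control ::
    "'a measure \<Rightarrow> (real \<Rightarrow> 'a \<Rightarrow> real) \<Rightarrow> real \<Rightarrow> real \<Rightarrow> real \<Rightarrow> real \<Rightarrow> real \<Rightarrow>
     (real \<Rightarrow> 'a \<Rightarrow> real) \<Rightarrow> real \<Rightarrow> real \<Rightarrow> 'a \<Rightarrow> real" where
  "closed_loop_control M W A B C D \<Theta> v x =
     (\<lambda>t \<omega>. \<Theta> * state M W (A + B * \<Theta>) B (C + D * \<Theta>) D x v t \<omega> + v t \<omega>)"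

definition closed_loop_optimal ::
    "'a measure \<Rightarrow> (real \<Rightarrow> 'a \<Rightarrow> real) \<Rightarrow> real \<Rightarrow> real \<Rightarrow> real \<Rightarrow> real \<Rightarrow> real \<Rightarrow> real \<Rightarrow> real \<Rightarrow>
     real \<Rightarrow> (real \<Rightarrow> 'a \<Rightarrow> real) \<Rightarrow> bool" where
  "closed_loop_optimal M W A B C D Q S R \<Theta> v \<longleftrightarrow>
     v \<in> L2F M W \<and> stabilizer M W A B C D \<Theta> \<and>
     (\<forall>x. \<forall>u\<in>admissible M W A B C D x.
        cost M W A B C D Q S R x (closed_loop_control M W A B C D \<Theta> v x)
          \<le> cost M W A B C D Q S R x u)"

definition closed_loop_solvable ::
    "'a measure \<Rightarrow> (real \<Rightarrow> 'a \<Rightarrow> real) \<Rightarrow> real \<Rightarrow> real \<Rightarrow> real \<Rightarrow> real \<Rightarrow> real \<Rightarrow> real \<Rightarrow> real \<Rightarrow> bool" where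
  "closed_loop_solvable M W A B C D Q S R \<longleftrightarrow>
     (\<exists>\<Theta> v. closed_loop_optimal M W A B C D Q S R \<Theta> v)"

end

theory Submission
  imports Defs
begin

text \<open>With \<open>D = 0\<close> and \<open>B = 1\<close> the state equation is solved explicitly: with
  \<open>\<Phi>(s,t) = exp ((A - C\<^sup>2 / 2) (t - s) + C (W\<^sub>t - W\<^sub>s))\<close>, variation of constants gives
  \<open>X\<^sub>t = \<Phi>(0,t) x + \<integral>\<^sub>0\<^sup>t \<Phi>(s,t) u\<^sub>s ds\<close>. The increments of \<open>W\<close> are independent of the past, so
  Riemann sums over a uniform grid show that this process solves the equation in the sense of the
  \<open>L\<^sup>2\<close>-limit definition of the Ito integral, and squaring the formula yields the energy
  balance of \<open>E X\<^sup>2\<close>. Put \<open>m = 2 A + C\<^sup>2\<close>. If \<open>X\<close> and \<open>u\<close> are square integrable on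
  \<open>[0,\<infinity>)\<close>, the balance becomes \<open>m \<langle>X,X\<rangle> + 2 \<langle>X,u\<rangle> = - x\<^sup>2\<close>, so the cost is
  \<open>- S x\<^sup>2 + (Q - S m) \<langle>X,X\<rangle> + R \<langle>u,u\<rangle>\<close>. The rest is elementary: the feedbacks
  \<open>u = \<Theta> X\<close> have \<open>\<langle>X,X\<rangle> = - x\<^sup>2 / (m + 2 \<Theta>)\<close> and witness that the infimum is \<open>-\<infinity>\<close> or not
  attained, while for \<open>R > 0\<close> and \<open>\<Sigma> > 0\<close> the cost is completed to a square.\<close>

section \<open>Increments of Brownian motion\<close>

text \<open>The state is a \<open>SOME\<close> choice among solutions, so costs are out of reach
  before existence and uniqueness. For existence the Ito integral is defined as the residual of the
  equation and then shown to be one; uniqueness compares two Ito integrals through their elementary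
  approximants. \<open>D = 0\<close> keeps this elementary: the control enters only the drift, so
  the solution divided by the fundamental solution has absolutely continuous paths, and its square
  is computed path by path with ordinary calculus. The number \<open>m\<close> is the growth rate of
  the second moment of the fundamental solution. The control problem then concerns two vectors of
  one Hilbert space tied by a scalar identity. A feedback of decay rate \<open>t\<close> costs
  \<open>- S + d / t + R * m / 2 + R * t / 4\<close> per unit of \<open>x^2\<close>, where
  \<open>4 * d\<close> is \<Sigma>. This function of \<open>t\<close> guides the cases: it is
  unbounded below at infinity for \<open>R < 0\<close> and at 0 for \<Sigma> < 0; its infimum is
  only approached, at 0 for \<open>R > 0\<close> and \<Sigma> = 0, at infinity for
  \<open>R = 0\<close> and \<Sigma> > 0; if both are positive, its minimum is at
  \<open>t = sqrt (\<Sigma> / R)\<close>.\<close>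

lemma normal_density_exp_tilt:
  assumes "0 < \<sigma>"
  shows "normal_density 0 \<sigma> x * exp (l * x) = exp (l\<^sup>2 * \<sigma>\<^sup>2 / 2) * normal_density (l * \<sigma>\<^sup>2) \<sigma> x"
proof -
  have "- x\<^sup>2 / (2 * \<sigma>\<^sup>2) + l * x = l\<^sup>2 * \<sigma>\<^sup>2 / 2 - (x - l * \<sigma>\<^sup>2)\<^sup>2 / (2 * \<sigma>\<^sup>2)"
    using assms by (simp add: field_simps power2_eq_square)
  then have "exp (- x\<^sup>2 / (2 * \<sigma>\<^sup>2)) * exp (l * x)
      = exp (l\<^sup>2 * \<sigma>\<^sup>2 / 2) * exp (- (x - l * \<sigma>\<^sup>2)\<^sup>2 / (2 * \<sigma>\<^sup>2))"
    by (simp flip: exp_add)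
  then show ?thesis by (simp add: normal_density_def)
qed

context brownian_space
begin

abbreviation F :: "real \<Rightarrow> 'a measure" where "F \<equiv> augmented_filtration M W"

section \<open>The natural and the augmented filtration\<close>

lemma space_natural_filtration [simp]: "space (natural_filtration M W t) = space M"
  by (auto simp: natural_filtration_def intro!: space_measure_of)

lemma sets_natural_filtration:
  "sets (natural_filtration M W t) =
     sigma_sets (space M) {W s -` B \<inter> space M | s B. s \<in> {0..t} \<and> B \<in> sets borel}"
  unfolding natural_filtration_def by (rule sets_measure_of) auto

lemma sets_natural_filtration_subset: "sets (natural_filtration M W t) \<subseteq> sets M"
proof -
  have "W s -` B \<inter> space M \<in> sets M" if "s \<in> {0..t}" "B \<in> sets borel" for s and B :: "real set"
    using that by (intro measurable_sets[OF W_measurable]) auto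
  then show ?thesis
    unfolding sets_natural_filtration by (intro sets.sigma_sets_subset) auto
qed

lemma augmented_filtration_generator_subset:
  "sets (natural_filtration M W t) \<union> null_sets M \<subseteq> sets M"
  using sets_natural_filtration_subset by auto

lemma space_F [simp]: "space (F t) = space M"
  unfolding augmented_filtration_def
  by (intro space_measure_of order_trans[OF augmented_filtration_generator_subset] sets.space_closed)

lemma sets_F: "sets (F t) = sigma_sets (space M) (sets (natural_filtration M W t) \<union> null_sets M)"
  unfolding augmented_filtration_def
  by (intro sets_measure_of order_trans[OF augmented_filtration_generator_subset] sets.space_closed)

lemma sets_F_subset: "sets (F t) \<subseteq> sets M"
  unfolding sets_F by (rule sets.sigma_sets_subset[OF augmented_filtration_generator_subset])

lemma null_sets_in_F: "N \<in> null_sets M \<Longrightarrow> N \<in> sets (F t)"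
  unfolding sets_F by auto

lemma sets_natural_filtration_mono:
  assumes "s \<le> t"
  shows "sets (natural_filtration M W s) \<subseteq> sets (natural_filtration M W t)"
proof -
  have "{W r -` B \<inter> space M | r B. r \<in> {0..s} \<and> B \<in> sets borel}
      \<subseteq> {W r -` B \<inter> space M | r B. r \<in> {0..t} \<and> B \<in> sets borel}"
    using assms by fastforce
  then show ?thesis unfolding sets_natural_filtration by (rule sigma_sets_mono')
qed

lemma sets_F_mono: "s \<le> t \<Longrightarrow> sets (F s) \<subseteq> sets (F t)"
  unfolding sets_F by (intro sigma_sets_mono' Un_mono sets_natural_filtration_mono order_refl)

lemma measurable_F_mono: "s \<le> t \<Longrightarrow> f \<in> measurable (F s) N \<Longrightarrow> f \<in> measurable (F t) N"
  using sets_F_mono[of s t] by (auto simp: measurable_def)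

lemma measurable_F_M: "f \<in> measurable (F s) N \<Longrightarrow> f \<in> measurable M N"
  using sets_F_subset[of s] by (auto simp: measurable_def)

lemma W_measurable_F: "0 \<le> s \<Longrightarrow> s \<le> t \<Longrightarrow> W s \<in> borel_measurable (F t)"
proof (rule measurableI)
  fix B :: "real set" assume s: "0 \<le> s" "s \<le> t" and B: "B \<in> sets borel"
  have "W s -` B \<inter> space M \<in> sets (natural_filtration M W t)"
    unfolding sets_natural_filtration using s B by (intro sigma_sets.Basic) auto
  then show "W s -` B \<inter> space (F t) \<in> sets (F t)"
    by (auto simp: sets_F intro: sigma_sets.Basic)
qed auto

text \<open>The sets with this property form a sigma algebra that contains the generators of the
  augmentation. This carries the independence axiom, which speaks of the natural filtration, over to
  \<open>F\<close>.\<close>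

lemma F_set_AE_eq_natural:
  assumes "A \<in> sets (F t)"
  shows "\<exists>B\<in>sets (natural_filtration M W t). AE \<omega> in M. \<omega> \<in> A \<longleftrightarrow> \<omega> \<in> B"
  using assms unfolding sets_F
proof (induct rule: sigma_sets.induct)
  case (Basic a)
  then show ?case
  proof
    assume "a \<in> null_sets M"
    then have "AE \<omega> in M. \<omega> \<notin> a" by (rule AE_not_in)
    then show ?thesis by (intro bexI[of _ "{}"]) auto
  qed auto
next
  case Empty
  show ?case by (rule bexI[of _ "{}"]) auto
next
  case (Compl a)
  then obtain B where "B \<in> sets (natural_filtration M W t)" "AE \<omega> in M. \<omega> \<in> a \<longleftrightarrow> \<omega> \<in> B" by auto
  then show ?case
    using sets.compl_sets[of B "natural_filtration M W t"]
    by (intro bexI[of _ "space M - B"]) auto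
next
  case (Union a)
  then obtain B where B: "\<And>i::nat. B i \<in> sets (natural_filtration M W t)"
    "\<And>i. AE \<omega> in M. \<omega> \<in> a i \<longleftrightarrow> \<omega> \<in> B i" by metis
  then show ?case
  proof (intro bexI[of _ "\<Union>i. B i"])
    have "AE \<omega> in M. \<forall>i. \<omega> \<in> a i \<longleftrightarrow> \<omega> \<in> B i" using B(2) by (simp add: AE_all_countable)
    then show "AE \<omega> in M. \<omega> \<in> \<Union> (range a) \<longleftrightarrow> \<omega> \<in> (\<Union>i. B i)" by eventually_elim auto
  qed (use B(1) in auto)
qed

lemma prob_increment_indep:
  assumes st: "0 \<le> s" "s \<le> t" and A: "A \<in> sets (F s)" and B: "B \<in> sets borel"
  shows "prob (A \<inter> ((\<lambda>\<omega>. W t \<omega> - W s \<omega>) -` B \<inter> space M))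
       = prob A * prob ((\<lambda>\<omega>. W t \<omega> - W s \<omega>) -` B \<inter> space M)"
\<comment> \<open>The axiom covers only \<open>s < t\<close>. At \<open>s = t\<close> the increment
  is constantly 0, and its events are empty or the whole space.\<close>
proof (cases "s = t")
  case True
  have "A \<subseteq> space M" using A sets.sets_into_space[OF A] by simp
  then show ?thesis using True by (cases "0 \<in> B") (auto simp: prob_space Int_absorb2)
next
  case False
  let ?E = "(\<lambda>\<omega>. W t \<omega> - W s \<omega>) -` B \<inter> space M"
  obtain A' where A': "A' \<in> sets (natural_filtration M W s)" "AE \<omega> in M. \<omega> \<in> A \<longleftrightarrow> \<omega> \<in> A'"
    using F_set_AE_eq_natural[OF A] by auto
  have [measurable]: "W t \<in> borel_measurable M" "W s \<in> borel_measurable M"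
    using st W_measurable by auto
  have [measurable]: "A \<in> sets M" "A' \<in> sets M"
    using A sets_F_subset A' sets_natural_filtration_subset by auto
  have E[measurable]: "?E \<in> sets M" using B by measurable
  have "prob (A \<inter> ?E) = prob (A' \<inter> ?E)"
    by (rule finite_measure_eq_AE) (use A' in auto)
  also have "\<dots> = prob A' * prob ?E"
    using False st B A'(1)
    by (intro indep_setD[OF W_independent]) (auto simp: sets_vimage_algebra)
  also have "prob A' = prob A"
    by (rule finite_measure_eq_AE) (use A' in auto)
  finally show ?thesis .
qed

lemma indep_var_increment:
  fixes \<xi> :: "'a \<Rightarrow> real"
  assumes st: "0 \<le> s" "s \<le> t" and \<xi>: "\<xi> \<in> borel_measurable (F s)"
  shows "indep_var borel \<xi> borel (\<lambda>\<omega>. W t \<omega> - W s \<omega>)"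
proof -
  have [measurable]: "W t \<in> borel_measurable M" "W s \<in> borel_measurable M"
    using st W_measurable by auto
  note [measurable] = measurable_F_M[OF \<xi>]
  have 1: "sigma_sets (space M) {\<xi> -` A \<inter> space M |A. A \<in> sets borel} \<subseteq> sets (F s)"
    using measurable_sets[OF \<xi>] by (intro sets.sigma_sets_subset[of _ "F s", simplified]) auto
  \<comment> \<open>The preimages of Borel sets under one function already form a sigma algebra, so
    on this side every event is described by a single Borel set.\<close>
  have 2: "sigma_sets (space M) {(\<lambda>\<omega>. W t \<omega> - W s \<omega>) -` A \<inter> space M |A. A \<in> sets borel}
      = {(\<lambda>\<omega>. W t \<omega> - W s \<omega>) -` A \<inter> space M |A. A \<in> sets borel}"
    using sigma_sets_vimage_commute[of "\<lambda>\<omega>. W t \<omega> - W s \<omega>" "space M" UNIV "sets borel"]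
      sets.sigma_sets_eq[of "borel :: real measure"] by simp
  show ?thesis
    unfolding indep_var_eq 2
  proof (intro conjI indep_setI)
    show "sigma_sets (space M) {\<xi> -` A \<inter> space M |A. A \<in> sets borel} \<subseteq> events"
      using 1 sets_F_subset by blast
    fix a b assume "a \<in> sigma_sets (space M) {\<xi> -` A \<inter> space M |A. A \<in> sets borel}"
      "b \<in> {(\<lambda>\<omega>. W t \<omega> - W s \<omega>) -` A \<inter> space M |A. A \<in> sets borel}"
    then obtain B where "a \<in> sets (F s)" "B \<in> sets borel" "b = (\<lambda>\<omega>. W t \<omega> - W s \<omega>) -` B \<inter> space M"
      using 1 by auto
    then show "prob (a \<inter> b) = prob a * prob b"
      using prob_increment_indep[OF st, of a B] by simp
  qed auto
qed

lemma indep_var_increment_fun: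
  fixes \<xi> :: "'a \<Rightarrow> real" and f :: "real \<Rightarrow> real"
  assumes "0 \<le> s" "s \<le> t" and "\<xi> \<in> borel_measurable (F s)" and "f \<in> borel_measurable borel"
  shows "indep_var borel \<xi> borel (\<lambda>\<omega>. f (W t \<omega> - W s \<omega>))"
  using indep_var_compose[OF indep_var_increment[OF assms(1-3)], of "\<lambda>x. x" borel f borel] assms(4)
  unfolding comp_def by simp

text \<open>By the product law and Tonelli. With values in \<open>ennreal\<close>, second moments
  factorise before they are known to be finite.\<close>

lemma indep_var_nn_integral:
  fixes X Y :: "'a \<Rightarrow> real"
  assumes "indep_var borel X borel Y" and [measurable]: "f \<in> borel_measurable borel" "g \<in> borel_measurable borel"
  shows "(\<integral>\<^sup>+\<omega>. f (X \<omega>) * g (Y \<omega>) \<partial>M) = (\<integral>\<^sup>+\<omega>. f (X \<omega>) \<partial>M) * (\<integral>\<^sup>+\<omega>. g (Y \<omega>) \<partial>M)"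
proof -
  have [measurable]: "X \<in> borel_measurable M" "Y \<in> borel_measurable M"
    using assms(1) by (auto dest: indep_var_rv1 indep_var_rv2)
  interpret X: prob_space "distr M borel X" by (rule prob_space_distr) simp
  interpret Y: prob_space "distr M borel Y" by (rule prob_space_distr) simp
  have "(\<integral>\<^sup>+\<omega>. f (X \<omega>) * g (Y \<omega>) \<partial>M)
      = (\<integral>\<^sup>+z. f (fst z) * g (snd z) \<partial>distr M (borel \<Otimes>\<^sub>M borel) (\<lambda>\<omega>. (X \<omega>, Y \<omega>)))"
    by (subst nn_integral_distr) auto
  also have "\<dots> = (\<integral>\<^sup>+z. f (fst z) * g (snd z) \<partial>(distr M borel X \<Otimes>\<^sub>M distr M borel Y))"
    using assms(1) by (simp add: indep_var_distribution_eq)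
  also have "\<dots> = (\<integral>\<^sup>+x. \<integral>\<^sup>+y. f x * g y \<partial>distr M borel Y \<partial>distr M borel X)"
    by (subst Y.nn_integral_fst[symmetric]) auto
  also have "\<dots> = (\<integral>\<^sup>+\<omega>. f (X \<omega>) \<partial>M) * (\<integral>\<^sup>+\<omega>. g (Y \<omega>) \<partial>M)"
    by (simp add: nn_integral_cmult nn_integral_multc nn_integral_distr)
  finally show ?thesis .
qed

lemma nn_integral_increment:
  fixes \<xi> :: "'a \<Rightarrow> real"
  assumes "0 \<le> s" "s \<le> t" and "\<xi> \<in> borel_measurable (F s)"
    and "f \<in> borel_measurable borel" and "g \<in> borel_measurable borel"
  shows "(\<integral>\<^sup>+\<omega>. f (\<xi> \<omega>) * g (W t \<omega> - W s \<omega>) \<partial>M)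
       = (\<integral>\<^sup>+\<omega>. f (\<xi> \<omega>) \<partial>M) * (\<integral>\<^sup>+\<omega>. g (W t \<omega> - W s \<omega>) \<partial>M)"
  by (rule indep_var_nn_integral[OF indep_var_increment[OF assms(1-3)] assms(4,5)])

lemma
  fixes \<xi> :: "'a \<Rightarrow> real" and f :: "real \<Rightarrow> real"
  assumes "0 \<le> s" "s \<le> t" and "\<xi> \<in> borel_measurable (F s)" and "f \<in> borel_measurable borel"
    and "integrable M \<xi>" and "integrable M (\<lambda>\<omega>. f (W t \<omega> - W s \<omega>))"
  shows expectation_mult_increment: "(\<integral>\<omega>. \<xi> \<omega> * f (W t \<omega> - W s \<omega>) \<partial>M) = (\<integral>\<omega>. \<xi> \<omega> \<partial>M) * (\<integral>\<omega>. f (W t \<omega> - W s \<omega>) \<partial>M)"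
    and integrable_mult_increment: "integrable M (\<lambda>\<omega>. \<xi> \<omega> * f (W t \<omega> - W s \<omega>))"
  using indep_var_lebesgue_integral[OF indep_var_increment_fun[OF assms(1-4)] assms(5,6)]
    indep_var_integrable[OF indep_var_increment_fun[OF assms(1-4)] assms(5,6)] by auto

section \<open>Gaussian moments of an increment\<close>

lemma exp_increment:
  assumes "0 \<le> s" "s \<le> t"
  shows "has_bochner_integral M (\<lambda>\<omega>. exp (l * (W t \<omega> - W s \<omega>))) (exp (l\<^sup>2 * (t - s) / 2))"
proof (cases "s = t")
  case True
  then show ?thesis by (simp add: has_bochner_integral_iff prob_space)
next
  case False
  let ?\<sigma> = "sqrt (t - s)"
  have \<sigma>: "0 < ?\<sigma>" "?\<sigma>\<^sup>2 = t - s" using assms False by auto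
  have D: "distributed M lborel (\<lambda>\<omega>. W t \<omega> - W s \<omega>) (normal_density 0 ?\<sigma>)"
    using W_increment assms False by auto
  have "integrable lborel (\<lambda>x. normal_density 0 ?\<sigma> x * exp (l * x))"
    using \<sigma> by (simp add: normal_density_exp_tilt)
  then have "integrable M (\<lambda>\<omega>. exp (l * (W t \<omega> - W s \<omega>)))"
    by (subst distributed_integrable[OF D, symmetric]) auto
  moreover have "(\<integral>\<omega>. exp (l * (W t \<omega> - W s \<omega>)) \<partial>M) = (\<integral>x. normal_density 0 ?\<sigma> x * exp (l * x) \<partial>lborel)"
    by (subst distributed_integral[OF D, symmetric]) auto
  ultimately show ?thesis
    using \<sigma> by (simp add: has_bochner_integral_iff normal_density_exp_tilt)
qed

text \<open>Tilting moves the mean of the normal law from 0 to \<open>l * (t - s)\<close>, which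
  becomes the factor in front of the moment generating function. General \<open>l\<close> serves the
  cross term in the second moment of \<open>gres\<close>; \<open>l = 0\<close> gives the mean of an
  increment.\<close>

lemma increment_exp_increment:
  assumes "0 \<le> s" "s \<le> t"
  shows "has_bochner_integral M (\<lambda>\<omega>. (W t \<omega> - W s \<omega>) * exp (l * (W t \<omega> - W s \<omega>)))
           (l * (t - s) * exp (l\<^sup>2 * (t - s) / 2))"
proof (cases "s = t")
  case True
  then show ?thesis by (simp add: has_bochner_integral_iff)
next
  case False
  let ?\<sigma> = "sqrt (t - s)"
  have \<sigma>: "0 < ?\<sigma>" "?\<sigma>\<^sup>2 = t - s" using assms False by auto
  have D: "distributed M lborel (\<lambda>\<omega>. W t \<omega> - W s \<omega>) (normal_density 0 ?\<sigma>)"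
    using W_increment assms False by auto
  have eq: "normal_density 0 ?\<sigma> x * (x * exp (l * x))
      = exp (l\<^sup>2 * (t - s) / 2) * (normal_density (l * (t - s)) ?\<sigma> x * x)" for x
    using normal_density_exp_tilt[OF \<sigma>(1), of x l] \<sigma>(2) by (simp add: algebra_simps)
  have "integrable lborel (\<lambda>x. normal_density 0 ?\<sigma> x * (x * exp (l * x)))"
    unfolding eq by (intro integrable_mult_right integrable_normal_moment_nz_1 \<sigma>)
  then have "integrable M (\<lambda>\<omega>. (W t \<omega> - W s \<omega>) * exp (l * (W t \<omega> - W s \<omega>)))"
    by (subst distributed_integrable[OF D, symmetric]) auto
  moreover have "(\<integral>\<omega>. (W t \<omega> - W s \<omega>) * exp (l * (W t \<omega> - W s \<omega>)) \<partial>M)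
      = (\<integral>x. normal_density 0 ?\<sigma> x * (x * exp (l * x)) \<partial>lborel)"
    by (subst distributed_integral[OF D, symmetric]) auto
  ultimately show ?thesis
    using integral_normal_moment_nz_1[OF \<sigma>(1), of "l * (t - s)"]
    unfolding has_bochner_integral_iff eq by simp
qed

lemma increment_mean:
  assumes "0 \<le> s" "s \<le> t"
  shows "has_bochner_integral M (\<lambda>\<omega>. W t \<omega> - W s \<omega>) 0"
  using increment_exp_increment[OF assms, of 0] by simp

lemma increment_square:
  assumes "0 \<le> s" "s \<le> t"
  shows "has_bochner_integral M (\<lambda>\<omega>. (W t \<omega> - W s \<omega>)\<^sup>2) (t - s)"
proof (cases "s = t")
  case True
  then show ?thesis by (simp add: has_bochner_integral_iff)
next
  case False
  let ?\<sigma> = "sqrt (t - s)"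
  have \<sigma>: "0 < ?\<sigma>" "?\<sigma>\<^sup>2 = t - s" using assms False by auto
  have D: "distributed M lborel (\<lambda>\<omega>. W t \<omega> - W s \<omega>) (normal_density 0 ?\<sigma>)"
    using W_increment assms False by auto
  have "integrable lborel (\<lambda>x. normal_density 0 ?\<sigma> x * x\<^sup>2)"
    using integrable_normal_moment[OF \<sigma>(1), of 0 2] by simp
  then have "integrable M (\<lambda>\<omega>. (W t \<omega> - W s \<omega>)\<^sup>2)"
    by (subst distributed_integrable[OF D, symmetric]) auto
  moreover have "(\<integral>\<omega>. (W t \<omega> - W s \<omega>)\<^sup>2 \<partial>M) = (\<integral>x. normal_density 0 ?\<sigma> x * x\<^sup>2 \<partial>lborel)"
    by (subst distributed_integral[OF D, symmetric]) auto
  moreover have "(\<integral>x. normal_density 0 ?\<sigma> x * x\<^sup>2 \<partial>lborel) = t - s"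
    using integral_normal_moment_even[OF \<sigma>(1), of 0 1] \<sigma> assms by (simp add: fact_numeral)
  ultimately show ?thesis by (simp add: has_bochner_integral_iff)
qed

end

section \<open>Second moments\<close>

lemma ennreal_power2_add_le: "ennreal ((a + b)\<^sup>2) \<le> 2 * (ennreal (a\<^sup>2) + ennreal (b\<^sup>2))"
proof -
  have "(a + b)\<^sup>2 \<le> 2 * (a\<^sup>2 + b\<^sup>2)"
    using sum_squares_bound[of a b] by (simp add: power2_eq_square algebra_simps)
  then have "ennreal ((a + b)\<^sup>2) \<le> ennreal (2 * (a\<^sup>2 + b\<^sup>2))" by (rule ennreal_leI)
  then show ?thesis by (simp add: ennreal_mult ennreal_plus)
qed

lemma ennreal_power2_add3_le:
  "ennreal ((a + b + c)\<^sup>2) \<le> 3 * (ennreal (a\<^sup>2) + ennreal (b\<^sup>2) + ennreal (c\<^sup>2))"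
proof -
  have "(a + b + c)\<^sup>2 \<le> 3 * (a\<^sup>2 + b\<^sup>2 + c\<^sup>2)"
    using zero_le_power2[of "a - b"] zero_le_power2[of "a - c"] zero_le_power2[of "b - c"]
    by (simp add: power2_eq_square algebra_simps)
  then have "ennreal ((a + b + c)\<^sup>2) \<le> ennreal (3 * (a\<^sup>2 + b\<^sup>2 + c\<^sup>2))" by (rule ennreal_leI)
  then show ?thesis by (simp add: ennreal_mult ennreal_plus)
qed

lemma set_integral_power2_le:
  fixes f :: "real \<Rightarrow> real"
  assumes [measurable]: "(\<lambda>s. indicator {p..q} s * f s) \<in> borel_measurable lborel" and pq: "p \<le> q"
  shows "ennreal ((LBINT s:{p..q}. f s)\<^sup>2) \<le> ennreal (q - p) * (\<integral>\<^sup>+s\<in>{p..q}. ennreal ((f s)\<^sup>2) \<partial>lborel)"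
proof (cases "set_integrable lborel {p..q} f")
  case True
  let ?g = "\<lambda>s. indicator {p..q} s * f s"
  have int: "integrable lborel ?g" using True by (simp add: set_integrable_def)
  have "ennreal (norm (LBINT s:{p..q}. f s)) \<le> (\<integral>\<^sup>+s. norm (?g s) \<partial>lborel)"
    unfolding set_lebesgue_integral_def using integral_norm_bound_ennreal[OF int] by simp
  then have "(ennreal (norm (LBINT s:{p..q}. f s)))\<^sup>2 \<le> (\<integral>\<^sup>+s. norm (?g s) \<partial>lborel)\<^sup>2"
    by (rule power_mono) simp
  then have "ennreal ((LBINT s:{p..q}. f s)\<^sup>2) \<le> (\<integral>\<^sup>+s. norm (?g s) \<partial>lborel)\<^sup>2"
    by (simp add: ennreal_power)
  also have "(\<integral>\<^sup>+s. norm (?g s) \<partial>lborel) = (\<integral>\<^sup>+s. ennreal (norm (?g s)) * indicator {p..q} s \<partial>lborel)"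
    by (intro nn_integral_cong) (auto split: split_indicator)
  also have "\<dots>\<^sup>2 \<le> (\<integral>\<^sup>+s. (ennreal (norm (?g s)))\<^sup>2 \<partial>lborel) * (\<integral>\<^sup>+s. (indicator {p..q} s)\<^sup>2 \<partial>lborel)"
    by (rule Cauchy_Schwarz_nn_integral) auto
  also have "(\<integral>\<^sup>+s. (indicator {p..q} s)\<^sup>2 \<partial>lborel) = (\<integral>\<^sup>+s. indicator {p..q} s \<partial>lborel)"
    by (intro nn_integral_cong) (auto split: split_indicator)
  also have "\<dots> = ennreal (q - p)" using pq by simp
  also have "(\<integral>\<^sup>+s. (ennreal (norm (?g s)))\<^sup>2 \<partial>lborel) = (\<integral>\<^sup>+s\<in>{p..q}. ennreal ((f s)\<^sup>2) \<partial>lborel)"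
    by (intro nn_integral_cong) (auto split: split_indicator simp: ennreal_power)
  finally show ?thesis by (simp add: mult.commute)
next
  case False
  \<comment> \<open>The default value 0 of a non-existing integral makes the bound hold for every
    measurable path, so that it can be integrated over \<omega> at once.\<close>
  then have "(LBINT s:{p..q}. f s) = 0"
    unfolding set_lebesgue_integral_def set_integrable_def by (rule not_integrable_integral_eq)
  then show ?thesis by simp
qed

text \<open>Valued in \<open>ennreal\<close> so that estimates can be chained before finiteness is
  known. The measure is an argument because second moments are also taken over the product of time
  and probability space.\<close>

definition msq :: "'a measure \<Rightarrow> ('a \<Rightarrow> real) \<Rightarrow> ennreal" where
  "msq M f = (\<integral>\<^sup>+\<omega>. ennreal ((f \<omega>)\<^sup>2) \<partial>M)"

lemma msq_cong_AE: "AE \<omega> in M. f \<omega> = g \<omega> \<Longrightarrow> msq M f = msq M g"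
  unfolding msq_def by (rule nn_integral_cong_AE) auto

lemma msq_eq_0_iff: "f \<in> borel_measurable M \<Longrightarrow> msq M f = 0 \<longleftrightarrow> (AE \<omega> in M. f \<omega> = 0)"
  unfolding msq_def by (subst nn_integral_0_iff_AE) auto

lemma msq_minus_commute: "msq M (\<lambda>\<omega>. f \<omega> - g \<omega>) = msq M (\<lambda>\<omega>. g \<omega> - f \<omega>)"
  by (simp add: msq_def power2_commute)

lemma msq_cmult:
  "f \<in> borel_measurable M \<Longrightarrow> msq M (\<lambda>\<omega>. c * f \<omega>) = ennreal (c\<^sup>2) * msq M f"
  unfolding msq_def by (subst nn_integral_cmult[symmetric]) (auto simp: power_mult_distrib ennreal_mult)

lemma msq_add:
  assumes [measurable]: "f \<in> borel_measurable M" "g \<in> borel_measurable M"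
  shows "msq M (\<lambda>\<omega>. f \<omega> + g \<omega>) \<le> 2 * (msq M f + msq M g)"
proof -
  have "msq M (\<lambda>\<omega>. f \<omega> + g \<omega>) \<le> (\<integral>\<^sup>+\<omega>. 2 * (ennreal ((f \<omega>)\<^sup>2) + ennreal ((g \<omega>)\<^sup>2)) \<partial>M)"
    unfolding msq_def by (intro nn_integral_mono ennreal_power2_add_le)
  also have "\<dots> = 2 * (msq M f + msq M g)"
    unfolding msq_def by (simp add: nn_integral_cmult nn_integral_add)
  finally show ?thesis .
qed

lemma msq_add3:
  assumes [measurable]: "f \<in> borel_measurable M" "g \<in> borel_measurable M" "h \<in> borel_measurable M"
  shows "msq M (\<lambda>\<omega>. f \<omega> + g \<omega> + h \<omega>) \<le> 3 * (msq M f + msq M g + msq M h)"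
proof -
  have "msq M (\<lambda>\<omega>. f \<omega> + g \<omega> + h \<omega>)
      \<le> (\<integral>\<^sup>+\<omega>. 3 * (ennreal ((f \<omega>)\<^sup>2) + ennreal ((g \<omega>)\<^sup>2) + ennreal ((h \<omega>)\<^sup>2)) \<partial>M)"
    unfolding msq_def by (intro nn_integral_mono ennreal_power2_add3_le)
  also have "\<dots> = 3 * (msq M f + msq M g + msq M h)"
    unfolding msq_def by (simp add: nn_integral_cmult nn_integral_add)
  finally show ?thesis .
qed

lemma msq_sum:
  fixes f :: "nat \<Rightarrow> 'a \<Rightarrow> real"
  assumes "\<And>i. i < n \<Longrightarrow> f i \<in> borel_measurable M"
  shows "msq M (\<lambda>\<omega>. \<Sum>i<n. f i \<omega>) \<le> ennreal (real n) * (\<Sum>i<n. msq M (f i))"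
proof -
  have "ennreal ((\<Sum>i<n. f i \<omega>)\<^sup>2) \<le> ennreal (real n) * (\<Sum>i<n. ennreal ((f i \<omega>)\<^sup>2))" for \<omega>
  proof -
    have "(\<Sum>i<n. f i \<omega>)\<^sup>2 \<le> real n * (\<Sum>i<n. (f i \<omega>)\<^sup>2)"
      using sum_squared_le_sum_of_squares[of "\<lambda>i. f i \<omega>" "{..<n}"] by (simp add: mult.commute)
    then have "ennreal ((\<Sum>i<n. f i \<omega>)\<^sup>2) \<le> ennreal (real n * (\<Sum>i<n. (f i \<omega>)\<^sup>2))" by (rule ennreal_leI)
    then show ?thesis by (simp add: ennreal_mult sum_nonneg)
  qed
  then have "msq M (\<lambda>\<omega>. \<Sum>i<n. f i \<omega>) \<le> (\<integral>\<^sup>+\<omega>. ennreal (real n) * (\<Sum>i<n. ennreal ((f i \<omega>)\<^sup>2)) \<partial>M)"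
    unfolding msq_def by (intro nn_integral_mono)
  also have "\<dots> = ennreal (real n) * (\<Sum>i<n. msq M (f i))"
    unfolding msq_def using assms
    by (subst nn_integral_cmult) (auto simp del: sum_ennreal intro!: arg_cong2[where f="(*)"] nn_integral_sum)
  finally show ?thesis .
qed

lemma integrable_power2_iff_msq:
  "f \<in> borel_measurable M \<Longrightarrow> integrable M (\<lambda>\<omega>. (f \<omega>)\<^sup>2) \<longleftrightarrow> msq M f < \<infinity>"
  unfolding msq_def by (subst integrable_iff_bounded) auto

lemma integrable_mult_msq:
  assumes [measurable]: "f \<in> borel_measurable M" "g \<in> borel_measurable M"
    and "msq M f < \<infinity>" "msq M g < \<infinity>"
  shows "integrable M (\<lambda>\<omega>. f \<omega> * g \<omega> :: real)"
proof (rule Bochner_Integration.integrable_bound)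
  show "integrable M (\<lambda>\<omega>. (f \<omega>)\<^sup>2 + (g \<omega>)\<^sup>2)"
    using assms by (intro Bochner_Integration.integrable_add) (auto simp: integrable_power2_iff_msq)
  have "\<bar>a * b\<bar> \<le> \<bar>a\<^sup>2 + b\<^sup>2\<bar>" for a b :: real
    using sum_squares_bound[of a b] sum_squares_bound[of a "- b"] by (auto simp: abs_if)
  then show "AE \<omega> in M. norm (f \<omega> * g \<omega>) \<le> norm ((f \<omega>)\<^sup>2 + (g \<omega>)\<^sup>2)" by simp
qed simp

lemma msq_eq_integral:
  assumes "f \<in> borel_measurable M" "msq M f < \<infinity>"
  shows "msq M f = ennreal (\<integral>\<omega>. (f \<omega>)\<^sup>2 \<partial>M)"
  using assms unfolding msq_def
  by (intro nn_integral_eq_integral) (auto simp: integrable_power2_iff_msq msq_def)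

lemma (in pair_sigma_finite) nn_integral_swap_set:
  fixes f :: "'a \<Rightarrow> 'b \<Rightarrow> real"
  assumes [measurable]: "(\<lambda>z. indicator A (fst z) * f (fst z) (snd z)) \<in> borel_measurable (M1 \<Otimes>\<^sub>M M2)"
  shows "(\<integral>\<^sup>+\<omega>. (\<integral>\<^sup>+s\<in>A. ennreal ((f s \<omega>)\<^sup>2) \<partial>M1) \<partial>M2) = (\<integral>\<^sup>+s\<in>A. msq M2 (f s) \<partial>M1)"
proof -
  have eq: "ennreal ((f s \<omega>)\<^sup>2) * indicator A s = ennreal ((indicator A s * f s \<omega>)\<^sup>2)" for s \<omega>
    by (auto split: split_indicator)
  have "(\<integral>\<^sup>+\<omega>. (\<integral>\<^sup>+s\<in>A. ennreal ((f s \<omega>)\<^sup>2) \<partial>M1) \<partial>M2)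
      = (\<integral>\<^sup>+s. (\<integral>\<^sup>+\<omega>. ennreal ((indicator A s * f s \<omega>)\<^sup>2) \<partial>M2) \<partial>M1)"
    unfolding eq by (rule Fubini') (simp add: case_prod_beta')
  also have "\<dots> = (\<integral>\<^sup>+s\<in>A. msq M2 (f s) \<partial>M1)"
    by (intro nn_integral_cong) (auto simp: msq_def split: split_indicator)
  finally show ?thesis .
qed

context prob_space
begin

text \<open>The cutoff is part of the notion because \<open>progressive\<close> says nothing about
  negative times.\<close>

abbreviation jointly_measurable :: "real set \<Rightarrow> (real \<Rightarrow> 'a \<Rightarrow> real) \<Rightarrow> bool" where
  "jointly_measurable A f \<equiv>
    (\<lambda>z. indicator A (fst z) * f (fst z) (snd z)) \<in> borel_measurable (lborel \<Otimes>\<^sub>M M)"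

lemma pair_sigma_finite_lborel: "pair_sigma_finite (lborel :: real measure) M"
  by (intro pair_sigma_finite.intro lborel.sigma_finite_measure_axioms sigma_finite_measure_axioms)

lemma integrable_msq:
  assumes "f \<in> borel_measurable M" "msq M f < \<infinity>"
  shows "integrable M f"
  using square_integrable_imp_integrable[OF assms(1)] integrable_power2_iff_msq[OF assms(1)] assms(2)
  by simp

lemma joint_measurable_mono:
  fixes f :: "real \<Rightarrow> 'a \<Rightarrow> real"
  assumes f: "jointly_measurable A f"
    and "B \<subseteq> A" and [measurable]: "B \<in> sets borel"
  shows "jointly_measurable B f"
proof -
  note f[measurable]
  have "(\<lambda>z. indicator B (fst z) * (indicator A (fst z) * f (fst z) (snd z))) \<in> borel_measurable (lborel \<Otimes>\<^sub>M M)"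
    by measurable
  also have "(\<lambda>z. indicator B (fst z) * (indicator A (fst z) * f (fst z) (snd z)))
      = (\<lambda>z. indicator B (fst z) * f (fst z) (snd z))"
    using \<open>B \<subseteq> A\<close> by (auto simp: fun_eq_iff split: split_indicator)
  finally show ?thesis .
qed

lemma joint_measurable_section1:
  fixes f :: "real \<Rightarrow> 'a \<Rightarrow> real"
  assumes "jointly_measurable A f" "\<omega> \<in> space M"
  shows "(\<lambda>s. indicator A s * f s \<omega>) \<in> borel_measurable lborel"
  using measurable_compose[OF measurable_Pair2' assms(1), of \<omega>] assms(2) by simp

text \<open>Cauchy-Schwarz in time along each path, then Tonelli. The factor \<open>q - p\<close> is
  what later makes drift errors small on a short interval.\<close>

lemma msq_set_integral_le:
  assumes f: "jointly_measurable {p..q} f"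
    and pq: "p \<le> q"
  shows "msq M (\<lambda>\<omega>. LBINT s:{p..q}. f s \<omega>) \<le> ennreal (q - p) * (\<integral>\<^sup>+s\<in>{p..q}. msq M (f s) \<partial>lborel)"
proof -
  interpret P: pair_sigma_finite "lborel :: real measure" M by (rule pair_sigma_finite_lborel)
  note f[measurable]
  have eq: "ennreal ((f s \<omega>)\<^sup>2) * indicator {p..q} s = ennreal ((indicator {p..q} s * f s \<omega>)\<^sup>2)" for s \<omega>
    by (auto split: split_indicator)
  have "msq M (\<lambda>\<omega>. LBINT s:{p..q}. f s \<omega>)
      \<le> (\<integral>\<^sup>+\<omega>. ennreal (q - p) * (\<integral>\<^sup>+s\<in>{p..q}. ennreal ((f s \<omega>)\<^sup>2) \<partial>lborel) \<partial>M)"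
    unfolding msq_def
    by (intro nn_integral_mono set_integral_power2_le joint_measurable_section1[OF f] pq)
  also have "\<dots> = ennreal (q - p) * (\<integral>\<^sup>+\<omega>. (\<integral>\<^sup>+s\<in>{p..q}. ennreal ((f s \<omega>)\<^sup>2) \<partial>lborel) \<partial>M)"
  proof -
    have "(\<lambda>(\<omega>, s). ennreal ((indicator {p..q} s * f s \<omega>)\<^sup>2)) \<in> borel_measurable (M \<Otimes>\<^sub>M lborel)"
      using measurable_compose[OF measurable_pair_swap' f] by (simp add: case_prod_beta')
    then show ?thesis
      unfolding eq by (intro nn_integral_cmult lborel.borel_measurable_nn_integral) auto
  qed
  also have "\<dots> = ennreal (q - p) * (\<integral>\<^sup>+s\<in>{p..q}. msq M (f s) \<partial>lborel)"
    by (subst P.nn_integral_swap_set[OF f]) simp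
  finally show ?thesis .
qed

end

section \<open>Progressive measurability and joint measurability in time and \<omega>\<close>

context brownian_space
begin

text \<open>Clamping time to \<open>[0,T]\<close> replaces the restricted Borel space by the full
  one, so that the usual closure rules for measurable functions apply directly.\<close>

lemma progressive_iff_clamp:
  "progressive M W \<phi> \<longleftrightarrow>
     (\<forall>T\<ge>0. (\<lambda>z. \<phi> (max 0 (min (fst z) T)) (snd z)) \<in> borel_measurable (borel \<Otimes>\<^sub>M F T))"
  unfolding progressive_def
proof (intro all_cong1 imp_cong refl iffI)
  fix T :: real assume T: "0 \<le> T"
  { assume *: "(\<lambda>(t, \<omega>). \<phi> t \<omega>) \<in> borel_measurable (restrict_space borel {0..T} \<Otimes>\<^sub>M F T)"
    have "(\<lambda>z. (max 0 (min (fst z) T), snd z)) \<in> measurable (borel \<Otimes>\<^sub>M F T) (restrict_space borel {0..T} \<Otimes>\<^sub>M F T)"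
      using T by (intro measurable_Pair measurable_restrict_space2) auto
    from measurable_compose[OF this *]
    show "(\<lambda>z. \<phi> (max 0 (min (fst z) T)) (snd z)) \<in> borel_measurable (borel \<Otimes>\<^sub>M F T)" by simp }
  { assume *: "(\<lambda>z. \<phi> (max 0 (min (fst z) T)) (snd z)) \<in> borel_measurable (borel \<Otimes>\<^sub>M F T)"
    have "(\<lambda>z. (fst z, snd z)) \<in> measurable (restrict_space borel {0..T} \<Otimes>\<^sub>M F T) (borel \<Otimes>\<^sub>M F T)"
      by (intro measurable_Pair measurable_compose[OF measurable_fst] measurable_restrict_space1) auto
    from measurable_compose[OF this *]
    show "(\<lambda>(t, \<omega>). \<phi> t \<omega>) \<in> borel_measurable (restrict_space borel {0..T} \<Otimes>\<^sub>M F T)"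
      by (rule measurable_cong[THEN iffD1, rotated])
         (auto simp: space_pair_measure space_restrict_space min_def max_def) }
qed

lemma measurable_pair_F_M:
  assumes "f \<in> measurable (borel \<Otimes>\<^sub>M F T) N"
  shows "f \<in> measurable (lborel \<Otimes>\<^sub>M M) N"
proof -
  have "(\<lambda>\<omega>. \<omega>) \<in> measurable M (F T)"
    using sets_F_subset[of T] sets.sets_into_space by (intro measurableI) auto
  then have "(\<lambda>z. (fst z, snd z)) \<in> measurable (lborel \<Otimes>\<^sub>M M) (borel \<Otimes>\<^sub>M F T)"
    by (intro measurable_Pair measurable_compose[OF measurable_snd]) auto
  from measurable_compose[OF this assms] show ?thesis by simp
qed

text \<open>Pointwise limit of the processes clamped at horizon \<open>n\<close>; at a fixed time
  the sequence is eventually constant.\<close>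

lemma progressive_joint_measurable:
  assumes "progressive M W \<phi>"
  shows "jointly_measurable {0..} \<phi>"
proof (rule borel_measurable_LIMSEQ_real)
  fix n :: nat
  have "(\<lambda>z. \<phi> (max 0 (min (fst z) (real n))) (snd z)) \<in> borel_measurable (lborel \<Otimes>\<^sub>M M)"
    using assms by (intro measurable_pair_F_M[of _ "real n"]) (simp add: progressive_iff_clamp)
  note [measurable] = this
  show "(\<lambda>z. indicator {0..real n} (fst z) * \<phi> (max 0 (min (fst z) (real n))) (snd z)) \<in> borel_measurable (lborel \<Otimes>\<^sub>M M)"
    by measurable
next
  fix z :: "real \<times> 'a"
  obtain N where "fst z \<le> real N" using real_arch_simple by blast
  then have "eventually (\<lambda>n. indicator {0..real n} (fst z) * \<phi> (max 0 (min (fst z) (real n))) (snd z)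
      = indicator {0..} (fst z) * \<phi> (fst z) (snd z)) sequentially"
    by (intro eventually_sequentiallyI[of N]) (auto split: split_indicator simp: min_def max_def)
  then show "(\<lambda>n. indicator {0..real n} (fst z) * \<phi> (max 0 (min (fst z) (real n))) (snd z))
      \<longlonglongrightarrow> indicator {0..} (fst z) * \<phi> (fst z) (snd z)"
    by (rule tendsto_eventually)
qed

lemma progressive_measurable_F:
  assumes "progressive M W \<phi>" "0 \<le> t"
  shows "\<phi> t \<in> borel_measurable (F t)"
proof -
  have "(\<lambda>z. \<phi> (max 0 (min (fst z) t)) (snd z)) \<in> borel_measurable (borel \<Otimes>\<^sub>M F t)"
    using assms by (simp add: progressive_iff_clamp)
  from measurable_compose[OF measurable_Pair1'[of t borel "F t"] this] assms(2) show ?thesis by simp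
qed

lemma progressive_measurable: "progressive M W \<phi> \<Longrightarrow> 0 \<le> t \<Longrightarrow> \<phi> t \<in> borel_measurable M"
  by (rule measurable_F_M[OF progressive_measurable_F])

lemma progressive_linear:
  "progressive M W \<phi> \<Longrightarrow> progressive M W \<psi> \<Longrightarrow> progressive M W (\<lambda>t \<omega>. a * \<phi> t \<omega> + b * \<psi> t \<omega>)"
  unfolding progressive_iff_clamp
  by (intro allI impI borel_measurable_add borel_measurable_times borel_measurable_const) blast+


section \<open>The isometry for elementary integrals\<close>

lemma msq_mult_increment:
  assumes "0 \<le> s" "s \<le> t" and "\<xi> \<in> borel_measurable (F s)" and [measurable]: "f \<in> borel_measurable borel"
  shows "msq M (\<lambda>\<omega>. \<xi> \<omega> * f (W t \<omega> - W s \<omega>)) = msq M \<xi> * msq M (\<lambda>\<omega>. f (W t \<omega> - W s \<omega>))"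
  using nn_integral_increment[OF assms(1-3), of "\<lambda>x. ennreal (x\<^sup>2)" "\<lambda>x. ennreal ((f x)\<^sup>2)"]
  by (simp add: msq_def power_mult_distrib ennreal_mult)

lemma msq_increment:
  assumes "0 \<le> s" "s \<le> t"
  shows "msq M (\<lambda>\<omega>. W t \<omega> - W s \<omega>) = ennreal (t - s)"
  using increment_square[OF assms] by (simp add: msq_def has_bochner_integral_iff nn_integral_eq_integral)

lemma increment_measurable_F [measurable (raw)]:
  "0 \<le> s \<Longrightarrow> s \<le> r \<Longrightarrow> 0 \<le> t \<Longrightarrow> t \<le> r \<Longrightarrow> (\<lambda>\<omega>. W t \<omega> - W s \<omega>) \<in> borel_measurable (F r)"
  by (intro borel_measurable_diff W_measurable_F)

lemma mult_increment_L2: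
  assumes "0 \<le> s" "s \<le> t" "t \<le> r" and \<xi>: "\<xi> \<in> borel_measurable (F s)" "msq M \<xi> < \<infinity>"
  shows "(\<lambda>\<omega>. \<xi> \<omega> * (W t \<omega> - W s \<omega>)) \<in> borel_measurable (F r)"
    and "msq M (\<lambda>\<omega>. \<xi> \<omega> * (W t \<omega> - W s \<omega>)) < \<infinity>"
proof -
  show "(\<lambda>\<omega>. \<xi> \<omega> * (W t \<omega> - W s \<omega>)) \<in> borel_measurable (F r)"
    using assms by (intro borel_measurable_times increment_measurable_F measurable_F_mono[OF _ \<xi>(1)]) auto
  show "msq M (\<lambda>\<omega>. \<xi> \<omega> * (W t \<omega> - W s \<omega>)) < \<infinity>"
    using msq_mult_increment[OF assms(1,2) \<xi>(1), of "\<lambda>x. x"] \<xi>(2) msq_increment[OF assms(1,2)]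
    by (simp add: ennreal_mult_less_top)
qed

lemma has_bochner_integral_mult_increment_0:
  assumes "0 \<le> s" "s \<le> t" and "\<xi> \<in> borel_measurable (F s)" "integrable M \<xi>"
  shows "has_bochner_integral M (\<lambda>\<omega>. \<xi> \<omega> * (W t \<omega> - W s \<omega>)) 0"
  using integrable_mult_increment[OF assms(1-3), of "\<lambda>x. x"] expectation_mult_increment[OF assms(1-3), of "\<lambda>x. x"]
    increment_mean[OF assms(1,2)] assms(4) by (auto simp: has_bochner_integral_iff)

text \<open>Independence of the last increment from everything before it annihilates every product
  except the square over the common part of the two intervals, whose mean is the length of the
  overlap.\<close>

lemma increment_product_aux:
  assumes s: "0 \<le> s1" "s1 \<le> s2" "s1 \<le> t1" "s2 \<le> t2"
    and \<xi>: "\<xi> \<in> borel_measurable (F s1)" "msq M \<xi> < \<infinity>"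
    and \<eta>: "\<eta> \<in> borel_measurable (F s2)" "msq M \<eta> < \<infinity>"
  shows "has_bochner_integral M (\<lambda>\<omega>. \<xi> \<omega> * (W t1 \<omega> - W s1 \<omega>) * (\<eta> \<omega> * (W t2 \<omega> - W s2 \<omega>)))
     ((\<integral>\<omega>. \<xi> \<omega> * \<eta> \<omega> \<partial>M) * measure lborel ({s1<..t1} \<inter> {s2<..t2}))"
proof (cases "t1 \<le> s2")
  case True
  have "has_bochner_integral M (\<lambda>\<omega>. (\<xi> \<omega> * (W t1 \<omega> - W s1 \<omega>) * \<eta> \<omega>) * (W t2 \<omega> - W s2 \<omega>)) 0"
  proof (rule has_bochner_integral_mult_increment_0)
    note L = mult_increment_L2[OF s(1,3) True \<xi>]
    show "(\<lambda>\<omega>. \<xi> \<omega> * (W t1 \<omega> - W s1 \<omega>) * \<eta> \<omega>) \<in> borel_measurable (F s2)"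
      using L(1) \<eta>(1) by (rule borel_measurable_times)
    show "integrable M (\<lambda>\<omega>. \<xi> \<omega> * (W t1 \<omega> - W s1 \<omega>) * \<eta> \<omega>)"
      using L \<eta> by (intro integrable_mult_msq measurable_F_M[of _ s2]) auto
  qed (use s in auto)
  moreover have "{s1<..t1} \<inter> {s2<..t2} = {}" using True by auto
  then have "measure lborel ({s1<..t1} \<inter> {s2<..t2}) = 0" by (simp only: measure_empty)
  ultimately show ?thesis by (simp only: mult_zero_right mult.assoc)
next
  case False
  \<comment> \<open>The first increment is cut at \<open>s2\<close>. Past that point the two
    increments start together and end at \<open>r\<close> and \<open>R\<close>, so their product is
    the square of the increment up to \<open>r\<close> plus a centred term over the rest. Only
    summand 2 below has a nonzero mean.\<close>
  define r where "r = min t1 t2"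
  define R where "R = max t1 t2"
  have r: "s2 \<le> r" "r \<le> R" "0 \<le> s2" "0 \<le> r" using s False by (auto simp: r_def R_def)
  note \<xi>2 = measurable_F_mono[OF s(2) \<xi>(1)]
  have int: "integrable M (\<lambda>\<omega>. \<xi> \<omega> * \<eta> \<omega>)"
    using \<xi> \<eta> by (intro integrable_mult_msq measurable_F_M) auto
  have 1: "has_bochner_integral M (\<lambda>\<omega>. (\<xi> \<omega> * (W s2 \<omega> - W s1 \<omega>) * \<eta> \<omega>) * (W t2 \<omega> - W s2 \<omega>)) 0"
  proof (rule has_bochner_integral_mult_increment_0)
    note L = mult_increment_L2[OF s(1,2) order_refl \<xi>]
    show "(\<lambda>\<omega>. \<xi> \<omega> * (W s2 \<omega> - W s1 \<omega>) * \<eta> \<omega>) \<in> borel_measurable (F s2)"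
      using L(1) \<eta>(1) by (rule borel_measurable_times)
    show "integrable M (\<lambda>\<omega>. \<xi> \<omega> * (W s2 \<omega> - W s1 \<omega>) * \<eta> \<omega>)"
      using L \<eta> by (intro integrable_mult_msq measurable_F_M[of _ s2]) auto
  qed (use s in auto)
  have 2: "has_bochner_integral M (\<lambda>\<omega>. (\<xi> \<omega> * \<eta> \<omega>) * (W r \<omega> - W s2 \<omega>)\<^sup>2) ((\<integral>\<omega>. \<xi> \<omega> * \<eta> \<omega> \<partial>M) * (r - s2))"
  proof -
    have m: "(\<lambda>\<omega>. \<xi> \<omega> * \<eta> \<omega>) \<in> borel_measurable (F s2)"
      using \<xi>2 \<eta>(1) by (rule borel_measurable_times)
    note sq = increment_square[OF r(3,1), unfolded has_bochner_integral_iff]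
    show ?thesis
      using expectation_mult_increment[OF r(3,1) m, of "\<lambda>x. x\<^sup>2"] integrable_mult_increment[OF r(3,1) m, of "\<lambda>x. x\<^sup>2"] int sq
      by (simp add: has_bochner_integral_iff)
  qed
  have 3: "has_bochner_integral M (\<lambda>\<omega>. (\<xi> \<omega> * (W r \<omega> - W s2 \<omega>) * \<eta> \<omega>) * (W R \<omega> - W r \<omega>)) 0"
  proof (rule has_bochner_integral_mult_increment_0)
    note L = mult_increment_L2[OF r(3,1) order_refl \<xi>2 \<xi>(2)]
    show "(\<lambda>\<omega>. \<xi> \<omega> * (W r \<omega> - W s2 \<omega>) * \<eta> \<omega>) \<in> borel_measurable (F r)"
      using L(1) measurable_F_mono[OF r(1) \<eta>(1)] by (rule borel_measurable_times)
    show "integrable M (\<lambda>\<omega>. \<xi> \<omega> * (W r \<omega> - W s2 \<omega>) * \<eta> \<omega>)"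
      using L \<eta> measurable_F_mono[OF r(1) \<eta>(1)] by (intro integrable_mult_msq measurable_F_M[of _ r]) auto
  qed (use r in auto)
  have "has_bochner_integral M (\<lambda>\<omega>. (\<xi> \<omega> * (W s2 \<omega> - W s1 \<omega>) * \<eta> \<omega>) * (W t2 \<omega> - W s2 \<omega>) +
      (\<xi> \<omega> * \<eta> \<omega>) * (W r \<omega> - W s2 \<omega>)\<^sup>2 + (\<xi> \<omega> * (W r \<omega> - W s2 \<omega>) * \<eta> \<omega>) * (W R \<omega> - W r \<omega>))
      (0 + (\<integral>\<omega>. \<xi> \<omega> * \<eta> \<omega> \<partial>M) * (r - s2) + 0)"
    by (intro has_bochner_integral_add 1 2 3)
  moreover have "(\<xi> \<omega> * (W s2 \<omega> - W s1 \<omega>) * \<eta> \<omega>) * (W t2 \<omega> - W s2 \<omega>) +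
      (\<xi> \<omega> * \<eta> \<omega>) * (W r \<omega> - W s2 \<omega>)\<^sup>2 + (\<xi> \<omega> * (W r \<omega> - W s2 \<omega>) * \<eta> \<omega>) * (W R \<omega> - W r \<omega>)
      = \<xi> \<omega> * (W t1 \<omega> - W s1 \<omega>) * (\<eta> \<omega> * (W t2 \<omega> - W s2 \<omega>))" for \<omega>
    by (cases "t1 \<le> t2") (simp_all add: r_def R_def power2_eq_square algebra_simps)
  moreover have "{s1<..t1} \<inter> {s2<..t2} = {s2<..r}" using s False by (auto simp: r_def)
  ultimately show ?thesis using r by simp
qed

lemma increment_product:
  assumes s: "0 \<le> s1" "0 \<le> s2" "s1 \<le> t1" "s2 \<le> t2"
    and \<xi>: "\<xi> \<in> borel_measurable (F s1)" "msq M \<xi> < \<infinity>"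
    and \<eta>: "\<eta> \<in> borel_measurable (F s2)" "msq M \<eta> < \<infinity>"
  shows "has_bochner_integral M (\<lambda>\<omega>. \<xi> \<omega> * (W t1 \<omega> - W s1 \<omega>) * (\<eta> \<omega> * (W t2 \<omega> - W s2 \<omega>)))
     ((\<integral>\<omega>. \<xi> \<omega> * \<eta> \<omega> \<partial>M) * measure lborel ({s1<..t1} \<inter> {s2<..t2}))"
proof (cases "s1 \<le> s2")
  case True
  then show ?thesis using assms by (intro increment_product_aux) auto
next
  case False
  then show ?thesis
    using increment_product_aux[of s2 s1 t2 t1 \<eta> \<xi>] assms by (simp add: mult.commute Int_commute)
qed

text \<open>The intervals may overlap arbitrarily, so the difference of two elementary integrals over
  different partitions is covered without a common refinement.\<close>

lemma isometry:
  fixes I :: "'i set"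
  assumes I: "finite I"
    and st: "\<And>i. i \<in> I \<Longrightarrow> 0 \<le> s i \<and> s i \<le> t i"
    and \<xi>: "\<And>i. i \<in> I \<Longrightarrow> \<xi> i \<in> borel_measurable (F (s i))" "\<And>i. i \<in> I \<Longrightarrow> msq M (\<xi> i) < \<infinity>"
  shows "msq M (\<lambda>\<omega>. \<Sum>i\<in>I. \<xi> i \<omega> * (W (t i) \<omega> - W (s i) \<omega>))
    = (\<integral>\<^sup>+\<omega>. (\<integral>\<^sup>+r. ennreal ((\<Sum>i\<in>I. \<xi> i \<omega> * indicator {s i<..t i} r)\<^sup>2) \<partial>lborel) \<partial>M)"
proof -
  \<comment> \<open>Expanding the squares turns both sides into the same double sum
    \<open>v\<close>: the overlap length is the integral of a product of indicators and also the
    factor contributed by a product of increments.\<close>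
  define L where "L i j = measure lborel ({s i<..t i} \<inter> {s j<..t j})" for i j
  define v where "v = (\<Sum>i\<in>I. \<Sum>j\<in>I. (\<integral>\<omega>. \<xi> i \<omega> * \<xi> j \<omega> \<partial>M) * L i j)"
  have "has_bochner_integral M (\<lambda>\<omega>. \<Sum>i\<in>I. \<Sum>j\<in>I. \<xi> i \<omega> * (W (t i) \<omega> - W (s i) \<omega>) * (\<xi> j \<omega> * (W (t j) \<omega> - W (s j) \<omega>))) v"
    unfolding v_def L_def using st \<xi>
    by (intro has_bochner_integral_sum increment_product) auto
  then have "has_bochner_integral M (\<lambda>\<omega>. (\<Sum>i\<in>I. \<xi> i \<omega> * (W (t i) \<omega> - W (s i) \<omega>))\<^sup>2) v"
    by (simp add: power2_eq_square sum_product)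
  then have 1: "msq M (\<lambda>\<omega>. \<Sum>i\<in>I. \<xi> i \<omega> * (W (t i) \<omega> - W (s i) \<omega>)) = ennreal v"
    unfolding msq_def has_bochner_integral_iff by (subst nn_integral_eq_integral) auto
  have in2: "(\<integral>\<^sup>+r. ennreal ((\<Sum>i\<in>I. \<xi> i \<omega> * indicator {s i<..t i} r)\<^sup>2) \<partial>lborel)
      = ennreal (\<Sum>i\<in>I. \<Sum>j\<in>I. (\<xi> i \<omega> * \<xi> j \<omega>) * L i j)"
    and nn: "0 \<le> (\<Sum>i\<in>I. \<Sum>j\<in>I. (\<xi> i \<omega> * \<xi> j \<omega>) * L i j)" for \<omega>
  proof -
    have em: "emeasure lborel ({s i<..t i} \<inter> {s j<..t j}) < \<infinity>" for i j
      by (rule le_less_trans[OF emeasure_mono[of _ "{s i..t i}"]]) (auto simp: emeasure_lborel_Icc_eq)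
    have "has_bochner_integral lborel (\<lambda>r. \<Sum>i\<in>I. \<Sum>j\<in>I. (\<xi> i \<omega> * \<xi> j \<omega>) * indicator ({s i<..t i} \<inter> {s j<..t j}) r)
       (\<Sum>i\<in>I. \<Sum>j\<in>I. (\<xi> i \<omega> * \<xi> j \<omega>) * L i j)"
      unfolding L_def
      by (intro has_bochner_integral_sum has_bochner_integral_mult_right has_bochner_integral_real_indicator em) auto
    then have *: "has_bochner_integral lborel (\<lambda>r. (\<Sum>i\<in>I. \<xi> i \<omega> * indicator {s i<..t i} r)\<^sup>2)
       (\<Sum>i\<in>I. \<Sum>j\<in>I. (\<xi> i \<omega> * \<xi> j \<omega>) * L i j)"
      by (simp add: power2_eq_square sum_product indicator_inter_arith mult_ac del: Int_greaterThanAtMost)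
    then show "(\<integral>\<^sup>+r. ennreal ((\<Sum>i\<in>I. \<xi> i \<omega> * indicator {s i<..t i} r)\<^sup>2) \<partial>lborel)
      = ennreal (\<Sum>i\<in>I. \<Sum>j\<in>I. (\<xi> i \<omega> * \<xi> j \<omega>) * L i j)"
      unfolding has_bochner_integral_iff by (subst nn_integral_eq_integral) auto
    show "0 \<le> (\<Sum>i\<in>I. \<Sum>j\<in>I. (\<xi> i \<omega> * \<xi> j \<omega>) * L i j)"
    proof -
      have "0 \<le> (\<integral>r. (\<Sum>i\<in>I. \<xi> i \<omega> * indicator {s i<..t i} r)\<^sup>2 \<partial>lborel)"
        by (rule Bochner_Integration.integral_nonneg) simp
      also have "\<dots> = (\<Sum>i\<in>I. \<Sum>j\<in>I. (\<xi> i \<omega> * \<xi> j \<omega>) * L i j)"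
        using * by (rule has_bochner_integral_integral_eq)
      finally show ?thesis .
    qed
  qed
  have "has_bochner_integral M (\<lambda>\<omega>. \<Sum>i\<in>I. \<Sum>j\<in>I. (\<xi> i \<omega> * \<xi> j \<omega>) * L i j) v"
    unfolding v_def
  proof (intro has_bochner_integral_sum has_bochner_integral_mult_left)
    fix i j assume "i \<in> I" "j \<in> I"
    then show "has_bochner_integral M (\<lambda>\<omega>. \<xi> i \<omega> * \<xi> j \<omega>) (\<integral>\<omega>. \<xi> i \<omega> * \<xi> j \<omega> \<partial>M)"
      using \<xi> by (intro has_bochner_integral_integrable integrable_mult_msq measurable_F_M) auto
  qed
  then have "(\<integral>\<^sup>+\<omega>. ennreal (\<Sum>i\<in>I. \<Sum>j\<in>I. (\<xi> i \<omega> * \<xi> j \<omega>) * L i j) \<partial>M) = ennreal v"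
    unfolding has_bochner_integral_iff using nn by (subst nn_integral_eq_integral) auto
  then show ?thesis unfolding 1 in2 by simp
qed

lemma isometry_Icc:
  fixes I :: "'i set"
  assumes I: "finite I"
    and st: "\<And>i. i \<in> I \<Longrightarrow> 0 \<le> s i \<and> s i \<le> t i \<and> t i \<le> T"
    and \<xi>: "\<And>i. i \<in> I \<Longrightarrow> \<xi> i \<in> borel_measurable (F (s i))" "\<And>i. i \<in> I \<Longrightarrow> msq M (\<xi> i) < \<infinity>"
  shows "msq M (\<lambda>\<omega>. \<Sum>i\<in>I. \<xi> i \<omega> * (W (t i) \<omega> - W (s i) \<omega>))
    = (\<integral>\<^sup>+\<omega>. (\<integral>\<^sup>+r\<in>{0..T}. ennreal ((\<Sum>i\<in>I. \<xi> i \<omega> * indicator {s i<..t i} r)\<^sup>2) \<partial>lborel) \<partial>M)"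
proof -
  have "(\<Sum>i\<in>I. \<xi> i \<omega> * indicator {s i<..t i} r) = 0" if "r \<notin> {0..T}" for r \<omega>
    using st that by (intro sum.neutral) (force split: split_indicator)
  then have "ennreal ((\<Sum>i\<in>I. \<xi> i \<omega> * indicator {s i<..t i} r)\<^sup>2)
      = ennreal ((\<Sum>i\<in>I. \<xi> i \<omega> * indicator {s i<..t i} r)\<^sup>2) * indicator {0..T} r" for r \<omega>
    by (cases "r \<in> {0..T}") auto
  then show ?thesis using isometry[of I s t \<xi>] assms by simp
qed


section \<open>The squared norm of processes on a bounded time interval, and stability of the Ito
  integral\<close>

lemma joint_measurable_section2:
  fixes f :: "real \<Rightarrow> 'a \<Rightarrow> real"
  assumes "jointly_measurable A f" "s \<in> A"
  shows "f s \<in> borel_measurable M"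
  using measurable_compose[OF measurable_Pair1' assms(1), of s] assms(2) by simp

lemma measurable_msq_time:
  fixes f :: "real \<Rightarrow> 'a \<Rightarrow> real"
  assumes f: "jointly_measurable A f"
  shows "(\<lambda>s. msq M (f s) * indicator A s) \<in> borel_measurable lborel"
proof -
  have eq: "msq M (f s) * indicator A s = (\<integral>\<^sup>+\<omega>. ennreal ((indicator A s * f s \<omega>)\<^sup>2) \<partial>M)" for s
    by (simp add: msq_def split: split_indicator)
  note f[measurable]
  have "(\<lambda>(s, \<omega>). ennreal ((indicator A s * f s \<omega>)\<^sup>2)) \<in> borel_measurable (lborel \<Otimes>\<^sub>M M)"
    by (simp add: case_prod_beta')
  then show ?thesis unfolding eq by (rule borel_measurable_nn_integral)
qed

text \<open>The time integral is innermost, as in \<open>has_ito_integral\<close>, so that unfolding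
  that definition produces \<open>pnorm\<close> literally; \<open>pnorm_eq\<close> gives the other
  order.\<close>

definition pnorm :: "real \<Rightarrow> (real \<Rightarrow> 'a \<Rightarrow> real) \<Rightarrow> ennreal" where
  "pnorm T \<phi> = (\<integral>\<^sup>+\<omega>. (\<integral>\<^sup>+s\<in>{0..T}. ennreal ((\<phi> s \<omega>)\<^sup>2) \<partial>lborel) \<partial>M)"

lemma pnorm_eq:
  assumes "jointly_measurable {0..T} \<phi>"
  shows "pnorm T \<phi> = (\<integral>\<^sup>+s\<in>{0..T}. msq M (\<phi> s) \<partial>lborel)"
proof -
  interpret P: pair_sigma_finite "lborel :: real measure" M by (rule pair_sigma_finite_lborel)
  show ?thesis unfolding pnorm_def by (rule P.nn_integral_swap_set[OF assms])
qed

lemma pnorm_minus_commute: "pnorm T (\<lambda>s \<omega>. f s \<omega> - g s \<omega>) = pnorm T (\<lambda>s \<omega>. g s \<omega> - f s \<omega>)"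
  by (simp add: pnorm_def power2_commute)

lemma pnorm_add3:
  assumes f: "jointly_measurable {0..T} f"
    and g: "jointly_measurable {0..T} g"
    and h: "jointly_measurable {0..T} h"
  shows "pnorm T (\<lambda>s \<omega>. f s \<omega> + g s \<omega> + h s \<omega>) \<le> 3 * (pnorm T f + pnorm T g + pnorm T h)"
proof -
  have "(\<lambda>z. indicator {0..T} (fst z) * (f (fst z) (snd z) + g (fst z) (snd z) + h (fst z) (snd z)))
      \<in> borel_measurable (lborel \<Otimes>\<^sub>M M)"
    using borel_measurable_add[OF borel_measurable_add[OF f g] h] by (simp add: algebra_simps)
  then have "pnorm T (\<lambda>s \<omega>. f s \<omega> + g s \<omega> + h s \<omega>)
      = (\<integral>\<^sup>+s\<in>{0..T}. msq M (\<lambda>\<omega>. f s \<omega> + g s \<omega> + h s \<omega>) \<partial>lborel)" by (rule pnorm_eq)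
  also have "\<dots> \<le> (\<integral>\<^sup>+s. 3 * (msq M (f s) * indicator {0..T} s + msq M (g s) * indicator {0..T} s
      + msq M (h s) * indicator {0..T} s) \<partial>lborel)"
  proof (intro nn_integral_mono)
    fix s
    show "msq M (\<lambda>\<omega>. f s \<omega> + g s \<omega> + h s \<omega>) * indicator {0..T} s
      \<le> 3 * (msq M (f s) * indicator {0..T} s + msq M (g s) * indicator {0..T} s + msq M (h s) * indicator {0..T} s)"
    proof (cases "s \<in> {0..T}")
      case True
      have "msq M (\<lambda>\<omega>. f s \<omega> + g s \<omega> + h s \<omega>) \<le> 3 * (msq M (f s) + msq M (g s) + msq M (h s))"
        using True by (intro msq_add3 joint_measurable_section2[OF f] joint_measurable_section2[OF g]
            joint_measurable_section2[OF h])
      then show ?thesis using True by simp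
    qed simp
  qed
  also have "\<dots> = 3 * (pnorm T f + pnorm T g + pnorm T h)"
    using measurable_msq_time[OF f] measurable_msq_time[OF g] measurable_msq_time[OF h]
    by (simp add: nn_integral_cmult nn_integral_add pnorm_eq[OF f] pnorm_eq[OF g] pnorm_eq[OF h])
  finally show ?thesis .
qed

lemma progressive_joint_measurable_Icc:
  "progressive M W \<phi> \<Longrightarrow> jointly_measurable {0..T} \<phi>"
  by (rule joint_measurable_mono[OF progressive_joint_measurable]) auto

lemma elementary_joint_measurable:
  assumes "elementary_data M W T n t \<xi>" and [measurable]: "A \<in> sets borel"
  shows "(\<lambda>z. indicator A (fst z) * elementary_process n t \<xi> (fst z) (snd z)) \<in> borel_measurable (lborel \<Otimes>\<^sub>M M)"
proof -
  have [measurable]: "\<xi> i \<in> borel_measurable M" if "i \<in> {..<n}" for i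
    using assms that by (intro measurable_F_M[of _ "t i"]) (simp add: elementary_data_def)
  show ?thesis unfolding elementary_process_def by measurable
qed

lemma elementary_data_properties:
  assumes d: "elementary_data M W T n t \<xi>" and i: "i < n"
  shows "0 \<le> t i \<and> t i \<le> t (Suc i) \<and> t (Suc i) \<le> T"
    and "\<xi> i \<in> borel_measurable (F (t i))" and "msq M (\<xi> i) < \<infinity>"
proof -
  have mono: "t j \<le> t k" if "j \<le> k" "k \<le> n" for j k
    using that d by (induct rule: dec_induct) (auto simp: elementary_data_def intro: order_trans)
  show "0 \<le> t i \<and> t i \<le> t (Suc i) \<and> t (Suc i) \<le> T"
    using mono[of 0 i] mono[of i "Suc i"] mono[of "Suc i" n] d i by (auto simp: elementary_data_def)
  show "\<xi> i \<in> borel_measurable (F (t i))" using d i by (simp add: elementary_data_def)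
  obtain K where K: "\<And>\<omega>. \<omega> \<in> space M \<Longrightarrow> \<bar>\<xi> i \<omega>\<bar> \<le> K"
    using d i unfolding elementary_data_def by blast
  have "msq M (\<xi> i) \<le> (\<integral>\<^sup>+\<omega>. ennreal (K\<^sup>2) \<partial>M)"
    unfolding msq_def using K by (intro nn_integral_mono ennreal_leI) (metis power2_abs power_mono abs_ge_zero)
  also have "\<dots> < \<infinity>" by (simp add: emeasure_space_1)
  finally show "msq M (\<xi> i) < \<infinity>" .
qed

lemma elementary_integral_measurable:
  assumes d: "elementary_data M W T n t \<xi>"
  shows "elementary_integral W n t \<xi> \<in> borel_measurable M"
proof -
  have "(\<lambda>\<omega>. \<xi> i \<omega> * (W (t (Suc i)) \<omega> - W (t i) \<omega>)) \<in> borel_measurable M" if "i < n" for i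
    using elementary_data_properties[OF d that]
    by (intro borel_measurable_times borel_measurable_diff measurable_F_M[of "\<xi> i"] W_measurable) auto
  then show ?thesis unfolding elementary_integral_def by (intro borel_measurable_sum) auto
qed

text \<open>Both sums are indexed by one disjoint union, with the second family of coefficients
  negated; the isometry then applies to the difference as to a single elementary integral.\<close>

lemma elementary_isometry_diff:
  assumes d: "elementary_data M W T n t \<xi>" and d': "elementary_data M W T n' t' \<xi>'"
  shows "msq M (\<lambda>\<omega>. elementary_integral W n t \<xi> \<omega> - elementary_integral W n' t' \<xi>' \<omega>)
    = pnorm T (\<lambda>s \<omega>. elementary_process n t \<xi> s \<omega> - elementary_process n' t' \<xi>' s \<omega>)"
proof -
  let ?s = "case_sum t t'" and ?t = "case_sum (\<lambda>i. t (Suc i)) (\<lambda>i. t' (Suc i))"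
  let ?\<xi> = "case_sum \<xi> (\<lambda>i \<omega>. - \<xi>' i \<omega>)"
  have neg: "msq M (\<lambda>\<omega>. - f \<omega>) = msq M f" for f :: "'a \<Rightarrow> real" by (simp add: msq_def)
  have "msq M (\<lambda>\<omega>. \<Sum>i\<in>{..<n} <+> {..<n'}. ?\<xi> i \<omega> * (W (?t i) \<omega> - W (?s i) \<omega>))
    = (\<integral>\<^sup>+\<omega>. (\<integral>\<^sup>+r\<in>{0..T}. ennreal ((\<Sum>i\<in>{..<n} <+> {..<n'}. ?\<xi> i \<omega> * indicator {?s i<..?t i} r)\<^sup>2) \<partial>lborel) \<partial>M)"
    by (rule isometry_Icc)
       (use elementary_data_properties[OF d] elementary_data_properties[OF d'] in
         \<open>auto simp: neg intro!: borel_measurable_uminus\<close>)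
  then show ?thesis
    by (simp add: sum.Plus elementary_integral_def elementary_process_def pnorm_def sum_negf
        del: sum_mult_indicator)
qed

text \<open>The elementary approximants are interposed between the two integrals, the isometry
  passes to the approximating processes, and the integrands are interposed there. Each passage
  splits a square into three and costs a factor 3, hence 9. The exact isometry would give 1, but any
  constant serves the Gronwall argument.\<close>

lemma ito_integral_diff_le:
  assumes "has_ito_integral M W T \<phi> I" and "has_ito_integral M W T \<phi>' I'"
  shows "msq M (\<lambda>\<omega>. I \<omega> - I' \<omega>) \<le> 9 * pnorm T (\<lambda>s \<omega>. \<phi> s \<omega> - \<phi>' s \<omega>)"
proof -
  obtain n t \<xi> where d: "\<And>k::nat. elementary_data M W T (n k) (t k) (\<xi> k)"
    and c: "(\<lambda>k. pnorm T (\<lambda>s \<omega>. \<phi> s \<omega> - elementary_process (n k) (t k) (\<xi> k) s \<omega>)) \<longlonglongrightarrow> 0"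
    "(\<lambda>k. msq M (\<lambda>\<omega>. I \<omega> - elementary_integral W (n k) (t k) (\<xi> k) \<omega>)) \<longlonglongrightarrow> 0"
    and I[measurable]: "I \<in> borel_measurable M" and \<phi>: "progressive M W \<phi>"
    using assms(1) unfolding has_ito_integral_def pnorm_def msq_def by blast
  obtain n' t' \<xi>' where d': "\<And>k::nat. elementary_data M W T (n' k) (t' k) (\<xi>' k)"
    and c': "(\<lambda>k. pnorm T (\<lambda>s \<omega>. \<phi>' s \<omega> - elementary_process (n' k) (t' k) (\<xi>' k) s \<omega>)) \<longlonglongrightarrow> 0"
    "(\<lambda>k. msq M (\<lambda>\<omega>. I' \<omega> - elementary_integral W (n' k) (t' k) (\<xi>' k) \<omega>)) \<longlonglongrightarrow> 0"
    and I'[measurable]: "I' \<in> borel_measurable M" and \<phi>': "progressive M W \<phi>'"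
    using assms(2) unfolding has_ito_integral_def pnorm_def msq_def by blast
  define e where "e k = elementary_process (n k) (t k) (\<xi> k)" for k
  define e' where "e' k = elementary_process (n' k) (t' k) (\<xi>' k)" for k
  define J where "J k = elementary_integral W (n k) (t k) (\<xi> k)" for k
  define J' where "J' k = elementary_integral W (n' k) (t' k) (\<xi>' k)" for k
  have [measurable]: "J k \<in> borel_measurable M" "J' k \<in> borel_measurable M" for k
    unfolding J_def J'_def using elementary_integral_measurable d d' by blast+
  have diff: "(\<lambda>z. indicator {0..T} (fst z) * (f (fst z) (snd z) - g (fst z) (snd z))) \<in> borel_measurable (lborel \<Otimes>\<^sub>M M)"
    if "jointly_measurable {0..T} f"
       "jointly_measurable {0..T} g"
    for f g :: "real \<Rightarrow> 'a \<Rightarrow> real"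
    using borel_measurable_diff[OF that] by (simp add: algebra_simps)
  note jm = progressive_joint_measurable_Icc[OF \<phi>, of T] progressive_joint_measurable_Icc[OF \<phi>', of T]
    elementary_joint_measurable[OF d, of "{0..T}", simplified, folded e_def]
    elementary_joint_measurable[OF d', of "{0..T}", simplified, folded e'_def]
  define D where "D = pnorm T (\<lambda>s \<omega>. \<phi> s \<omega> - \<phi>' s \<omega>)"
  define a where "a k = msq M (\<lambda>\<omega>. I \<omega> - J k \<omega>)" for k
  define a' where "a' k = msq M (\<lambda>\<omega>. I' \<omega> - J' k \<omega>)" for k
  define b where "b k = pnorm T (\<lambda>s \<omega>. \<phi> s \<omega> - e k s \<omega>)" for k
  define b' where "b' k = pnorm T (\<lambda>s \<omega>. \<phi>' s \<omega> - e' k s \<omega>)" for k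
  have "msq M (\<lambda>\<omega>. I \<omega> - I' \<omega>) \<le> 3 * (a k + 3 * (b k + D + b' k) + a' k)" for k
  proof -
    have "msq M (\<lambda>\<omega>. I \<omega> - I' \<omega>) = msq M (\<lambda>\<omega>. (I \<omega> - J k \<omega>) + (J k \<omega> - J' k \<omega>) + (J' k \<omega> - I' \<omega>))"
      by simp
    also have "\<dots> \<le> 3 * (a k + msq M (\<lambda>\<omega>. J k \<omega> - J' k \<omega>) + a' k)"
      using msq_add3[of "\<lambda>\<omega>. I \<omega> - J k \<omega>" M "\<lambda>\<omega>. J k \<omega> - J' k \<omega>" "\<lambda>\<omega>. J' k \<omega> - I' \<omega>"]
      by (simp add: a_def a'_def msq_minus_commute[of M "J' k"])
    also have "msq M (\<lambda>\<omega>. J k \<omega> - J' k \<omega>) = pnorm T (\<lambda>s \<omega>. e k s \<omega> - e' k s \<omega>)"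
      unfolding J_def J'_def e_def e'_def by (rule elementary_isometry_diff[OF d d'])
    also have "\<dots> = pnorm T (\<lambda>s \<omega>. (e k s \<omega> - \<phi> s \<omega>) + (\<phi> s \<omega> - \<phi>' s \<omega>) + (\<phi>' s \<omega> - e' k s \<omega>))" by simp
    also have "\<dots> \<le> 3 * (b k + D + b' k)"
      using pnorm_add3[of T "\<lambda>s \<omega>. e k s \<omega> - \<phi> s \<omega>" "\<lambda>s \<omega>. \<phi> s \<omega> - \<phi>' s \<omega>" "\<lambda>s \<omega>. \<phi>' s \<omega> - e' k s \<omega>"]
        diff[OF jm(3)[of k] jm(1)] diff[OF jm(1,2)] diff[OF jm(2) jm(4)[of k]]
      by (simp add: b_def b'_def D_def pnorm_minus_commute[of T "e k"])
    finally show ?thesis by (simp add: mult_left_mono add_mono)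
  qed
  moreover have "(\<lambda>k. 3 * (a k + 3 * (b k + D + b' k) + a' k)) \<longlonglongrightarrow> 3 * (0 + 3 * (0 + D + 0) + 0)"
    using c c' unfolding a_def a'_def b_def b'_def J_def J'_def e_def e'_def
    by (intro tendsto_add ennreal_tendsto_cmult tendsto_const) auto
  ultimately have "msq M (\<lambda>\<omega>. I \<omega> - I' \<omega>) \<le> 3 * (0 + 3 * (0 + D + 0) + 0)"
    by (intro LIMSEQ_le_const[where X="\<lambda>k. 3 * (a k + 3 * (b k + D + b' k) + a' k)"]) auto
  then show ?thesis by (simp add: D_def mult.assoc[symmetric])
qed

end

section \<open>Uniqueness of solutions\<close>

lemma nn_integral_exp_atLeast:
  fixes l s :: real
  assumes "0 < l"
  shows "(\<integral>\<^sup>+t\<in>{s..}. ennreal (exp (- l * t)) \<partial>lborel) = ennreal (exp (- l * s) / l)"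
proof -
  have "(\<integral>\<^sup>+t. ennreal (exp (- l * t)) * indicator {s..} t \<partial>lborel) = ennreal (0 - (- exp (- l * s) / l))"
  proof (rule nn_integral_FTC_atLeast)
    show "((\<lambda>t. - exp (- l * t) / l) has_real_derivative exp (- l * t)) (at t)" for t
      using assms by (auto intro!: derivative_eq_intros)
    have "((\<lambda>t. - exp (- l * t) / l) \<longlongrightarrow> - 0 / l) at_top"
      using assms
      by (intro tendsto_intros filterlim_compose[OF exp_at_bot] filterlim_tendsto_neg_mult_at_bot[of _ "-l"]
          filterlim_ident) auto
    then show "((\<lambda>t. - exp (- l * t) / l) \<longlongrightarrow> 0) at_top" by simp
  qed auto
  then show ?thesis by simp
qed

text \<open>Integrating the inequality against \<open>exp (- 2 * K * t)\<close> bounds the weighted integral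
  of \<open>y\<close> by half of itself.\<close>

lemma gronwall_zero:
  fixes y :: "real \<Rightarrow> ennreal" and K T :: real
  assumes [measurable]: "(\<lambda>t. y t * indicator {0..T} t) \<in> borel_measurable lborel"
    and fin: "(\<integral>\<^sup>+t\<in>{0..T}. y t \<partial>lborel) < \<infinity>" and K: "0 < K"
    and le: "\<And>t. 0 \<le> t \<Longrightarrow> t \<le> T \<Longrightarrow> y t \<le> ennreal K * (\<integral>\<^sup>+s\<in>{0..t}. y s \<partial>lborel)"
    and t: "0 \<le> t" "t \<le> T"
  shows "y t = 0"
proof -
  define z where "z s = y s * indicator {0..T} s" for s
  have [measurable]: "z \<in> borel_measurable lborel" unfolding z_def by simp
  let ?e = "\<lambda>t. ennreal (exp (- (2 * K) * t))"
  define N where "N = (\<integral>\<^sup>+t. ?e t * z t \<partial>lborel)"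
  have sub: "(\<integral>\<^sup>+s\<in>{0..t}. y s \<partial>lborel) = (\<integral>\<^sup>+s. z s * indicator {s..} t \<partial>lborel)" if "t \<le> T" for t
    using that by (intro nn_integral_cong) (auto simp: z_def split: split_indicator)
  \<comment> \<open>Finiteness of \<open>N\<close> is essential: \<open>N \<le> N / 2\<close> forces
    \<open>N = 0\<close> only for finite \<open>N\<close>.\<close>
  have "N \<le> (\<integral>\<^sup>+t. z t \<partial>lborel)"
    unfolding N_def
  proof (rule nn_integral_mono)
    fix s show "?e s * z s \<le> z s"
    proof (cases "s \<in> {0..T}")
      case True
      then have "?e s \<le> 1" using K by (simp add: ennreal_le_1)
      then show ?thesis using mult_right_mono[of "?e s" 1 "z s"] by simp
    qed (simp add: z_def)
  qed
  then have Nfin: "N < \<infinity>" using fin by (simp add: z_def)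
  have "N \<le> (\<integral>\<^sup>+t. (\<integral>\<^sup>+s. ennreal K * (z s * (?e t * indicator {s..} t)) \<partial>lborel) \<partial>lborel)"
    unfolding N_def
  proof (rule nn_integral_mono)
    fix t
    show "?e t * z t \<le> (\<integral>\<^sup>+s. ennreal K * (z s * (?e t * indicator {s..} t)) \<partial>lborel)"
    proof (cases "t \<in> {0..T}")
      case True
      have "?e t * z t = ?e t * y t" using True by (simp add: z_def)
      also have "\<dots> \<le> ?e t * (ennreal K * (\<integral>\<^sup>+s. z s * indicator {s..} t \<partial>lborel))"
        using le[of t] True sub[of t] by (intro mult_left_mono) auto
      also have "\<dots> = (\<integral>\<^sup>+s. ?e t * (ennreal K * (z s * indicator {s..} t)) \<partial>lborel)"
      proof -
        have "indicator {s..} t = (indicator {..t} s :: ennreal)" for s by (simp split: split_indicator)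
        then show ?thesis by (simp add: nn_integral_cmult)
      qed
      finally show ?thesis by (simp add: mult_ac)
    qed (simp add: z_def)
  qed
  also have "\<dots> = (\<integral>\<^sup>+s. (\<integral>\<^sup>+t. ennreal K * (z s * (?e t * indicator {s..} t)) \<partial>lborel) \<partial>lborel)"
    by (rule lborel_pair.Fubini') (simp add: indicator_def)
  also have "\<dots> = (\<integral>\<^sup>+s. ennreal K * (z s * (\<integral>\<^sup>+t\<in>{s..}. ?e t \<partial>lborel)) \<partial>lborel)"
    by (simp add: nn_integral_cmult)
  also have "\<dots> = (\<integral>\<^sup>+s. ennreal (1/2) * (?e s * z s) \<partial>lborel)"
  proof (rule nn_integral_cong)
    fix s
    have "(\<integral>\<^sup>+t\<in>{s..}. ?e t \<partial>lborel) = ennreal (exp (- (2 * K) * s) / (2 * K))"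
      using K by (intro nn_integral_exp_atLeast) auto
    moreover have "ennreal K * ennreal (exp (- (2 * K) * s) / (2 * K)) = ennreal (1/2) * ?e s"
    proof -
      have "ennreal K * ennreal (exp (- (2 * K) * s) / (2 * K)) = ennreal (K * (exp (- (2 * K) * s) / (2 * K)))"
        using K by (intro ennreal_mult[symmetric]) auto
      also have "K * (exp (- (2 * K) * s) / (2 * K)) = 1/2 * exp (- (2 * K) * s)" using K by simp
      also have "ennreal \<dots> = ennreal (1/2) * ?e s" by (intro ennreal_mult) auto
      finally show ?thesis .
    qed
    ultimately show "ennreal K * (z s * (\<integral>\<^sup>+t\<in>{s..}. ?e t \<partial>lborel)) = ennreal (1/2) * (?e s * z s)"
      by (metis mult.assoc mult.commute)
  qed
  also have "\<dots> = ennreal (1/2) * N" unfolding N_def by (rule nn_integral_cmult) simp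
  finally have "N \<le> ennreal (1/2) * N" .
  have "N = 0"
  proof -
    obtain r where r: "0 \<le> r" "N = ennreal r" using Nfin by (cases N) auto
    have "ennreal r \<le> ennreal (1/2 * r)"
      using \<open>N \<le> ennreal (1/2) * N\<close> r ennreal_mult[of "1/2" r] by simp
    then have "r \<le> 1/2 * r" using r by (subst (asm) ennreal_le_iff) auto
    then show ?thesis using r by simp
  qed
  \<comment> \<open>So far \<open>y\<close> vanishes at almost every time; the hypothesis
    \<open>le\<close> bounds each single value by an integral that is now 0.\<close>
  then have "AE s in lborel. z s = 0"
    unfolding N_def by (subst (asm) nn_integral_0_iff_AE) auto
  then have "(\<integral>\<^sup>+s. z s * indicator {s..} t \<partial>lborel) = (\<integral>\<^sup>+s. 0 \<partial>(lborel :: real measure))"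
    by (intro nn_integral_cong_AE) auto
  then show ?thesis using le[OF t] sub[OF t(2)] by simp
qed

lemma set_integrable_lborel_Icc_square:
  fixes f :: "real \<Rightarrow> real"
  assumes [measurable]: "(\<lambda>s. indicator {0..T} s * f s) \<in> borel_measurable lborel"
    and fin: "(\<integral>\<^sup>+s\<in>{0..T}. ennreal ((f s)\<^sup>2) \<partial>lborel) < \<infinity>"
  shows "set_integrable lborel {0..T} f"
  unfolding set_integrable_def
proof (rule Bochner_Integration.integrable_bound)
  let ?g = "\<lambda>s. indicator {0..T} s * f s"
  have "(\<integral>\<^sup>+s. ennreal ((?g s)\<^sup>2) \<partial>lborel) < \<infinity>"
    by (rule le_less_trans[OF _ fin], intro nn_integral_mono) (auto split: split_indicator)
  then have "integrable lborel (\<lambda>s. (?g s)\<^sup>2)" by (subst integrable_iff_bounded) auto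
  moreover have "integrable lborel (indicator {0..T} :: real \<Rightarrow> real)"
    by (cases "0 \<le> T") auto
  ultimately show "integrable lborel (\<lambda>s. indicator {0..T} s + (?g s)\<^sup>2 :: real)" by simp
  have "\<bar>a\<bar> \<le> 1 + a\<^sup>2" for a :: real
    using sum_squares_bound[of 1 "\<bar>a\<bar>"] by simp
  then show "AE s in lborel. norm (indicator {0..T} s *\<^sub>R f s) \<le> norm (indicator {0..T} s + (?g s)\<^sup>2 :: real)"
    by (auto split: split_indicator)
qed simp

context brownian_space
begin

lemma L2F_D:
  assumes "u \<in> L2F M W"
  shows "progressive M W u" and "(\<integral>\<^sup>+\<omega>. (\<integral>\<^sup>+t\<in>{0..}. ennreal ((u t \<omega>)\<^sup>2) \<partial>lborel) \<partial>M) < \<infinity>"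
  using assms by (auto simp: L2F_def)

lemma pnorm_le_L2:
  "pnorm T u \<le> (\<integral>\<^sup>+\<omega>. (\<integral>\<^sup>+t\<in>{0..}. ennreal ((u t \<omega>)\<^sup>2) \<partial>lborel) \<partial>M)"
  unfolding pnorm_def by (intro nn_integral_mono) (auto split: split_indicator)

lemma L2F_pnorm: "u \<in> L2F M W \<Longrightarrow> pnorm T u < \<infinity>"
  using pnorm_le_L2 L2F_D(2) by (rule le_less_trans)

lemma measurable_nn_integral_time:
  assumes f: "jointly_measurable A f"
  shows "(\<lambda>\<omega>. \<integral>\<^sup>+s\<in>A. ennreal ((f s \<omega>)\<^sup>2) \<partial>(lborel :: real measure)) \<in> borel_measurable M"
proof -
  have eq: "ennreal ((f s \<omega>)\<^sup>2) * indicator A s = ennreal ((indicator A s * f s \<omega>)\<^sup>2)" for s \<omega>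
    by (auto split: split_indicator)
  have "(\<lambda>(\<omega>, s). ennreal ((indicator A s * f s \<omega>)\<^sup>2)) \<in> borel_measurable (M \<Otimes>\<^sub>M lborel)"
    using measurable_compose[OF measurable_pair_swap' f] by (simp add: case_prod_beta')
  then show ?thesis unfolding eq by (rule lborel.borel_measurable_nn_integral)
qed

lemma AE_set_integrable:
  assumes f: "progressive M W f" and fin: "pnorm T f < \<infinity>"
  shows "AE \<omega> in M. set_integrable lborel {0..T} (\<lambda>s. f s \<omega>)"
proof -
  note jm = progressive_joint_measurable_Icc[OF f, of T]
  have "AE \<omega> in M. (\<integral>\<^sup>+s\<in>{0..T}. ennreal ((f s \<omega>)\<^sup>2) \<partial>lborel) \<noteq> \<infinity>"
    using fin unfolding pnorm_def
    by (intro nn_integral_PInf_AE measurable_nn_integral_time jm) auto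
  then show ?thesis
    using AE_space
    by eventually_elim
       (intro set_integrable_lborel_Icc_square joint_measurable_section1[OF jm], auto simp: less_top)
qed

text \<open>The control and the initial value cancel in the difference \<open>Z\<close>.
  Cauchy-Schwarz for the drift and \<open>ito_integral_diff_le\<close> for the noise bound the
  second moment of \<open>Z\<close> by a multiple of its own time integral.\<close>

theorem sde_unique:
  assumes X: "solves_sde M W A B C 0 x u X" and X': "solves_sde M W A B C 0 x u X'"
    and u: "u \<in> L2F M W" and T: "0 \<le> T"
  shows "AE \<omega> in M. X T \<omega> = X' T \<omega>"
proof -
  have pX: "progressive M W X" "progressive M W X'"
    and fX: "\<And>t. 0 \<le> t \<Longrightarrow> pnorm t X < \<infinity>" "\<And>t. 0 \<le> t \<Longrightarrow> pnorm t X' < \<infinity>"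
    using X X' by (auto simp: solves_sde_def pnorm_def)
  define Z where "Z t \<omega> = X t \<omega> - X' t \<omega>" for t \<omega>
  have pZ: "progressive M W Z"
    using progressive_linear[OF pX, of 1 "-1"] by (simp add: Z_def[abs_def])
  note jZ = progressive_joint_measurable_Icc[OF pZ]
  have fZ: "pnorm t Z < \<infinity>" if "0 \<le> t" for t
  proof -
    have "pnorm t Z = pnorm t (\<lambda>s \<omega>. X s \<omega> + (-1) * X' s \<omega> + 0 * X s \<omega>)" by (simp add: Z_def[abs_def])
    also have "\<dots> \<le> 3 * (pnorm t X + pnorm t (\<lambda>s \<omega>. (-1) * X' s \<omega>) + pnorm t (\<lambda>s \<omega>. 0 * X s \<omega>))"
      using progressive_joint_measurable_Icc[OF pX(1), of t] progressive_joint_measurable_Icc[OF pX(2), of t]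
      by (intro pnorm_add3) (auto simp: mult.left_commute[of _ "-1"])
    also have "\<dots> = 3 * (pnorm t X + pnorm t X')" by (simp add: pnorm_def)
    also have "\<dots> < \<infinity>" using fX that by (simp add: ennreal_mult_less_top)
    finally show ?thesis .
  qed
  have step: "msq M (Z t) \<le> ennreal (2 * (A\<^sup>2 * t + 9 * C\<^sup>2)) * (\<integral>\<^sup>+s\<in>{0..t}. msq M (Z s) \<partial>lborel)" if t: "0 \<le> t" for t
  proof -
    obtain I where I: "has_ito_integral M W t (\<lambda>s \<omega>. C * X s \<omega>) I"
      "AE \<omega> in M. X t \<omega> = x + (LBINT s:{0..t}. A * X s \<omega> + B * u s \<omega>) + I \<omega>"
      using X t by (auto simp: solves_sde_def)
    obtain I' where I': "has_ito_integral M W t (\<lambda>s \<omega>. C * X' s \<omega>) I'"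
      "AE \<omega> in M. X' t \<omega> = x + (LBINT s:{0..t}. A * X' s \<omega> + B * u s \<omega>) + I' \<omega>"
      using X' t by (auto simp: solves_sde_def)
    have [measurable]: "I \<in> borel_measurable M" "I' \<in> borel_measurable M"
      using I(1) I'(1) by (auto simp: has_ito_integral_def)
    have "AE \<omega> in M. Z t \<omega> = (LBINT s:{0..t}. A * Z s \<omega>) + (I \<omega> - I' \<omega>)"
      \<comment> \<open>Integrability along the path licenses merging the two drift integrals;
        \<open>u\<close> is listed because each integrand contains it.\<close>
      using I(2) I'(2) AE_set_integrable[OF pX(1) fX(1)[OF t]] AE_set_integrable[OF pX(2) fX(2)[OF t]]
        AE_set_integrable[OF L2F_D(1)[OF u] L2F_pnorm[OF u], of t]
    proof eventually_elim
      case (elim \<omega>)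
      have "(LBINT s:{0..t}. A * X s \<omega> + B * u s \<omega>) - (LBINT s:{0..t}. A * X' s \<omega> + B * u s \<omega>)
          = (LBINT s:{0..t}. (A * X s \<omega> + B * u s \<omega>) - (A * X' s \<omega> + B * u s \<omega>))"
        using elim by (intro set_integral_diff(2)[symmetric] set_integral_add(1)) auto
      then show ?case using elim(1,2) by (simp add: Z_def right_diff_distrib)
    qed
    then have "msq M (Z t) = msq M (\<lambda>\<omega>. (LBINT s:{0..t}. A * Z s \<omega>) + (I \<omega> - I' \<omega>))"
      by (rule msq_cong_AE)
    also have "\<dots> \<le> 2 * (msq M (\<lambda>\<omega>. LBINT s:{0..t}. A * Z s \<omega>) + msq M (\<lambda>\<omega>. I \<omega> - I' \<omega>))"
    proof (rule msq_add)
      have "(\<lambda>(\<omega>, s). A * (indicator {0..t} s * Z s \<omega>)) \<in> borel_measurable (M \<Otimes>\<^sub>M lborel)"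
        using measurable_compose[OF measurable_pair_swap' jZ[of t]] by (simp add: case_prod_beta')
      from lborel.borel_measurable_lebesgue_integral[OF this]
      show "(\<lambda>\<omega>. LBINT s:{0..t}. A * Z s \<omega>) \<in> borel_measurable M"
        by (simp add: set_lebesgue_integral_def mult.left_commute)
    qed auto
    finally have le: "msq M (Z t) \<le> 2 * (msq M (\<lambda>\<omega>. LBINT s:{0..t}. A * Z s \<omega>) + msq M (\<lambda>\<omega>. I \<omega> - I' \<omega>))" .
    have "msq M (\<lambda>\<omega>. LBINT s:{0..t}. A * Z s \<omega>) = msq M (\<lambda>\<omega>. A * (LBINT s:{0..t}. Z s \<omega>))" by simp
    also have "\<dots> = ennreal (A\<^sup>2) * msq M (\<lambda>\<omega>. LBINT s:{0..t}. Z s \<omega>)"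
    proof (rule msq_cmult)
      have "(\<lambda>(\<omega>, s). indicator {0..t} s * Z s \<omega>) \<in> borel_measurable (M \<Otimes>\<^sub>M lborel)"
        using measurable_compose[OF measurable_pair_swap' jZ[of t]] by (simp add: case_prod_beta')
      from lborel.borel_measurable_lebesgue_integral[OF this]
      show "(\<lambda>\<omega>. LBINT s:{0..t}. Z s \<omega>) \<in> borel_measurable M"
        by (simp add: set_lebesgue_integral_def)
    qed
    also have "\<dots> \<le> ennreal (A\<^sup>2) * (ennreal (t - 0) * (\<integral>\<^sup>+s\<in>{0..t}. msq M (Z s) \<partial>lborel))"
      by (intro mult_left_mono msq_set_integral_le jZ t) auto
    finally have le1: "msq M (\<lambda>\<omega>. LBINT s:{0..t}. A * Z s \<omega>)
      \<le> ennreal (A\<^sup>2) * (ennreal (t - 0) * (\<integral>\<^sup>+s\<in>{0..t}. msq M (Z s) \<partial>lborel))" .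
    have "msq M (\<lambda>\<omega>. I \<omega> - I' \<omega>) \<le> 9 * pnorm t (\<lambda>s \<omega>. C * X s \<omega> - C * X' s \<omega>)"
      by (rule ito_integral_diff_le[OF I(1) I'(1)])
    also have "pnorm t (\<lambda>s \<omega>. C * X s \<omega> - C * X' s \<omega>) = pnorm t (\<lambda>s \<omega>. C * Z s \<omega>)"
      by (simp add: Z_def right_diff_distrib)
    also have "\<dots> = (\<integral>\<^sup>+s\<in>{0..t}. msq M (\<lambda>\<omega>. C * Z s \<omega>) \<partial>lborel)"
      using borel_measurable_times[OF borel_measurable_const[of C] jZ[of t]]
      by (intro pnorm_eq) (simp add: mult.left_commute)
    also have "\<dots> = (\<integral>\<^sup>+s. ennreal (C\<^sup>2) * (msq M (Z s) * indicator {0..t} s) \<partial>lborel)"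
      using progressive_measurable[OF pZ]
      by (intro nn_integral_cong) (auto split: split_indicator simp: msq_cmult)
    also have "\<dots> = ennreal (C\<^sup>2) * (\<integral>\<^sup>+s\<in>{0..t}. msq M (Z s) \<partial>lborel)"
      by (rule nn_integral_cmult[OF measurable_msq_time[OF jZ]])
    finally have le2: "msq M (\<lambda>\<omega>. I \<omega> - I' \<omega>)
      \<le> 9 * (ennreal (C\<^sup>2) * (\<integral>\<^sup>+s\<in>{0..t}. msq M (Z s) \<partial>lborel))" .
    have "msq M (Z t) \<le> 2 * (ennreal (A\<^sup>2) * (ennreal (t - 0) * (\<integral>\<^sup>+s\<in>{0..t}. msq M (Z s) \<partial>lborel))
      + 9 * (ennreal (C\<^sup>2) * (\<integral>\<^sup>+s\<in>{0..t}. msq M (Z s) \<partial>lborel)))"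
      by (rule order_trans[OF le mult_left_mono[OF add_mono[OF le1 le2]]]) simp
    then show ?thesis
      using t by (simp add: ennreal_mult ennreal_plus distrib_left distrib_right mult_ac)
  qed
  have "msq M (Z T) = 0"
  \<comment> \<open>The summand 1 keeps the constant strictly positive when \<open>A\<close> and
    \<open>C\<close> vanish.\<close>
  proof (rule gronwall_zero[of "\<lambda>t. msq M (Z t)" T "2 * (A\<^sup>2 * T + 9 * C\<^sup>2) + 1"])
    show "(\<lambda>t. msq M (Z t) * indicator {0..T} t) \<in> borel_measurable lborel"
      by (rule measurable_msq_time[OF jZ])
    show "(\<integral>\<^sup>+t\<in>{0..T}. msq M (Z t) \<partial>lborel) < \<infinity>"
      using fZ[OF T] pnorm_eq[OF jZ] by simp
    show "0 < 2 * (A\<^sup>2 * T + 9 * C\<^sup>2) + 1" using T by (simp add: add_nonneg_pos)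
    fix t assume t: "0 \<le> t" "t \<le> T"
    have "2 * (A\<^sup>2 * t + 9 * C\<^sup>2) \<le> 2 * (A\<^sup>2 * T + 9 * C\<^sup>2) + 1"
      using mult_left_mono[OF t(2), of "A\<^sup>2"] by simp
    then show "msq M (Z t) \<le> ennreal (2 * (A\<^sup>2 * T + 9 * C\<^sup>2) + 1) * (\<integral>\<^sup>+s\<in>{0..t}. msq M (Z s) \<partial>lborel)"
      using step[OF t(1)] by (elim order_trans) (intro mult_right_mono ennreal_leI, auto)
  qed (use T in auto)
  then show ?thesis
    using progressive_measurable[OF pZ T] by (simp add: msq_eq_0_iff Z_def)
qed

end

section \<open>The explicit solution\<close>

lemma set_integrable_mult_continuous:
  fixes f g :: "real \<Rightarrow> real"
  assumes f: "set_integrable lborel {p..q} f" and g: "continuous_on {p..q} g"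
  shows "set_integrable lborel {p..q} (\<lambda>s. f s * g s)"
proof -
  have "bounded (g ` {p..q})" by (intro compact_imp_bounded compact_continuous_image g) simp
  then obtain B where B: "\<And>s. s \<in> {p..q} \<Longrightarrow> \<bar>g s\<bar> \<le> B"
    by (force simp: bounded_iff)
  have gm[measurable]: "(\<lambda>s. indicator {p..q} s *\<^sub>R g s) \<in> borel_measurable borel"
    by (rule borel_measurable_continuous_on_indicator[OF _ g]) simp
  have fm[measurable]: "(\<lambda>s. indicator {p..q} s *\<^sub>R f s) \<in> borel_measurable borel"
    using f unfolding set_integrable_def by (auto dest: borel_measurable_integrable)
  have eq: "indicator {p..q} s *\<^sub>R (f s * g s) = (indicator {p..q} s *\<^sub>R f s) * (indicator {p..q} s *\<^sub>R g s)" for s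
    by (simp split: split_indicator)
  show ?thesis
    unfolding set_integrable_def
  proof (rule Bochner_Integration.integrable_bound)
    show "integrable lborel (\<lambda>s. B * (indicator {p..q} s *\<^sub>R f s))"
      using f unfolding set_integrable_def by (rule integrable_mult_right)
    show "(\<lambda>s. indicator {p..q} s *\<^sub>R (f s * g s)) \<in> borel_measurable lborel"
      unfolding eq using borel_measurable_times[OF fm gm] by simp
    have "\<bar>f s * g s\<bar> \<le> \<bar>B * f s\<bar>" if "s \<in> {p..q}" for s
    proof -
      have "\<bar>g s\<bar> \<le> \<bar>B\<bar>" using B[OF that] by linarith
      then have "\<bar>f s\<bar> * \<bar>g s\<bar> \<le> \<bar>f s\<bar> * \<bar>B\<bar>" by (rule mult_left_mono) simp
      then show ?thesis by (simp add: abs_mult mult.commute)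
    qed
    then show "AE s in lborel. norm (indicator {p..q} s *\<^sub>R (f s * g s)) \<le> norm (B * (indicator {p..q} s *\<^sub>R f s))"
      by (auto split: split_indicator)
  qed
qed

lemma set_integral_combine_Icc:
  fixes f :: "real \<Rightarrow> real"
  assumes f: "set_integrable lborel {p..r} f" and "p \<le> q" "q \<le> r"
  shows "(LBINT s:{p..r}. f s) = (LBINT s:{p..q}. f s) + (LBINT s:{q..r}. f s)"
proof -
  have i: "set_integrable lborel {p..q} f" "set_integrable lborel {q..r} f"
    using assms by (auto intro: set_integrable_subset[OF f])
  show ?thesis
    unfolding set_borel_integral_eq_integral(2)[OF f] set_borel_integral_eq_integral(2)[OF i(1)]
      set_borel_integral_eq_integral(2)[OF i(2)]
    using Henstock_Kurzweil_Integration.integral_combine[OF assms(2,3) set_borel_integral_eq_integral(1)[OF f]]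
    by simp
qed

lemma continuous_on_atLeast_Icc:
  fixes f :: "real \<Rightarrow> real"
  assumes "\<And>n::nat. continuous_on {0..real n} f"
  shows "continuous_on {0..} f"
  unfolding continuous_on_eq_continuous_within
proof
  fix t :: real assume t: "t \<in> {0..}"
  obtain n :: nat where n: "t < real n" using reals_Archimedean2 by blast
  have "continuous (at t within {0..real n}) f"
    using assms[of n] t n by (auto simp: continuous_on_eq_continuous_within)
  moreover have "at t within {0..real n} = at t within {0..}"
    using n by (intro at_within_nhd[of _ "{..<real n}"]) auto
  ultimately show "continuous (at t within {0..}) f" by simp
qed

lemma continuous_on_set_integral_Icc:
  fixes f :: "real \<Rightarrow> real"
  assumes "\<And>n::nat. set_integrable lborel {0..real n} f"
  shows "continuous_on {0..} (\<lambda>t. LBINT s:{0..t}. f s)"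
proof (rule continuous_on_atLeast_Icc)
  fix n :: nat
  have "continuous_on {0..real n} (\<lambda>t. integral {0..t} f)"
    by (intro indefinite_integral_continuous_1 set_borel_integral_eq_integral(1) assms)
  moreover have "integral {0..t} f = (LBINT s:{0..t}. f s)" if "t \<in> {0..real n}" for t
    using that by (intro set_borel_integral_eq_integral(2)[symmetric] set_integrable_subset[OF assms[of n]]) auto
  ultimately show "continuous_on {0..real n} (\<lambda>t. LBINT s:{0..t}. f s)"
    by (rule continuous_on_eq)
qed

lemma floor_grid_tendsto: "(\<lambda>n. of_int \<lfloor>real (Suc n) * t\<rfloor> / real (Suc n)) \<longlonglongrightarrow> t"
proof (rule tendsto_sandwich[of "\<lambda>n. t - 1 / real (Suc n)" _ _ "\<lambda>n. t"])
  have "(\<lambda>n. t - inverse (real (Suc n))) \<longlonglongrightarrow> t - 0"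
    by (intro tendsto_diff tendsto_const LIMSEQ_inverse_real_of_nat)
  then show "(\<lambda>n. t - 1 / real (Suc n)) \<longlonglongrightarrow> t" by (simp add: inverse_eq_divide)
  show "\<forall>\<^sub>F n in sequentially. t - 1 / real (Suc n) \<le> of_int \<lfloor>real (Suc n) * t\<rfloor> / real (Suc n)"
  proof (rule always_eventually, rule allI)
    fix n
    have "real (Suc n) * t - 1 \<le> of_int \<lfloor>real (Suc n) * t\<rfloor>" by linarith
    then have "(real (Suc n) * t - 1) / real (Suc n) \<le> of_int \<lfloor>real (Suc n) * t\<rfloor> / real (Suc n)"
      by (rule divide_right_mono) simp
    then show "t - 1 / real (Suc n) \<le> of_int \<lfloor>real (Suc n) * t\<rfloor> / real (Suc n)"
      by (simp add: diff_divide_distrib del: of_nat_Suc)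
  qed
  show "\<forall>\<^sub>F n in sequentially. of_int \<lfloor>real (Suc n) * t\<rfloor> / real (Suc n) \<le> t"
  proof (rule always_eventually, rule allI)
    fix n
    have "of_int \<lfloor>real (Suc n) * t\<rfloor> \<le> real (Suc n) * t" by linarith
    then have "of_int \<lfloor>real (Suc n) * t\<rfloor> / real (Suc n) \<le> real (Suc n) * t / real (Suc n)"
      by (rule divide_right_mono) simp
    then show "of_int \<lfloor>real (Suc n) * t\<rfloor> / real (Suc n) \<le> t" by (simp del: of_nat_Suc)
  qed
qed simp

section \<open>Progressive measurability of continuous processes and of time integrals\<close>

context brownian_space
begin

text \<open>Rounding time down to a grid leaves countably many time values, at each of which
  adaptedness suffices; continuity of the paths gives the limit. Clamping after rounding keeps the
  grid times within \<open>[0,T]\<close>.\<close>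

lemma progressive_continuous:
  fixes \<phi> :: "real \<Rightarrow> 'a \<Rightarrow> real"
  assumes ad: "\<And>t. 0 \<le> t \<Longrightarrow> \<phi> t \<in> borel_measurable (F t)"
    and cont: "\<And>\<omega>. \<omega> \<in> space M \<Longrightarrow> continuous_on {0..} (\<lambda>t. \<phi> t \<omega>)"
  shows "progressive M W \<phi>"
  unfolding progressive_iff_clamp
proof (intro allI impI)
  fix T :: real assume T: "0 \<le> T"
  let ?d = "\<lambda>(n::nat) (k::int). max 0 (min (of_int k / real (Suc n)) T)"
  show "(\<lambda>z. \<phi> (max 0 (min (fst z) T)) (snd z)) \<in> borel_measurable (borel \<Otimes>\<^sub>M F T)"
  proof (rule borel_measurable_LIMSEQ_real)
    fix n :: nat
    have "(\<lambda>z. \<phi> (?d n k) (snd z)) \<in> borel_measurable (borel \<Otimes>\<^sub>M F T)" for k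
    proof -
      have "\<phi> (?d n k) \<in> borel_measurable (F T)"
        using T by (intro measurable_F_mono[OF _ ad]) auto
      then show ?thesis by (intro measurable_compose[OF measurable_snd])
    qed
    moreover have "(\<lambda>z. \<lfloor>real (Suc n) * fst z\<rfloor>) \<in> measurable (borel \<Otimes>\<^sub>M F T) (count_space UNIV)"
      by measurable
    ultimately show "(\<lambda>z. \<phi> (?d n \<lfloor>real (Suc n) * fst z\<rfloor>) (snd z)) \<in> borel_measurable (borel \<Otimes>\<^sub>M F T)"
      by (rule measurable_compose_countable)
  next
    fix z assume z: "z \<in> space (borel \<Otimes>\<^sub>M F T :: (real \<times> 'a) measure)"
    have "continuous_on {0..} (\<lambda>t. \<phi> t (snd z))" using z by (intro cont) (auto simp: space_pair_measure)
    moreover have "(\<lambda>n. ?d n \<lfloor>real (Suc n) * fst z\<rfloor>) \<longlonglongrightarrow> max 0 (min (fst z) T)"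
      by (intro tendsto_max tendsto_min tendsto_const floor_grid_tendsto)
    ultimately show "(\<lambda>n. \<phi> (?d n \<lfloor>real (Suc n) * fst z\<rfloor>) (snd z)) \<longlonglongrightarrow> \<phi> (max 0 (min (fst z) T)) (snd z)"
      by (rule continuous_on_tendsto_compose) auto
  qed
qed

lemma progressive_mult:
  "progressive M W \<phi> \<Longrightarrow> progressive M W \<psi> \<Longrightarrow> progressive M W (\<lambda>t \<omega>. \<phi> t \<omega> * \<psi> t \<omega>)"
  unfolding progressive_iff_clamp by (intro allI impI borel_measurable_times) blast+

lemma progressive_divide:
  "progressive M W \<phi> \<Longrightarrow> progressive M W \<psi> \<Longrightarrow> progressive M W (\<lambda>t \<omega>. \<phi> t \<omega> / \<psi> t \<omega>)"
  unfolding progressive_iff_clamp by (intro allI impI borel_measurable_divide) blast+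

lemma progressive_const: "progressive M W (\<lambda>t \<omega>. x)"
  unfolding progressive_iff_clamp by simp

lemma progressive_add:
  "progressive M W \<phi> \<Longrightarrow> progressive M W \<psi> \<Longrightarrow> progressive M W (\<lambda>t \<omega>. \<phi> t \<omega> + \<psi> t \<omega>)"
  using progressive_linear[of \<phi> \<psi> 1 1] by simp

text \<open>The moving upper limit becomes a condition on \<open>s\<close> inside the integrand, so
  that measurability of parameter integrals applies. Clamping \<open>s\<close> changes nothing where
  that condition holds.\<close>

lemma progressive_set_integral:
  assumes g: "progressive M W g"
  shows "progressive M W (\<lambda>t \<omega>. LBINT s:{0..t}. g s \<omega>)"
  unfolding progressive_iff_clamp
proof (intro allI impI)
  fix T :: real assume T: "0 \<le> T"
  let ?c = "\<lambda>t. max 0 (min t T)"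
  have m: "(\<lambda>z. g (?c (fst z)) (snd z)) \<in> borel_measurable (borel \<Otimes>\<^sub>M F T)"
    using g T by (simp add: progressive_iff_clamp)
  have "(\<lambda>p. (snd p, snd (fst p))) \<in> measurable ((borel \<Otimes>\<^sub>M F T) \<Otimes>\<^sub>M lborel) (borel \<Otimes>\<^sub>M F T)"
    by measurable
  from measurable_compose[OF this m]
  have [measurable]: "(\<lambda>p. g (?c (snd p)) (snd (fst p))) \<in> borel_measurable ((borel \<Otimes>\<^sub>M F T) \<Otimes>\<^sub>M lborel)"
    by simp
  have "(\<lambda>(z, s). if 0 \<le> s \<and> s \<le> ?c (fst z) then g (?c s) (snd z) else 0) \<in> borel_measurable ((borel \<Otimes>\<^sub>M F T) \<Otimes>\<^sub>M lborel)"
    unfolding case_prod_beta' by measurable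
  from lborel.borel_measurable_lebesgue_integral[OF this]
  have "(\<lambda>z. \<integral>s. (if 0 \<le> s \<and> s \<le> ?c (fst z) then g (?c s) (snd z) else 0) \<partial>lborel) \<in> borel_measurable (borel \<Otimes>\<^sub>M F T)"
    by simp
  moreover have "(if 0 \<le> s \<and> s \<le> ?c t then g (?c s) \<omega> else 0) = indicator {0..?c t} s *\<^sub>R g s \<omega>" for s t \<omega>
    by (auto split: split_indicator simp: min_def max_def)
  ultimately show "(\<lambda>z. LBINT s:{0..?c (fst z)}. g s (snd z)) \<in> borel_measurable (borel \<Otimes>\<^sub>M F T)"
    by (simp add: set_lebesgue_integral_def)
qed

text \<open>Setting \<open>W\<close> to zero on a null set makes every path continuous; the result stays adapted
  because the filtration contains the null sets.\<close>

definition bad :: "'a set" where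
  "bad = (SOME N. N \<in> null_sets M \<and> (\<forall>\<omega>\<in>space M - N. continuous_on {0..} (\<lambda>t. W t \<omega>)))"

lemma bad: "bad \<in> null_sets M" "\<omega> \<in> space M - bad \<Longrightarrow> continuous_on {0..} (\<lambda>t. W t \<omega>)"
proof -
  obtain N where "{\<omega> \<in> space M. \<not> continuous_on {0..} (\<lambda>t. W t \<omega>)} \<subseteq> N" "N \<in> null_sets M"
    using W_continuous unfolding eventually_ae_filter by auto
  then have "N \<in> null_sets M \<and> (\<forall>\<omega>\<in>space M - N. continuous_on {0..} (\<lambda>t. W t \<omega>))" by auto
  then have "bad \<in> null_sets M \<and> (\<forall>\<omega>\<in>space M - bad. continuous_on {0..} (\<lambda>t. W t \<omega>))"
    unfolding bad_def by (rule someI)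
  then show "bad \<in> null_sets M" "\<omega> \<in> space M - bad \<Longrightarrow> continuous_on {0..} (\<lambda>t. W t \<omega>)" by auto
qed

definition V :: "real \<Rightarrow> 'a \<Rightarrow> real" where "V t \<omega> = (if \<omega> \<in> bad then 0 else W t \<omega>)"

lemma V_continuous: "\<omega> \<in> space M \<Longrightarrow> continuous_on {0..} (\<lambda>t. V t \<omega>)"
  using bad(2)[of \<omega>] by (cases "\<omega> \<in> bad") (auto simp: V_def)

lemma V_measurable_F: "0 \<le> s \<Longrightarrow> s \<le> t \<Longrightarrow> V s \<in> borel_measurable (F t)"
  unfolding V_def[abs_def]
  by (intro measurable_If_set W_measurable_F borel_measurable_const sets.Int null_sets_in_F[OF bad(1)] sets.top)

lemma V_AE: "AE \<omega> in M. \<forall>t. V t \<omega> = W t \<omega>"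
  using AE_not_in[OF bad(1)] by eventually_elim (simp add: V_def)

text \<open>The fundamental solution \<Phi>(s,t), built from \<open>V\<close> so that its paths are
  continuous at every \<omega> of the space. For \<open>s > t\<close> the formula gives the inverse
  of \<Phi>(t,s).\<close>

definition ratio :: "real \<Rightarrow> real \<Rightarrow> real \<Rightarrow> real \<Rightarrow> 'a \<Rightarrow> real" where
  "ratio a c s t \<omega> = exp ((a - c\<^sup>2 / 2) * (t - s) + c * (V t \<omega> - V s \<omega>))"

text \<open>Variation of constants with the factor \<Phi>(0,t) pulled out: the integral depends on
  \<open>t\<close> only through its upper limit, which makes continuity and progressive
  measurability immediate.\<close>

definition sol :: "real \<Rightarrow> real \<Rightarrow> real \<Rightarrow> (real \<Rightarrow> 'a \<Rightarrow> real) \<Rightarrow> real \<Rightarrow> 'a \<Rightarrow> real" where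
  "sol a c x u t \<omega> = ratio a c 0 t \<omega> * (x + (LBINT s:{0..t}. u s \<omega> / ratio a c 0 s \<omega>))"

lemma ratio_pos [simp]: "0 < ratio a c s t \<omega>" "ratio a c s t \<omega> \<noteq> 0"
  by (simp_all add: ratio_def)

lemma ratio_mult: "ratio a c s t \<omega> * ratio a c r s \<omega> = ratio a c r t \<omega>"
proof -
  have "(a - c\<^sup>2 / 2) * (t - s) + c * (V t \<omega> - V s \<omega>) + ((a - c\<^sup>2 / 2) * (s - r) + c * (V s \<omega> - V r \<omega>))
      = (a - c\<^sup>2 / 2) * (t - r) + c * (V t \<omega> - V r \<omega>)"
    by (simp add: ring_distribs)
  then show ?thesis by (simp add: ratio_def flip: exp_add)
qed

lemma ratio_self [simp]: "ratio a c s s \<omega> = 1" by (simp add: ratio_def)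

lemma ratio_continuous1: "\<omega> \<in> space M \<Longrightarrow> continuous_on {0..} (\<lambda>t. ratio a c s t \<omega>)"
  unfolding ratio_def by (intro continuous_intros V_continuous)

lemma ratio_continuous2: "\<omega> \<in> space M \<Longrightarrow> continuous_on {0..} (\<lambda>s. ratio a c s t \<omega>)"
  unfolding ratio_def by (intro continuous_intros V_continuous)

lemma ratio_measurable_F: "0 \<le> s \<Longrightarrow> s \<le> r \<Longrightarrow> 0 \<le> t \<Longrightarrow> t \<le> r \<Longrightarrow> ratio a c s t \<in> borel_measurable (F r)"
  unfolding ratio_def[abs_def] using V_measurable_F[of s r] V_measurable_F[of t r] by measurable

lemma progressive_ratio: "progressive M W (\<lambda>t. ratio a c 0 t)"
  by (rule progressive_continuous) (auto intro: ratio_measurable_F ratio_continuous1)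

lemma progressive_sol:
  assumes "progressive M W u"
  shows "progressive M W (sol a c x u)"
  unfolding sol_def[abs_def] using assms
  by (intro progressive_mult progressive_add progressive_const progressive_set_integral progressive_divide progressive_ratio)

text \<open>One null set serves all horizons: integrability up to every natural number gives it on
  every bounded interval of nonnegative times.\<close>

lemma AE_u_integrable:
  assumes u: "u \<in> L2F M W"
  shows "AE \<omega> in M. \<forall>n::nat. set_integrable lborel {0..real n} (\<lambda>s. u s \<omega>)"
  unfolding AE_all_countable using AE_set_integrable[OF L2F_D(1)[OF u] L2F_pnorm[OF u]] by auto

lemma set_integrable_Icc_nat:
  fixes f :: "real \<Rightarrow> real"
  assumes "\<forall>n::nat. set_integrable lborel {0..real n} f" "0 \<le> p"
  shows "set_integrable lborel {p..q} f"
proof -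
  obtain n :: nat where "q \<le> real n" using real_arch_simple by blast
  then show ?thesis
    using assms set_integrable_subset[of lborel "{0..real n}" f "{p..q}"] by auto
qed

lemma set_integrable_u_ratio:
  assumes u: "\<forall>n::nat. set_integrable lborel {0..real n} (\<lambda>s. u s \<omega>)" and \<omega>: "\<omega> \<in> space M" and p: "0 \<le> p"
  shows "set_integrable lborel {p..q} (\<lambda>s. u s \<omega> / ratio a c 0 s \<omega>)"
    and "set_integrable lborel {p..q} (\<lambda>s. ratio a c s q \<omega> * u s \<omega>)"
proof -
  have c1: "continuous_on {p..q} (\<lambda>s. 1 / ratio a c 0 s \<omega>)"
    using continuous_on_subset[OF ratio_continuous1[OF \<omega>], of "{p..q}"] p
    by (intro continuous_on_divide) auto
  have c2: "continuous_on {p..q} (\<lambda>s. ratio a c s q \<omega>)"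
    using continuous_on_subset[OF ratio_continuous2[OF \<omega>], of "{p..q}"] p by auto
  note ui = set_integrable_Icc_nat[OF u p, of q]
  show "set_integrable lborel {p..q} (\<lambda>s. u s \<omega> / ratio a c 0 s \<omega>)"
    using set_integrable_mult_continuous[OF ui c1] by simp
  show "set_integrable lborel {p..q} (\<lambda>s. ratio a c s q \<omega> * u s \<omega>)"
    using set_integrable_mult_continuous[OF ui c2] by (simp add: mult.commute)
qed

lemma sol_continuous:
  assumes "\<forall>n::nat. set_integrable lborel {0..real n} (\<lambda>s. u s \<omega>)" "\<omega> \<in> space M"
  shows "continuous_on {0..} (\<lambda>t. sol a c x u t \<omega>)"
  unfolding sol_def using assms
  by (intro continuous_on_mult continuous_on_add continuous_on_const ratio_continuous1
      continuous_on_set_integral_Icc set_integrable_u_ratio) auto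

text \<open>The solution restarted at time \<open>s\<close>. The past enters only through its value
  at \<open>s\<close>, which is independent of the later increments of \<open>W\<close>; every
  moment estimate below starts here.\<close>

lemma sol_flow:
  assumes u: "\<forall>n::nat. set_integrable lborel {0..real n} (\<lambda>s. u s \<omega>)" and \<omega>: "\<omega> \<in> space M"
    and st: "0 \<le> s" "s \<le> t"
  shows "sol a c x u t \<omega> = ratio a c s t \<omega> * sol a c x u s \<omega> + (LBINT r:{s..t}. ratio a c r t \<omega> * u r \<omega>)"
proof -
  have eq: "ratio a c 0 t \<omega> * (u r \<omega> / ratio a c 0 r \<omega>) = ratio a c r t \<omega> * u r \<omega>" for r
    using ratio_mult[of a c r t \<omega> 0] by (simp add: field_simps)
  have "sol a c x u t \<omega> = ratio a c 0 t \<omega> * (x + (LBINT r:{0..s}. u r \<omega> / ratio a c 0 r \<omega>)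
      + (LBINT r:{s..t}. u r \<omega> / ratio a c 0 r \<omega>))"
    unfolding sol_def using set_integral_combine_Icc[OF set_integrable_u_ratio(1)[where u=u and \<omega>=\<omega>, OF u \<omega>], of 0 s t a c] st
    by simp
  also have "\<dots> = ratio a c s t \<omega> * sol a c x u s \<omega> + (LBINT r:{s..t}. ratio a c 0 t \<omega> * (u r \<omega> / ratio a c 0 r \<omega>))"
    unfolding sol_def set_integral_mult_right
    using ratio_mult[of a c s t \<omega> 0] by (simp add: algebra_simps)
  finally show ?thesis unfolding eq .
qed

end

section \<open>Convergence of the Riemann sums\<close>

lemma exp_minus_one_bound: "\<bar>exp x - 1\<bar> \<le> exp \<bar>x\<bar> * \<bar>x\<bar>" for x :: real
proof -
  obtain t where t: "\<bar>t\<bar> \<le> \<bar>x\<bar>" "exp x = (\<Sum>m<1. x ^ m / fact m) + exp t / fact 1 * x ^ 1"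
    using Maclaurin_exp_le[of x 1] by blast
  then have "\<bar>exp x - 1\<bar> = exp t * \<bar>x\<bar>" by (simp add: abs_mult)
  also have "\<dots> \<le> exp \<bar>x\<bar> * \<bar>x\<bar>" using t(1) by (intro mult_right_mono) auto
  finally show ?thesis .
qed

lemma exp_minus_linear_bound: "\<bar>exp x - 1 - x\<bar> \<le> exp \<bar>x\<bar> * x\<^sup>2" for x :: real
proof -
  obtain t where t: "\<bar>t\<bar> \<le> \<bar>x\<bar>" "exp x = (\<Sum>m<2. x ^ m / fact m) + exp t / fact 2 * x ^ 2"
    using Maclaurin_exp_le[of x 2] by blast
  then have "\<bar>exp x - 1 - x\<bar> = exp t / 2 * x\<^sup>2" by (simp add: abs_mult numeral_2_eq_2)
  also have "\<dots> \<le> exp \<bar>x\<bar> * x\<^sup>2"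
    using t(1) exp_le_cancel_iff[of t "\<bar>x\<bar>"] exp_ge_zero[of t] by (intro mult_right_mono) (linarith, simp)
  finally show ?thesis .
qed

lemma exp_minus_one_bound_Icc:
  fixes l T :: real
  shows "\<exists>K\<ge>0. \<forall>h. 0 \<le> h \<longrightarrow> h \<le> T \<longrightarrow> \<bar>exp (l * h) - 1\<bar> \<le> K * h"
proof (intro exI[of _ "exp (\<bar>l\<bar> * T) * \<bar>l\<bar>"] conjI allI impI)
  fix h :: real assume h: "0 \<le> h" "h \<le> T"
  have "\<bar>exp (l * h) - 1\<bar> \<le> exp \<bar>l * h\<bar> * \<bar>l * h\<bar>" by (rule exp_minus_one_bound)
  also have "\<dots> \<le> exp (\<bar>l\<bar> * T) * \<bar>l * h\<bar>"
    using h by (intro mult_right_mono) (auto simp: abs_mult mult_left_mono)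
  also have "\<dots> = exp (\<bar>l\<bar> * T) * \<bar>l\<bar> * h" using h by (simp add: abs_mult)
  finally show "\<bar>exp (l * h) - 1\<bar> \<le> exp (\<bar>l\<bar> * T) * \<bar>l\<bar> * h" .
qed simp

lemma exp_minus_linear_bound_Icc:
  fixes l T :: real
  shows "\<exists>K\<ge>0. \<forall>h. 0 \<le> h \<longrightarrow> h \<le> T \<longrightarrow> \<bar>exp (l * h) - 1 - l * h\<bar> \<le> K * h\<^sup>2"
proof (intro exI[of _ "exp (\<bar>l\<bar> * T) * l\<^sup>2"] conjI allI impI)
  fix h :: real assume h: "0 \<le> h" "h \<le> T"
  have "\<bar>exp (l * h) - 1 - l * h\<bar> \<le> exp \<bar>l * h\<bar> * (l * h)\<^sup>2" by (rule exp_minus_linear_bound)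
  also have "\<dots> \<le> exp (\<bar>l\<bar> * T) * (l * h)\<^sup>2"
    using h by (intro mult_right_mono) (auto simp: abs_mult mult_left_mono)
  also have "\<dots> = exp (\<bar>l\<bar> * T) * l\<^sup>2 * h\<^sup>2" by (simp add: power_mult_distrib)
  finally show "\<bar>exp (l * h) - 1 - l * h\<bar> \<le> exp (\<bar>l\<bar> * T) * l\<^sup>2 * h\<^sup>2" .
qed simp

text \<open>\<open>gexp a c (t - s) (W\<^sub>t - W\<^sub>s)\<close> is the fundamental solution from \<open>s\<close> to \<open>t\<close>. Subtracting its
  mean and the Brownian increment leaves \<open>gres\<close>, centred with second moment of order
  \<open>(t - s)\<^sup>2\<close>.\<close>

definition gexp :: "real \<Rightarrow> real \<Rightarrow> real \<Rightarrow> real \<Rightarrow> real" where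
  "gexp a c h y = exp ((a - c\<^sup>2 / 2) * h + c * y)"

definition gres :: "real \<Rightarrow> real \<Rightarrow> real \<Rightarrow> real \<Rightarrow> real" where
  "gres a c h y = gexp a c h y - exp (a * h) - c * y"

lemma gexp_measurable [measurable]: "gexp a c h \<in> borel_measurable borel"
  unfolding gexp_def[abs_def] by measurable

lemma gres_measurable [measurable]: "gres a c h \<in> borel_measurable borel"
  unfolding gres_def[abs_def] by measurable

section \<open>Moments of one step of the fundamental solution\<close>

context brownian_space
begin

lemma ratio_eq_gexp: "ratio a c s t \<omega> = gexp a c (t - s) (V t \<omega> - V s \<omega>)"
  by (simp add: ratio_def gexp_def)

lemma msq_mult_ratio_fun:
  assumes "0 \<le> s" "s \<le> t" and "\<xi> \<in> borel_measurable (F s)" and "f \<in> borel_measurable borel"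
  shows "msq M (\<lambda>\<omega>. \<xi> \<omega> * f (V t \<omega> - V s \<omega>)) = msq M \<xi> * msq M (\<lambda>\<omega>. f (W t \<omega> - W s \<omega>))"
proof -
  have "msq M (\<lambda>\<omega>. \<xi> \<omega> * f (V t \<omega> - V s \<omega>)) = msq M (\<lambda>\<omega>. \<xi> \<omega> * f (W t \<omega> - W s \<omega>))"
    by (rule msq_cong_AE) (use V_AE in eventually_elim, simp)
  then show ?thesis using msq_mult_increment[OF assms] by simp
qed

text \<open>The correction \<open>- c^2 / 2\<close> in the exponent cancels the exponential moment
  of the Gaussian increment, leaving growth at rate \<open>a\<close>.\<close>

lemma gexp_mean:
  assumes "0 \<le> s" "s \<le> t"
  shows "has_bochner_integral M (\<lambda>\<omega>. gexp a c (t - s) (W t \<omega> - W s \<omega>)) (exp (a * (t - s)))"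
proof -
  have "has_bochner_integral M (\<lambda>\<omega>. exp ((a - c\<^sup>2 / 2) * (t - s)) * exp (c * (W t \<omega> - W s \<omega>)))
     (exp ((a - c\<^sup>2 / 2) * (t - s)) * exp (c\<^sup>2 * (t - s) / 2))"
    by (intro has_bochner_integral_mult_right exp_increment assms)
  moreover have "(a - c\<^sup>2 / 2) * (t - s) + c\<^sup>2 * (t - s) / 2 = a * (t - s)" by (simp add: field_simps)
  ultimately show ?thesis by (simp add: gexp_def exp_add[symmetric])
qed

text \<open>Squaring stays within the family, so second moments are means with changed parameters.
  The constant \<open>2 * a + c^2\<close> of the theorem originates here.\<close>

lemma gexp_square: "(gexp a c h y)\<^sup>2 = gexp (2 * a + c\<^sup>2) (2 * c) h y"
proof -
  have "2 * ((a - c\<^sup>2 / 2) * h + c * y) = (2 * a + c\<^sup>2 - (2 * c)\<^sup>2 / 2) * h + 2 * c * y"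
    by (simp add: power_mult_distrib field_simps)
  then show ?thesis by (simp add: gexp_def exp_double[symmetric])
qed

lemma gexp_square_mean:
  assumes "0 \<le> s" "s \<le> t"
  shows "has_bochner_integral M (\<lambda>\<omega>. (gexp a c (t - s) (W t \<omega> - W s \<omega>))\<^sup>2) (exp ((2 * a + c\<^sup>2) * (t - s)))"
  unfolding gexp_square by (rule gexp_mean[OF assms])

lemma msq_eq_bochner: "has_bochner_integral M (\<lambda>\<omega>. (f \<omega>)\<^sup>2) v \<Longrightarrow> msq M f = ennreal v"
  unfolding msq_def has_bochner_integral_iff by (subst nn_integral_eq_integral) auto

lemma msq_gexp:
  assumes "0 \<le> s" "s \<le> t"
  shows "msq M (\<lambda>\<omega>. gexp a c (t - s) (W t \<omega> - W s \<omega>)) = ennreal (exp ((2 * a + c\<^sup>2) * (t - s)))"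
  by (rule msq_eq_bochner[OF gexp_square_mean[OF assms]])

lemma has_bochner_const: "has_bochner_integral M (\<lambda>\<omega>. v::real) v"
  by (simp add: has_bochner_integral_iff prob_space)

lemma msq_gexp_minus_one:
  assumes "0 \<le> s" "s \<le> t"
  shows "msq M (\<lambda>\<omega>. gexp a c (t - s) (W t \<omega> - W s \<omega>) - 1)
    = ennreal (exp ((2 * a + c\<^sup>2) * (t - s)) - 2 * exp (a * (t - s)) + 1)"
proof (rule msq_eq_bochner)
  have "has_bochner_integral M (\<lambda>\<omega>. (gexp a c (t - s) (W t \<omega> - W s \<omega>))\<^sup>2 - 2 * gexp a c (t - s) (W t \<omega> - W s \<omega>) + 1)
     (exp ((2 * a + c\<^sup>2) * (t - s)) - 2 * exp (a * (t - s)) + 1)"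
    by (intro has_bochner_integral_add has_bochner_integral_diff has_bochner_integral_mult_right
        gexp_square_mean gexp_mean has_bochner_const assms)
  then show "has_bochner_integral M (\<lambda>\<omega>. (gexp a c (t - s) (W t \<omega> - W s \<omega>) - 1)\<^sup>2)
     (exp ((2 * a + c\<^sup>2) * (t - s)) - 2 * exp (a * (t - s)) + 1)"
    by (simp add: power2_diff algebra_simps)
qed

lemma gres_mean:
  assumes "0 \<le> s" "s \<le> t"
  shows "has_bochner_integral M (\<lambda>\<omega>. gres a c (t - s) (W t \<omega> - W s \<omega>)) 0"
proof -
  have "has_bochner_integral M (\<lambda>\<omega>. gexp a c (t - s) (W t \<omega> - W s \<omega>) - exp (a * (t - s)) - c * (W t \<omega> - W s \<omega>))
     (exp (a * (t - s)) - exp (a * (t - s)) - c * 0)"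
    by (intro has_bochner_integral_diff has_bochner_integral_mult_right gexp_mean has_bochner_const increment_mean assms)
  then show ?thesis by (simp add: gres_def)
qed

text \<open>The square is expanded into terms of known mean; the mixed moment of the increment with
  its exponential is the one supplied by \<open>increment_exp_increment\<close>.\<close>

lemma msq_gres:
  assumes "0 \<le> s" "s \<le> t"
  shows "msq M (\<lambda>\<omega>. gres a c (t - s) (W t \<omega> - W s \<omega>))
    = ennreal (exp ((2 * a + c\<^sup>2) * (t - s)) - exp (2 * a * (t - s)) + c\<^sup>2 * (t - s)
        - 2 * c\<^sup>2 * (t - s) * exp (a * (t - s)))"
proof (rule msq_eq_bochner)
  let ?h = "t - s"
  let ?D = "\<lambda>\<omega>. W t \<omega> - W s \<omega>"
  have 1: "has_bochner_integral M (\<lambda>\<omega>. exp ((a - c\<^sup>2 / 2) * ?h) * (?D \<omega> * exp (c * ?D \<omega>)))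
     (exp ((a - c\<^sup>2 / 2) * ?h) * (c * ?h * exp (c\<^sup>2 * ?h / 2)))"
    by (intro has_bochner_integral_mult_right increment_exp_increment assms)
  have "(a - c\<^sup>2 / 2) * ?h + c\<^sup>2 * ?h / 2 = a * ?h" by (simp add: field_simps)
  then have eqA: "exp ((a - c\<^sup>2 / 2) * ?h) * (c * ?h * exp (c\<^sup>2 * ?h / 2)) = c * ?h * exp (a * ?h)"
    by (simp add: mult.left_commute[of "exp _"] exp_add[symmetric])
  have eqB: "exp ((a - c\<^sup>2 / 2) * ?h) * (?D \<omega> * exp (c * ?D \<omega>)) = ?D \<omega> * gexp a c ?h (?D \<omega>)" for \<omega>
    by (simp add: gexp_def exp_add)
  note 1 = 1[unfolded eqA eqB]
  have "has_bochner_integral M (\<lambda>\<omega>. (gexp a c ?h (?D \<omega>))\<^sup>2 + (exp (a * ?h))\<^sup>2 + c\<^sup>2 * (?D \<omega>)\<^sup>2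
      - (2 * exp (a * ?h)) * gexp a c ?h (?D \<omega>) - (2 * c) * (?D \<omega> * gexp a c ?h (?D \<omega>))
      + (2 * c * exp (a * ?h)) * ?D \<omega>)
     (exp ((2 * a + c\<^sup>2) * ?h) + (exp (a * ?h))\<^sup>2 + c\<^sup>2 * ?h - (2 * exp (a * ?h)) * exp (a * ?h)
      - (2 * c) * (c * ?h * exp (a * ?h)) + (2 * c * exp (a * ?h)) * 0)"
    by (intro has_bochner_integral_add has_bochner_integral_diff has_bochner_integral_mult_right
        gexp_square_mean gexp_mean has_bochner_const increment_mean increment_square 1 assms)
  moreover have "(gexp a c ?h (?D \<omega>))\<^sup>2 + (exp (a * ?h))\<^sup>2 + c\<^sup>2 * (?D \<omega>)\<^sup>2
      - (2 * exp (a * ?h)) * gexp a c ?h (?D \<omega>) - (2 * c) * (?D \<omega> * gexp a c ?h (?D \<omega>))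
      + (2 * c * exp (a * ?h)) * ?D \<omega> = (gres a c ?h (?D \<omega>))\<^sup>2" for \<omega>
  proof -
    have "g\<^sup>2 + e\<^sup>2 + c\<^sup>2 * d\<^sup>2 - (2 * e) * g - (2 * c) * (d * g) + (2 * c * e) * d = (g - e - c * d)\<^sup>2" for g e d :: real
      by (simp add: power2_eq_square algebra_simps)
    then show ?thesis unfolding gres_def .
  qed
  moreover have "exp ((2 * a + c\<^sup>2) * ?h) + (exp (a * ?h))\<^sup>2 + c\<^sup>2 * ?h - (2 * exp (a * ?h)) * exp (a * ?h)
      - (2 * c) * (c * ?h * exp (a * ?h)) + (2 * c * exp (a * ?h)) * 0
    = exp ((2 * a + c\<^sup>2) * ?h) - exp (2 * a * ?h) + c\<^sup>2 * ?h - 2 * c\<^sup>2 * ?h * exp (a * ?h)"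
  proof -
    have "exp (2 * a * ?h) = (exp (a * ?h))\<^sup>2" by (simp add: exp_double[symmetric] mult.assoc)
    then show ?thesis by (simp add: power2_eq_square)
  qed
  ultimately show "has_bochner_integral M (\<lambda>\<omega>. (gres a c ?h (?D \<omega>))\<^sup>2)
     (exp ((2 * a + c\<^sup>2) * ?h) - exp (2 * a * ?h) + c\<^sup>2 * ?h - 2 * c\<^sup>2 * ?h * exp (a * ?h))"
    by (simp only:)
qed

text \<open>Taylor bounds turn the exact moments into orders 1, \<open>h\<close>, \<open>h^2\<close>
  and \<open>h^3\<close> of the step length \<open>h\<close>, with a single constant for all of
  \<open>[0,T]\<close>.\<close>

lemma moment_bounds:
  assumes T: "0 \<le> T"
  shows "\<exists>K\<ge>0.
    (\<forall>s t. 0 \<le> s \<longrightarrow> s \<le> t \<longrightarrow> t \<le> T \<longrightarrow>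
      msq M (\<lambda>\<omega>. gexp a c (t - s) (W t \<omega> - W s \<omega>)) \<le> ennreal K \<and>
      msq M (\<lambda>\<omega>. gexp a c (t - s) (W t \<omega> - W s \<omega>) - 1) \<le> ennreal (K * (t - s)) \<and>
      msq M (\<lambda>\<omega>. gres a c (t - s) (W t \<omega> - W s \<omega>)) \<le> ennreal (K * (t - s)\<^sup>2)) \<and>
    (\<forall>h. 0 \<le> h \<longrightarrow> h \<le> T \<longrightarrow> (exp (a * h) - 1 - a * h)\<^sup>2 \<le> K * h ^ 3)"
proof -
  let ?m = "2 * a + c\<^sup>2"
  obtain k1 where k1: "0 \<le> k1" "\<And>h. 0 \<le> h \<Longrightarrow> h \<le> T \<Longrightarrow> \<bar>exp (?m * h) - 1\<bar> \<le> k1 * h"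
    using exp_minus_one_bound_Icc[of T ?m] by auto
  obtain k2 where k2: "0 \<le> k2" "\<And>h. 0 \<le> h \<Longrightarrow> h \<le> T \<Longrightarrow> \<bar>exp (a * h) - 1\<bar> \<le> k2 * h"
    using exp_minus_one_bound_Icc[of T a] by auto
  obtain l1 where l1: "0 \<le> l1" "\<And>h. 0 \<le> h \<Longrightarrow> h \<le> T \<Longrightarrow> \<bar>exp (?m * h) - 1 - ?m * h\<bar> \<le> l1 * h\<^sup>2"
    using exp_minus_linear_bound_Icc[of T ?m] by auto
  obtain l2 where l2: "0 \<le> l2" "\<And>h. 0 \<le> h \<Longrightarrow> h \<le> T \<Longrightarrow> \<bar>exp (2 * a * h) - 1 - 2 * a * h\<bar> \<le> l2 * h\<^sup>2"
    using exp_minus_linear_bound_Icc[of T "2 * a"] by auto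
  obtain l3 where l3: "0 \<le> l3" "\<And>h. 0 \<le> h \<Longrightarrow> h \<le> T \<Longrightarrow> \<bar>exp (a * h) - 1 - a * h\<bar> \<le> l3 * h\<^sup>2"
    using exp_minus_linear_bound_Icc[of T a] by auto
  define c1 where "c1 = k1 * T + 1"
  define c2 where "c2 = k1 + 2 * k2"
  define c3 where "c3 = l1 + l2 + 2 * c\<^sup>2 * k2"
  define c4 where "c4 = l3\<^sup>2 * T"
  define K where "K = c1 + c2 + c3 + c4"
  have nn: "0 \<le> c1" "0 \<le> c2" "0 \<le> c3" "0 \<le> c4"
    using k1(1) k2(1) l1(1) l2(1) T by (auto simp: c1_def c2_def c3_def c4_def)
  have K: "c1 \<le> K" "c2 \<le> K" "c3 \<le> K" "c4 \<le> K" "0 \<le> K" using nn by (auto simp: K_def)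
  show ?thesis
  proof (intro exI[of _ K] conjI allI impI)
    show "0 \<le> K" by fact
    fix s t :: real assume st: "0 \<le> s" "s \<le> t" "t \<le> T"
    define h where "h = t - s"
    have h: "0 \<le> h" "h \<le> T" using st by (auto simp: h_def)
    have "exp (?m * h) \<le> k1 * h + 1" using k1(2)[OF h] by linarith
    also have "\<dots> \<le> c1" using h k1(1) by (simp add: c1_def mult_left_mono)
    finally have "exp (?m * h) \<le> K" using K(1) by simp
    then show "msq M (\<lambda>\<omega>. gexp a c (t - s) (W t \<omega> - W s \<omega>)) \<le> ennreal K"
      unfolding msq_gexp[OF st(1,2)] h_def by (rule ennreal_leI)
    \<comment> \<open>The constants \<open>1 - 2 + 1\<close> cancel, so two first-order bounds
      suffice.\<close>
    have "exp (?m * h) - 2 * exp (a * h) + 1 \<le> k1 * h + 2 * (k2 * h)"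
      using k1(2)[OF h] k2(2)[OF h] by linarith
    also have "\<dots> = c2 * h" by (simp add: c2_def algebra_simps)
    also have "\<dots> \<le> K * h" using K(2) h by (simp add: mult_right_mono)
    finally show "msq M (\<lambda>\<omega>. gexp a c (t - s) (W t \<omega> - W s \<omega>) - 1) \<le> ennreal (K * (t - s))"
      unfolding msq_gexp_minus_one[OF st(1,2)] h_def by (rule ennreal_leI)
    \<comment> \<open>The first-order part is \<open>?m - 2 * a + c^2 - 2 * c^2 = 0\<close>. This
      cancellation is why \<open>gres\<close> has second moment of order \<open>h^2\<close> rather
      than \<open>h\<close>.\<close>
    have "exp (?m * h) - exp (2 * a * h) + c\<^sup>2 * h - 2 * c\<^sup>2 * h * exp (a * h)
        = (exp (?m * h) - 1 - ?m * h) - (exp (2 * a * h) - 1 - 2 * a * h) - 2 * c\<^sup>2 * h * (exp (a * h) - 1)"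
      by (simp add: algebra_simps)
    also have "\<dots> \<le> l1 * h\<^sup>2 + l2 * h\<^sup>2 + 2 * c\<^sup>2 * h * (k2 * h)"
    proof -
      have "2 * c\<^sup>2 * h * (1 - exp (a * h)) \<le> 2 * c\<^sup>2 * h * (k2 * h)"
        using k2(2)[OF h] h by (intro mult_left_mono) auto
      moreover have "2 * c\<^sup>2 * h * (1 - exp (a * h)) = - (2 * c\<^sup>2 * h * (exp (a * h) - 1))"
        by (simp add: algebra_simps)
      ultimately show ?thesis using abs_le_D1[OF l1(2)[OF h]] abs_le_D2[OF l2(2)[OF h]] by linarith
    qed
    also have "\<dots> = c3 * h\<^sup>2" by (simp add: c3_def power2_eq_square algebra_simps)
    also have "\<dots> \<le> K * h\<^sup>2" using K(3) by (simp add: mult_right_mono)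
    finally show "msq M (\<lambda>\<omega>. gres a c (t - s) (W t \<omega> - W s \<omega>)) \<le> ennreal (K * (t - s)\<^sup>2)"
      unfolding msq_gres[OF st(1,2)] h_def by (rule ennreal_leI)
  next
    fix h :: real assume h: "0 \<le> h" "h \<le> T"
    have "(exp (a * h) - 1 - a * h)\<^sup>2 \<le> (l3 * h\<^sup>2)\<^sup>2"
      using l3(2)[OF h] by (metis abs_ge_zero power2_abs power_mono)
    \<comment> \<open>The true order is \<open>h^4\<close>; one factor \<open>h\<close> is traded
      for \<open>T\<close> to reach the order of the other remainders.\<close>
    also have "\<dots> = l3\<^sup>2 * h * h ^ 3" by (simp add: power2_eq_square power3_eq_cube)
    also have "\<dots> \<le> c4 * h ^ 3" using h by (simp add: c4_def mult_left_mono mult_right_mono)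
    also have "\<dots> \<le> K * h ^ 3" using K(4) h by (simp add: mult_right_mono)
    finally show "(exp (a * h) - 1 - a * h)\<^sup>2 \<le> K * h ^ 3" .
  qed
qed


text \<open>The control is bounded only in mean square over time, so the error of a grid step is
  measured by the mass of \<open>u\<close> on its interval. These masses add up to the total over
  the grid.\<close>

definition umass :: "(real \<Rightarrow> 'a \<Rightarrow> real) \<Rightarrow> real \<Rightarrow> real \<Rightarrow> ennreal" where
  "umass u p q = (\<integral>\<^sup>+s\<in>{p..q}. msq M (u s) \<partial>lborel)"

lemma L2F_joint_measurable:
  assumes "u \<in> L2F M W" "0 \<le> p"
  shows "jointly_measurable {p..q} u"
  using assms by (intro joint_measurable_mono[OF progressive_joint_measurable[OF L2F_D(1)]]) auto

lemma umass_measurable: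
  assumes "u \<in> L2F M W" "0 \<le> p"
  shows "(\<lambda>s. msq M (u s) * indicator {p..q} s) \<in> borel_measurable lborel"
  by (rule measurable_msq_time[OF L2F_joint_measurable[OF assms]])

lemma umass_add:
  assumes "u \<in> L2F M W" "0 \<le> p" "p \<le> q" "q \<le> r"
  shows "umass u p q + umass u q r = umass u p r"
proof -
  have "umass u p q + umass u q r
      = (\<integral>\<^sup>+s. msq M (u s) * indicator {p..q} s + msq M (u s) * indicator {q..r} s \<partial>lborel)"
    unfolding umass_def using assms by (intro nn_integral_add[symmetric] umass_measurable) auto
  also have "\<dots> = umass u p r"
    unfolding umass_def
  proof (rule nn_integral_cong_AE)
    show "AE s in lborel. msq M (u s) * indicator {p..q} s + msq M (u s) * indicator {q..r} s
        = msq M (u s) * indicator {p..r} s"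
      using AE_lborel_singleton[of q] by eventually_elim (use assms in \<open>auto split: split_indicator\<close>)
  qed
  finally show ?thesis .
qed

lemma umass_le_pnorm:
  assumes "u \<in> L2F M W" "0 \<le> p" "q \<le> T"
  shows "umass u p q \<le> pnorm T u"
proof -
  have "pnorm T u = umass u 0 T"
    unfolding umass_def using assms by (intro pnorm_eq L2F_joint_measurable) auto
  moreover have "umass u p q \<le> umass u 0 T"
    unfolding umass_def using assms by (intro nn_integral_mono) (auto split: split_indicator)
  ultimately show ?thesis by simp
qed

lemma ratio_measurable: "0 \<le> s \<Longrightarrow> 0 \<le> t \<Longrightarrow> ratio a c s t \<in> borel_measurable M"
  by (rule measurable_F_M[of _ "max s t"]) (auto intro: ratio_measurable_F)

text \<open>The factor \<Phi>(s,q) looks ahead of \<open>s\<close>, so the product is not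
  progressive. Writing it as \<Phi>(0,q) times the progressive quotient of \<open>u\<close> by
  \<Phi>(0,s) restores joint measurability.\<close>

lemma progressive_ratio_mult_joint_measurable:
  assumes u: "progressive M W u" and "0 \<le> p" "0 \<le> q"
  shows "(\<lambda>z. indicator {p..q} (fst z) * (ratio a c (fst z) q (snd z) * u (fst z) (snd z))) \<in> borel_measurable (lborel \<Otimes>\<^sub>M M)"
proof -
  have "progressive M W (\<lambda>t \<omega>. u t \<omega> / ratio a c 0 t \<omega>)"
    by (intro progressive_divide u progressive_ratio)
  from joint_measurable_mono[OF progressive_joint_measurable[OF this], of "{p..q}"]
  have m1: "(\<lambda>z. indicator {p..q} (fst z) * (u (fst z) (snd z) / ratio a c 0 (fst z) (snd z))) \<in> borel_measurable (lborel \<Otimes>\<^sub>M M)"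
    using assms by auto
  have m2: "(\<lambda>z. ratio a c 0 q (snd z)) \<in> borel_measurable (lborel \<Otimes>\<^sub>M M)"
    using assms by (intro measurable_compose[OF measurable_snd] ratio_measurable) auto
  have "(\<lambda>z. ratio a c 0 q (snd z) * (indicator {p..q} (fst z) * (u (fst z) (snd z) / ratio a c 0 (fst z) (snd z))))
      \<in> borel_measurable (lborel \<Otimes>\<^sub>M M)"
    by (rule borel_measurable_times[OF m2 m1])
  moreover have "ratio a c 0 q \<omega> * (i * (v / ratio a c 0 s \<omega>)) = i * (ratio a c s q \<omega> * v)" for i v s \<omega>
    using ratio_mult[of a c s q \<omega> 0] by (simp add: field_simps)
  ultimately show ?thesis by simp
qed

lemma sol_0: "sol a c x u 0 \<omega> = x"
proof -
  have "(LBINT s:{0..0}. u s \<omega> / ratio a c 0 s \<omega>) = 0"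
    unfolding set_lebesgue_integral_def
    by (rule integral_eq_zero_AE) (use AE_lborel_singleton[of 0] in \<open>eventually_elim, auto split: split_indicator\<close>)
  then show ?thesis by (simp add: sol_def)
qed

lemma sol_measurable_F: "u \<in> L2F M W \<Longrightarrow> 0 \<le> t \<Longrightarrow> sol a c x u t \<in> borel_measurable (F t)"
  by (intro progressive_measurable_F progressive_sol L2F_D)

lemma sol_measurable: "u \<in> L2F M W \<Longrightarrow> 0 \<le> t \<Longrightarrow> sol a c x u t \<in> borel_measurable M"
  by (rule measurable_F_M[OF sol_measurable_F])

text \<open>At each \<open>s\<close> the factor \<open>f\<close> depends on the increment after
  \<open>s\<close> and is independent of \<open>u s\<close>, so the second moment factorises under
  the time integral. It is applied with the fundamental solution itself and with its deviation from
  1.\<close>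

lemma msq_conv_integral_le:
  assumes u: "u \<in> L2F M W" and pq: "0 \<le> p" "p \<le> q" and b: "0 \<le> b"
    and f[measurable]: "\<And>h. f h \<in> borel_measurable borel"
    and jm: "(\<lambda>z. indicator {p..q} (fst z) * (f (q - fst z) (V q (snd z) - V (fst z) (snd z)) * u (fst z) (snd z))) \<in> borel_measurable (lborel \<Otimes>\<^sub>M M)"
    and bound: "\<And>s. p \<le> s \<Longrightarrow> s \<le> q \<Longrightarrow> msq M (\<lambda>\<omega>. f (q - s) (W q \<omega> - W s \<omega>)) \<le> ennreal b"
  shows "msq M (\<lambda>\<omega>. LBINT s:{p..q}. f (q - s) (V q \<omega> - V s \<omega>) * u s \<omega>) \<le> ennreal ((q - p) * b) * umass u p q"
proof -
  have "msq M (\<lambda>\<omega>. LBINT s:{p..q}. f (q - s) (V q \<omega> - V s \<omega>) * u s \<omega>)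
      \<le> ennreal (q - p) * (\<integral>\<^sup>+s\<in>{p..q}. msq M (\<lambda>\<omega>. f (q - s) (V q \<omega> - V s \<omega>) * u s \<omega>) \<partial>lborel)"
    by (rule msq_set_integral_le[OF jm pq(2)])
  also have "(\<integral>\<^sup>+s\<in>{p..q}. msq M (\<lambda>\<omega>. f (q - s) (V q \<omega> - V s \<omega>) * u s \<omega>) \<partial>lborel)
      \<le> (\<integral>\<^sup>+s. ennreal b * (msq M (u s) * indicator {p..q} s) \<partial>lborel)"
  proof (rule nn_integral_mono)
    fix s
    show "msq M (\<lambda>\<omega>. f (q - s) (V q \<omega> - V s \<omega>) * u s \<omega>) * indicator {p..q} s
        \<le> ennreal b * (msq M (u s) * indicator {p..q} s)"
    proof (cases "s \<in> {p..q}")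
      case True
      then have s: "0 \<le> s" "s \<le> q" "p \<le> s" using pq by auto
      have "msq M (\<lambda>\<omega>. f (q - s) (V q \<omega> - V s \<omega>) * u s \<omega>) = msq M (\<lambda>\<omega>. u s \<omega> * f (q - s) (V q \<omega> - V s \<omega>))"
        by (simp add: mult.commute)
      also have "\<dots> = msq M (u s) * msq M (\<lambda>\<omega>. f (q - s) (W q \<omega> - W s \<omega>))"
        by (intro msq_mult_ratio_fun s progressive_measurable_F[OF L2F_D(1)[OF u]] f)
      also have "\<dots> \<le> msq M (u s) * ennreal b" using bound[OF s(3,2)] by (rule mult_left_mono) simp
      finally show ?thesis using True by (simp add: mult.commute)
    qed simp
  qed
  also have "\<dots> = ennreal b * umass u p q"
    unfolding umass_def by (rule nn_integral_cmult[OF umass_measurable[OF u pq(1)]])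
  finally show ?thesis
    using pq b by (simp add: ennreal_mult mult.assoc mult_left_mono)
qed

lemma AE_sol_flow:
  assumes u: "u \<in> L2F M W" and st: "0 \<le> s" "s \<le> t"
  shows "AE \<omega> in M. sol a c x u t \<omega> = ratio a c s t \<omega> * sol a c x u s \<omega> + (LBINT r:{s..t}. ratio a c r t \<omega> * u r \<omega>)"
  using AE_u_integrable[OF u] AE_space
  by eventually_elim (rule sol_flow[OF _ _ st])

text \<open>Uniform boundedness and Hoelder continuity of order 1/2 in mean square, both read off
  from \<open>sol_flow\<close>: on a time step of length \<open>h\<close>, the noise contributes
  order \<open>h\<close> to the second moment.\<close>

lemma sol_bounds:
  assumes u: "u \<in> L2F M W" and T: "0 \<le> T"
  shows "\<exists>K\<ge>0. (\<forall>t. 0 \<le> t \<longrightarrow> t \<le> T \<longrightarrow> msq M (sol a c x u t) \<le> ennreal K) \<and>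
    (\<forall>s t. 0 \<le> s \<longrightarrow> s \<le> t \<longrightarrow> t \<le> T \<longrightarrow> msq M (\<lambda>\<omega>. sol a c x u t \<omega> - sol a c x u s \<omega>) \<le> ennreal (K * (t - s)))"
proof -
  obtain K where K0: "0 \<le> K" and K': "\<forall>s t. 0 \<le> s \<longrightarrow> s \<le> t \<longrightarrow> t \<le> T \<longrightarrow>
      msq M (\<lambda>\<omega>. gexp a c (t - s) (W t \<omega> - W s \<omega>)) \<le> ennreal K \<and>
      msq M (\<lambda>\<omega>. gexp a c (t - s) (W t \<omega> - W s \<omega>) - 1) \<le> ennreal (K * (t - s)) \<and>
      msq M (\<lambda>\<omega>. gres a c (t - s) (W t \<omega> - W s \<omega>)) \<le> ennreal (K * (t - s)\<^sup>2)"
    using moment_bounds[OF T, of a c] by (elim exE conjE)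
  note K = K0 K'[rule_format, THEN conjunct1] K'[rule_format, THEN conjunct2, THEN conjunct1]
  obtain B where B: "0 \<le> B" "pnorm T u = ennreal B"
    using L2F_pnorm[OF u, of T] by (cases "pnorm T u") auto
  let ?J = "\<lambda>s t \<omega>. LBINT r:{s..t}. ratio a c r t \<omega> * u r \<omega>"
  have J: "msq M (?J s t) \<le> ennreal ((t - s) * K * B)" if st: "0 \<le> s" "s \<le> t" "t \<le> T" for s t
  proof -
    have "msq M (?J s t) \<le> ennreal ((t - s) * K) * umass u s t"
      unfolding ratio_eq_gexp
      using st K(1) progressive_ratio_mult_joint_measurable[OF L2F_D(1)[OF u], of s t a c]
      by (intro msq_conv_integral_le u K(2)) (auto simp: ratio_eq_gexp)
    also have "\<dots> \<le> ennreal ((t - s) * K) * ennreal B"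
      using umass_le_pnorm[OF u st(1,3)] B by (intro mult_left_mono) auto
    finally show ?thesis using st K B by (simp add: ennreal_mult[symmetric])
  qed
  have Jm: "?J s t \<in> borel_measurable M" if st: "0 \<le> s" "s \<le> t" for s t
  proof -
    have "(\<lambda>(\<omega>, r). indicator {s..t} r * (ratio a c r t \<omega> * u r \<omega>)) \<in> borel_measurable (M \<Otimes>\<^sub>M lborel)"
      using measurable_compose[OF measurable_pair_swap' progressive_ratio_mult_joint_measurable[OF L2F_D(1)[OF u], of s t a c]] st
      by (simp add: case_prod_beta')
    from lborel.borel_measurable_lebesgue_integral[OF this] show ?thesis
      by (simp add: set_lebesgue_integral_def)
  qed
  define K1 where "K1 = 2 * (K * x\<^sup>2 + T * K * B)"
  have K1: "msq M (sol a c x u t) \<le> ennreal K1" "0 \<le> K1" if t: "0 \<le> t" "t \<le> T" for t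
  proof -
    have "AE \<omega> in M. sol a c x u t \<omega> = x * ratio a c 0 t \<omega> + ?J 0 t \<omega>"
      using AE_sol_flow[OF u order_refl t(1), of a c x] by (simp add: sol_0 mult.commute)
    then have "msq M (sol a c x u t) = msq M (\<lambda>\<omega>. x * ratio a c 0 t \<omega> + ?J 0 t \<omega>)" by (rule msq_cong_AE)
    also have "\<dots> \<le> 2 * (msq M (\<lambda>\<omega>. x * ratio a c 0 t \<omega>) + msq M (?J 0 t))"
      using t by (intro msq_add Jm borel_measurable_times ratio_measurable) auto
    also have "msq M (\<lambda>\<omega>. x * ratio a c 0 t \<omega>) = msq M (\<lambda>_. x) * msq M (\<lambda>\<omega>. gexp a c (t - 0) (W t \<omega> - W 0 \<omega>))"
      unfolding ratio_eq_gexp by (rule msq_mult_ratio_fun) (use t in auto)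
    also have "msq M (\<lambda>_. x) = ennreal (x\<^sup>2)" by (simp add: msq_def emeasure_space_1)
    also have "2 * (ennreal (x\<^sup>2) * msq M (\<lambda>\<omega>. gexp a c (t - 0) (W t \<omega> - W 0 \<omega>)) + msq M (?J 0 t))
       \<le> 2 * (ennreal (x\<^sup>2) * ennreal K + ennreal ((t - 0) * K * B))"
      using t by (intro mult_left_mono add_mono K(2) J) auto
    also have "\<dots> = ennreal (2 * (x\<^sup>2 * K + t * K * B))"
      using t K B by (simp add: ennreal_mult[symmetric] ennreal_plus[symmetric] ennreal_numeral[symmetric] del: ennreal_plus ennreal_numeral)
    also have "\<dots> \<le> ennreal K1"
      unfolding K1_def using t K B by (intro ennreal_leI mult_left_mono add_mono mult_right_mono) auto
    finally show "msq M (sol a c x u t) \<le> ennreal K1" .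
    show "0 \<le> K1" using T K B by (simp add: K1_def)
  qed
  define K2 where "K2 = 2 * (K1 * K + K * B)"
  have K2: "msq M (\<lambda>\<omega>. sol a c x u t \<omega> - sol a c x u s \<omega>) \<le> ennreal (K2 * (t - s))" "0 \<le> K2"
    if st: "0 \<le> s" "s \<le> t" "t \<le> T" for s t
  proof -
    \<comment> \<open>The flow splits the increment into the past value times the deviation of the
      fundamental solution from 1, and the contribution of the control.\<close>
    have "AE \<omega> in M. sol a c x u t \<omega> - sol a c x u s \<omega> = sol a c x u s \<omega> * (gexp a c (t - s) (V t \<omega> - V s \<omega>) - 1) + ?J s t \<omega>"
      using AE_sol_flow[OF u st(1,2), of a c x] by eventually_elim (simp add: ratio_eq_gexp algebra_simps)
    then have "msq M (\<lambda>\<omega>. sol a c x u t \<omega> - sol a c x u s \<omega>)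
        = msq M (\<lambda>\<omega>. sol a c x u s \<omega> * (gexp a c (t - s) (V t \<omega> - V s \<omega>) - 1) + ?J s t \<omega>)" by (rule msq_cong_AE)
    also have "\<dots> \<le> 2 * (msq M (\<lambda>\<omega>. sol a c x u s \<omega> * (gexp a c (t - s) (V t \<omega> - V s \<omega>) - 1)) + msq M (?J s t))"
    proof (intro msq_add Jm st borel_measurable_times borel_measurable_diff borel_measurable_const)
      show "sol a c x u s \<in> borel_measurable M" by (rule sol_measurable[OF u st(1)])
      show "(\<lambda>\<omega>. gexp a c (t - s) (V t \<omega> - V s \<omega>)) \<in> borel_measurable M"
        using ratio_measurable[of s t a c] st by (simp add: ratio_eq_gexp[symmetric, abs_def])
    qed
    also have "msq M (\<lambda>\<omega>. sol a c x u s \<omega> * (gexp a c (t - s) (V t \<omega> - V s \<omega>) - 1))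
       = msq M (sol a c x u s) * msq M (\<lambda>\<omega>. gexp a c (t - s) (W t \<omega> - W s \<omega>) - 1)"
      using st u by (intro msq_mult_ratio_fun[where f="\<lambda>y. gexp a c (t - s) y - 1"] sol_measurable_F) auto
    also have "2 * (msq M (sol a c x u s) * msq M (\<lambda>\<omega>. gexp a c (t - s) (W t \<omega> - W s \<omega>) - 1) + msq M (?J s t))
       \<le> 2 * (ennreal K1 * ennreal (K * (t - s)) + ennreal ((t - s) * K * B))"
      using st by (intro mult_left_mono add_mono mult_mono K(3) K1 J) auto
    also have "\<dots> = ennreal (K2 * (t - s))"
    proof -
      have nn: "0 \<le> K1" "0 \<le> K * (t - s)" "0 \<le> (t - s) * K * B" using st K(1) B K1(2)[of 0] T by auto
      have "2 * (ennreal K1 * ennreal (K * (t - s)) + ennreal ((t - s) * K * B))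
          = ennreal (2 * (K1 * (K * (t - s)) + (t - s) * K * B))"
        using nn by (simp only: ennreal_mult ennreal_plus ennreal_numeral mult_nonneg_nonneg add_nonneg_nonneg zero_le_numeral)
      then show ?thesis unfolding K2_def by (simp add: algebra_simps)
    qed
    finally show "msq M (\<lambda>\<omega>. sol a c x u t \<omega> - sol a c x u s \<omega>) \<le> ennreal (K2 * (t - s))" .
    show "0 \<le> K2" using K B K1(2)[of 0] T by (simp add: K2_def)
  qed
  have nn: "0 \<le> K1" "0 \<le> K2" using K1(2)[of 0] K2(2)[of 0 0] T by auto
  show ?thesis
  proof (intro exI[of _ "K1 + K2"] conjI allI impI)
    show "0 \<le> K1 + K2" using nn by simp
    show "msq M (sol a c x u t) \<le> ennreal (K1 + K2)" if that: "0 \<le> t" "t \<le> T" for t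
      using K1(1)[OF that] nn by (elim order_trans) (simp add: ennreal_leI)
    show "msq M (\<lambda>\<omega>. sol a c x u t \<omega> - sol a c x u s \<omega>) \<le> ennreal ((K1 + K2) * (t - s))"
      if "0 \<le> s" "s \<le> t" "t \<le> T" for s t
      using K2(1)[OF that] nn that by (elim order_trans) (simp add: ennreal_leI mult_right_mono)
  qed
qed


lemma set_integral_measurable:
  fixes f :: "real \<Rightarrow> 'a \<Rightarrow> real"
  assumes "jointly_measurable A f"
  shows "(\<lambda>\<omega>. LBINT s:A. f s \<omega>) \<in> borel_measurable M"
proof -
  have "(\<lambda>(\<omega>, s). indicator A s * f s \<omega>) \<in> borel_measurable (M \<Otimes>\<^sub>M lborel)"
    using measurable_compose[OF measurable_pair_swap' assms] by (simp add: case_prod_beta')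
  from lborel.borel_measurable_lebesgue_integral[OF this] show ?thesis
    by (simp add: set_lebesgue_integral_def)
qed

lemma sol_joint_measurable:
  assumes "u \<in> L2F M W" "0 \<le> p"
  shows "jointly_measurable {p..q} (sol a c x u)"
  using assms by (intro joint_measurable_mono[OF progressive_joint_measurable[OF progressive_sol[OF L2F_D(1)]]]) auto

lemma AE_sol_integrable:
  assumes u: "u \<in> L2F M W"
  shows "AE \<omega> in M. \<forall>p q. 0 \<le> p \<longrightarrow> set_integrable lborel {p..q} (\<lambda>s. sol a c x u s \<omega>)"
  using AE_u_integrable[OF u] AE_space
proof eventually_elim
  case (elim \<omega>)
  show ?case
    using continuous_on_subset[OF sol_continuous[where u=u and \<omega>=\<omega>, OF elim, of a c x]]
    by (auto intro!: borel_integrable_atLeastAtMost')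
qed

text \<open>One step of the grid: a martingale increment of second moment \<open>O(h\<^sup>2)\<close>, for which the sum
  over the grid uses orthogonality, plus a remainder \<open>Z\<close> small enough for Cauchy-Schwarz.\<close>

lemma sol_step:
  assumes u: "u \<in> L2F M W" and T: "0 \<le> T"
  shows "\<exists>K\<ge>0. \<forall>p q. 0 \<le> p \<longrightarrow> p \<le> q \<longrightarrow> q \<le> T \<longrightarrow> (\<exists>Z\<in>borel_measurable M.
    (AE \<omega> in M. sol a c x u q \<omega> - sol a c x u p \<omega> - (LBINT s:{p..q}. a * sol a c x u s \<omega> + u s \<omega>)
        - c * sol a c x u p \<omega> * (W q \<omega> - W p \<omega>)
      = sol a c x u p \<omega> * gres a c (q - p) (W q \<omega> - W p \<omega>) + Z \<omega>) \<and>
    msq M Z \<le> ennreal (K * (q - p) ^ 3) + ennreal (K * (q - p)\<^sup>2) * umass u p q)"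
proof -
  obtain Ka where Ka: "0 \<le> Ka" and Ka': "\<forall>s t. 0 \<le> s \<longrightarrow> s \<le> t \<longrightarrow> t \<le> T \<longrightarrow>
      msq M (\<lambda>\<omega>. gexp a c (t - s) (W t \<omega> - W s \<omega>)) \<le> ennreal Ka \<and>
      msq M (\<lambda>\<omega>. gexp a c (t - s) (W t \<omega> - W s \<omega>) - 1) \<le> ennreal (Ka * (t - s)) \<and>
      msq M (\<lambda>\<omega>. gres a c (t - s) (W t \<omega> - W s \<omega>)) \<le> ennreal (Ka * (t - s)\<^sup>2)"
    and Ka3: "\<forall>h. 0 \<le> h \<longrightarrow> h \<le> T \<longrightarrow> (exp (a * h) - 1 - a * h)\<^sup>2 \<le> Ka * h ^ 3"
    using moment_bounds[OF T, of a c] by (elim exE conjE)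
  note Ka2 = Ka'[rule_format, THEN conjunct2, THEN conjunct1]
  obtain Ks where Ks: "0 \<le> Ks" and Ks1: "\<forall>t. 0 \<le> t \<longrightarrow> t \<le> T \<longrightarrow> msq M (sol a c x u t) \<le> ennreal Ks"
    and Ks2: "\<forall>s t. 0 \<le> s \<longrightarrow> s \<le> t \<longrightarrow> t \<le> T \<longrightarrow> msq M (\<lambda>\<omega>. sol a c x u t \<omega> - sol a c x u s \<omega>) \<le> ennreal (Ks * (t - s))"
    using sol_bounds[OF u T, of a c x] by (elim exE conjE)
  define K where "K = 3 * (Ka * Ks + a\<^sup>2 * Ks + Ka)"
  let ?X = "sol a c x u"
  have main: "\<exists>Z\<in>borel_measurable M.
    (AE \<omega> in M. ?X q \<omega> - ?X p \<omega> - (LBINT s:{p..q}. a * ?X s \<omega> + u s \<omega>) - c * ?X p \<omega> * (W q \<omega> - W p \<omega>)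
      = ?X p \<omega> * gres a c (q - p) (W q \<omega> - W p \<omega>) + Z \<omega>) \<and>
    msq M Z \<le> ennreal (K * (q - p) ^ 3) + ennreal (K * (q - p)\<^sup>2) * umass u p q"
    if pq: "0 \<le> p" "p \<le> q" "q \<le> T" for p q
  proof -
    define h where "h = q - p"
    have h: "0 \<le> h" "h \<le> T" using pq by (auto simp: h_def)
    define e where "e = exp (a * h) - 1 - a * h"
    let ?Z1 = "\<lambda>\<omega>. e * ?X p \<omega>"
    let ?Z2 = "\<lambda>\<omega>. LBINT s:{p..q}. a * (?X p \<omega> - ?X s \<omega>)"
    let ?f = "\<lambda>h y. gexp a c h y - 1"
    let ?Z3 = "\<lambda>\<omega>. LBINT s:{p..q}. ?f (q - s) (V q \<omega> - V s \<omega>) * u s \<omega>"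
    note Xm = sol_measurable[OF u pq(1), of a c x]
    have jm2: "(\<lambda>z. indicator {p..q} (fst z) * (a * (?X p (snd z) - ?X (fst z) (snd z)))) \<in> borel_measurable (lborel \<Otimes>\<^sub>M M)"
    proof -
      note [measurable] = sol_joint_measurable[OF u pq(1), of q a c x] measurable_compose[OF measurable_snd Xm]
      have "(\<lambda>z. a * (indicator {p..q} (fst z) * ?X p (snd z) - indicator {p..q} (fst z) * ?X (fst z) (snd z))) \<in> borel_measurable (lborel \<Otimes>\<^sub>M M)"
        by measurable
      then show ?thesis by (simp add: algebra_simps)
    qed
    have jm3: "(\<lambda>z. indicator {p..q} (fst z) * (?f (q - fst z) (V q (snd z) - V (fst z) (snd z)) * u (fst z) (snd z))) \<in> borel_measurable (lborel \<Otimes>\<^sub>M M)"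
      using borel_measurable_diff[OF progressive_ratio_mult_joint_measurable[OF L2F_D(1)[OF u], of p q a c] L2F_joint_measurable[OF u pq(1), of q]] pq
      by (simp add: ratio_eq_gexp algebra_simps)
    show ?thesis
    proof (intro bexI[of _ "\<lambda>\<omega>. ?Z1 \<omega> + ?Z2 \<omega> + ?Z3 \<omega>"] conjI)
      show m: "(\<lambda>\<omega>. ?Z1 \<omega> + ?Z2 \<omega> + ?Z3 \<omega>) \<in> borel_measurable M"
        by (intro borel_measurable_add borel_measurable_times borel_measurable_const Xm set_integral_measurable jm2 jm3)
      show "AE \<omega> in M. ?X q \<omega> - ?X p \<omega> - (LBINT s:{p..q}. a * ?X s \<omega> + u s \<omega>) - c * ?X p \<omega> * (W q \<omega> - W p \<omega>)
        = ?X p \<omega> * gres a c (q - p) (W q \<omega> - W p \<omega>) + (?Z1 \<omega> + ?Z2 \<omega> + ?Z3 \<omega>)"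
        using AE_u_integrable[OF u] AE_sol_integrable[OF u, of a c x] V_AE AE_space
      proof eventually_elim
        case (elim \<omega>)
        have ui: "set_integrable lborel {p..q} (\<lambda>s. u s \<omega>)"
          using set_integrable_Icc_nat[OF elim(1) pq(1)] .
        have xi: "set_integrable lborel {p..q} (\<lambda>s. ?X s \<omega>)" using elim(2) pq(1) by blast
        have ri: "set_integrable lborel {p..q} (\<lambda>s. ratio a c s q \<omega> * u s \<omega>)"
          by (rule set_integrable_u_ratio(2)[where u=u and \<omega>=\<omega>, OF elim(1,4) pq(1)])
        have ci: "set_integrable lborel {p..q} (\<lambda>s. k::real)" for k
          by (intro borel_integrable_atLeastAtMost' continuous_on_const)
        have const: "(LBINT s:{p..q}. k::real) = k * h" for k
          using pq by (simp add: set_lebesgue_integral_def h_def)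
        have 1: "(LBINT s:{p..q}. a * ?X s \<omega> + u s \<omega>) = a * (LBINT s:{p..q}. ?X s \<omega>) + (LBINT s:{p..q}. u s \<omega>)"
          using ui xi by (simp add: set_integral_add)
        have 2: "?Z2 \<omega> = a * (?X p \<omega> * h - (LBINT s:{p..q}. ?X s \<omega>))"
          using xi ci by (simp add: set_integral_diff const)
        have "?Z3 \<omega> = (LBINT s:{p..q}. ratio a c s q \<omega> * u s \<omega> - u s \<omega>)"
          by (simp add: ratio_eq_gexp left_diff_distrib)
        also have "\<dots> = (LBINT s:{p..q}. ratio a c s q \<omega> * u s \<omega>) - (LBINT s:{p..q}. u s \<omega>)"
          using ri ui by (rule set_integral_diff)
        finally have 3: "?Z3 \<omega> = (LBINT s:{p..q}. ratio a c s q \<omega> * u s \<omega>) - (LBINT s:{p..q}. u s \<omega>)" .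
        have 4: "?X q \<omega> = ratio a c p q \<omega> * ?X p \<omega> + (LBINT s:{p..q}. ratio a c s q \<omega> * u s \<omega>)"
          by (rule sol_flow[where u=u and \<omega>=\<omega>, OF elim(1,4) pq(1,2)])
        have 5: "ratio a c p q \<omega> = gres a c (q - p) (W q \<omega> - W p \<omega>) + exp (a * h) + c * (W q \<omega> - W p \<omega>)"
          using elim(3) by (simp add: ratio_eq_gexp gres_def h_def)
        show ?case unfolding 1 2 3 4 5 by (simp add: e_def algebra_simps)
      qed
      have b1: "msq M ?Z1 \<le> ennreal (Ka * h ^ 3 * Ks)"
      proof -
        have "msq M ?Z1 = ennreal (e\<^sup>2) * msq M (?X p)" by (rule msq_cmult[OF Xm])
        also have "\<dots> \<le> ennreal (Ka * h ^ 3) * ennreal Ks"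
          using Ka3 h Ks1 pq by (intro mult_mono ennreal_leI) (auto simp: e_def)
        finally show ?thesis using Ka Ks h by (simp add: ennreal_mult[symmetric])
      qed
      have b2: "msq M ?Z2 \<le> ennreal (a\<^sup>2 * Ks * h ^ 3)"
      proof -
        have "msq M ?Z2 \<le> ennreal (q - p) * (\<integral>\<^sup>+s\<in>{p..q}. msq M (\<lambda>\<omega>. a * (?X p \<omega> - ?X s \<omega>)) \<partial>lborel)"
          by (rule msq_set_integral_le[OF jm2 pq(2)])
        also have "(\<integral>\<^sup>+s\<in>{p..q}. msq M (\<lambda>\<omega>. a * (?X p \<omega> - ?X s \<omega>)) \<partial>lborel)
            \<le> (\<integral>\<^sup>+s. ennreal (a\<^sup>2 * (Ks * h)) * indicator {p..q} s \<partial>lborel)"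
        proof (rule nn_integral_mono)
          fix s
          show "msq M (\<lambda>\<omega>. a * (?X p \<omega> - ?X s \<omega>)) * indicator {p..q} s \<le> ennreal (a\<^sup>2 * (Ks * h)) * indicator {p..q} s"
          proof (cases "s \<in> {p..q}")
            case True
            have "msq M (\<lambda>\<omega>. a * (?X p \<omega> - ?X s \<omega>)) = ennreal (a\<^sup>2) * msq M (\<lambda>\<omega>. ?X s \<omega> - ?X p \<omega>)"
              using True pq by (subst msq_cmult) (auto intro!: borel_measurable_diff sol_measurable u simp: msq_minus_commute[of M "?X p"])
            also have "\<dots> \<le> ennreal (a\<^sup>2) * ennreal (Ks * (s - p))"
              using Ks2 True pq by (intro mult_left_mono) auto
            also have "\<dots> \<le> ennreal (a\<^sup>2) * ennreal (Ks * h)"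
              using True Ks by (intro mult_left_mono ennreal_leI) (auto simp: h_def)
            finally show ?thesis using True Ks h by (simp add: ennreal_mult)
          qed simp
        qed
        also have "\<dots> = ennreal (a\<^sup>2 * (Ks * h)) * ennreal (q - p)"
          using pq by (simp add: nn_integral_cmult)
        finally have "msq M ?Z2 \<le> ennreal (q - p) * (ennreal (a\<^sup>2 * (Ks * h)) * ennreal (q - p))"
          by (simp add: mult_left_mono)
        also have "\<dots> = ennreal (a\<^sup>2 * Ks * h ^ 3)"
          using h Ks pq by (simp add: ennreal_mult[symmetric] h_def[symmetric] power3_eq_cube mult_ac)
        finally show ?thesis .
      qed
      have b3: "msq M ?Z3 \<le> ennreal (h * (Ka * h)) * umass u p q"
        unfolding h_def
      proof (rule msq_conv_integral_le[OF u pq(1,2) _ _ jm3])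
        show "0 \<le> Ka * (q - p)" using Ka pq by simp
        fix s assume s: "p \<le> s" "s \<le> q"
        have "msq M (\<lambda>\<omega>. gexp a c (q - s) (W q \<omega> - W s \<omega>) - 1) \<le> ennreal (Ka * (q - s))"
          using s pq by (intro Ka2) auto
        also have "\<dots> \<le> ennreal (Ka * (q - p))" using s Ka by (intro ennreal_leI mult_left_mono) auto
        finally show "msq M (\<lambda>\<omega>. gexp a c (q - s) (W q \<omega> - W s \<omega>) - 1) \<le> ennreal (Ka * (q - p))" .
      qed simp
      have "msq M (\<lambda>\<omega>. ?Z1 \<omega> + ?Z2 \<omega> + ?Z3 \<omega>) \<le> 3 * (msq M ?Z1 + msq M ?Z2 + msq M ?Z3)"
        by (intro msq_add3 borel_measurable_times borel_measurable_const Xm set_integral_measurable jm2 jm3)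
      also have "\<dots> \<le> 3 * (ennreal (Ka * h ^ 3 * Ks) + ennreal (a\<^sup>2 * Ks * h ^ 3) + ennreal (h * (Ka * h)) * umass u p q)"
        by (intro mult_left_mono add_mono b1 b2 b3) simp
      also have "\<dots> = ennreal (3 * (Ka * h ^ 3 * Ks + a\<^sup>2 * Ks * h ^ 3)) + ennreal (3 * (h * (Ka * h))) * umass u p q"
        using h Ka Ks by (simp add: ennreal_mult ennreal_plus distrib_left mult.assoc)
      also have "\<dots> \<le> ennreal (K * h ^ 3) + ennreal (K * h\<^sup>2) * umass u p q"
      proof (intro add_mono mult_right_mono ennreal_leI)
        have "0 \<le> 3 * Ka * h ^ 3" using Ka h by simp
        then show "3 * (Ka * h ^ 3 * Ks + a\<^sup>2 * Ks * h ^ 3) \<le> K * h ^ 3"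
          unfolding K_def by (simp add: algebra_simps)
        have "0 \<le> (3 * (Ka * Ks + a\<^sup>2 * Ks)) * h\<^sup>2" using Ka Ks by simp
        then show "3 * (h * (Ka * h)) \<le> K * h\<^sup>2"
          unfolding K_def by (simp add: algebra_simps power2_eq_square)
      qed simp
      finally show "msq M (\<lambda>\<omega>. ?Z1 \<omega> + ?Z2 \<omega> + ?Z3 \<omega>) \<le> ennreal (K * (q - p) ^ 3) + ennreal (K * (q - p)\<^sup>2) * umass u p q"
        by (simp add: h_def)
    qed
  qed
  have "0 \<le> K" using Ka Ks by (simp add: K_def)
  with main show ?thesis by blast
qed

text \<open>Pythagoras for martingale differences. Measurability of the partial sum at time
  \<open>t n\<close> is carried through the induction because the cross term with the next increment
  vanishes by exactly that.\<close>

lemma msq_orthogonal_sum: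
  fixes \<xi> :: "nat \<Rightarrow> 'a \<Rightarrow> real" and g :: "nat \<Rightarrow> real \<Rightarrow> real"
  assumes t: "0 \<le> t 0" "\<And>i. t i \<le> t (Suc i)"
    and \<xi>: "\<And>i. \<xi> i \<in> borel_measurable (F (t i))" "\<And>i. msq M (\<xi> i) < \<infinity>"
    and g[measurable]: "\<And>i. g i \<in> borel_measurable borel"
    and mean: "\<And>i. has_bochner_integral M (\<lambda>\<omega>. g i (W (t (Suc i)) \<omega> - W (t i) \<omega>)) 0"
    and sq: "\<And>i. msq M (\<lambda>\<omega>. g i (W (t (Suc i)) \<omega> - W (t i) \<omega>)) < \<infinity>"
  shows "(\<lambda>\<omega>. \<Sum>i<n. \<xi> i \<omega> * g i (W (t (Suc i)) \<omega> - W (t i) \<omega>)) \<in> borel_measurable (F (t n)) \<and>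
    msq M (\<lambda>\<omega>. \<Sum>i<n. \<xi> i \<omega> * g i (W (t (Suc i)) \<omega> - W (t i) \<omega>))
      = (\<Sum>i<n. msq M (\<xi> i) * msq M (\<lambda>\<omega>. g i (W (t (Suc i)) \<omega> - W (t i) \<omega>)))"
proof (induct n)
  case 0
  then show ?case by (simp add: msq_def)
next
  case (Suc n)
  have tn: "0 \<le> t i" for i by (induct i) (use t order_trans in blast)+
  let ?G = "\<lambda>i \<omega>. g i (W (t (Suc i)) \<omega> - W (t i) \<omega>)"
  let ?S = "\<lambda>n \<omega>. \<Sum>i<n. \<xi> i \<omega> * ?G i \<omega>"
  have G: "?G n \<in> borel_measurable (F (t (Suc n)))"
    using tn t by (intro measurable_compose[OF increment_measurable_F g]) auto
  have S1: "?S n \<in> borel_measurable (F (t n))" and S2: "msq M (?S n) = (\<Sum>i<n. msq M (\<xi> i) * msq M (?G i))"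
    using Suc by auto
  have fin: "msq M (?S n) < \<infinity>" unfolding S2 using \<xi>(2) sq by (simp add: ennreal_mult_less_top)
  have fin2: "msq M (\<lambda>\<omega>. \<xi> n \<omega> * ?G n \<omega>) = msq M (\<xi> n) * msq M (?G n)"
    using tn t by (intro msq_mult_increment \<xi> g) auto
  have m: "(\<lambda>\<omega>. \<xi> n \<omega> * ?G n \<omega>) \<in> borel_measurable (F (t (Suc n)))"
    using t by (intro borel_measurable_times G measurable_F_mono[OF _ \<xi>(1)])
  have p: "(\<lambda>\<omega>. ?S n \<omega> * \<xi> n \<omega>) \<in> borel_measurable (F (t n))"
    by (intro borel_measurable_times S1 \<xi>(1))
  have pi: "integrable M (\<lambda>\<omega>. ?S n \<omega> * \<xi> n \<omega>)"
    by (intro integrable_mult_msq measurable_F_M[OF S1] measurable_F_M[OF \<xi>(1)] fin \<xi>(2))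
  \<comment> \<open>The cross term: a function of the past times a centred function of the next
    increment.\<close>
  have c: "has_bochner_integral M (\<lambda>\<omega>. (?S n \<omega> * \<xi> n \<omega>) * ?G n \<omega>) 0"
    using integrable_mult_increment[OF tn t(2) p g pi] expectation_mult_increment[OF tn t(2) p g pi] mean[of n]
    by (simp add: has_bochner_integral_iff)
  have sqi: "has_bochner_integral M (\<lambda>\<omega>. (?S n \<omega>)\<^sup>2) (\<integral>\<omega>. (?S n \<omega>)\<^sup>2 \<partial>M)"
    "has_bochner_integral M (\<lambda>\<omega>. (\<xi> n \<omega> * ?G n \<omega>)\<^sup>2) (\<integral>\<omega>. (\<xi> n \<omega> * ?G n \<omega>)\<^sup>2 \<partial>M)"
    using measurable_F_M[OF S1] fin measurable_F_M[OF m] fin2 \<xi>(2)[of n] sq[of n]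
    by (auto intro!: has_bochner_integral_integrable integrable_power2_iff_msq[THEN iffD2] simp: ennreal_mult_less_top)
  have "has_bochner_integral M (\<lambda>\<omega>. (?S n \<omega>)\<^sup>2 + 2 * ((?S n \<omega> * \<xi> n \<omega>) * ?G n \<omega>) + (\<xi> n \<omega> * ?G n \<omega>)\<^sup>2)
     ((\<integral>\<omega>. (?S n \<omega>)\<^sup>2 \<partial>M) + 2 * 0 + (\<integral>\<omega>. (\<xi> n \<omega> * ?G n \<omega>)\<^sup>2 \<partial>M))"
    by (intro has_bochner_integral_add has_bochner_integral_mult_right c sqi)
  then have "has_bochner_integral M (\<lambda>\<omega>. (?S n \<omega> + \<xi> n \<omega> * ?G n \<omega>)\<^sup>2)
     ((\<integral>\<omega>. (?S n \<omega>)\<^sup>2 \<partial>M) + (\<integral>\<omega>. (\<xi> n \<omega> * ?G n \<omega>)\<^sup>2 \<partial>M))"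
    by (simp add: power2_sum algebra_simps)
  then have "msq M (\<lambda>\<omega>. ?S n \<omega> + \<xi> n \<omega> * ?G n \<omega>) = ennreal ((\<integral>\<omega>. (?S n \<omega>)\<^sup>2 \<partial>M) + (\<integral>\<omega>. (\<xi> n \<omega> * ?G n \<omega>)\<^sup>2 \<partial>M))"
    by (rule msq_eq_bochner)
  also have "\<dots> = msq M (?S n) + msq M (\<lambda>\<omega>. \<xi> n \<omega> * ?G n \<omega>)"
    using msq_eq_integral[OF measurable_F_M[OF S1] fin] msq_eq_integral[OF measurable_F_M[OF m]] fin2 \<xi>(2)[of n] sq[of n]
    by (simp add: ennreal_plus ennreal_mult_less_top)
  finally have "msq M (?S (Suc n)) = msq M (?S n) + msq M (\<xi> n) * msq M (?G n)"
    using fin2 by simp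
  moreover have "?S (Suc n) \<in> borel_measurable (F (t (Suc n)))"
    using borel_measurable_add[OF measurable_F_mono[OF t(2) S1] m] by simp
  ultimately show ?case using S2 by simp
qed

text \<open>Coefficients of elementary processes have to be bounded, whereas the values of the
  solution on the grid are only square integrable; truncation closes the gap.\<close>

lemma clamp_approx:
  assumes f[measurable]: "f \<in> borel_measurable M" and fin: "msq M f < \<infinity>" and \<epsilon>: "0 < \<epsilon>"
  shows "\<exists>N::nat. msq M (\<lambda>\<omega>. f \<omega> - max (- real N) (min (f \<omega>) (real N))) < \<epsilon>"
proof -
  have "(\<lambda>N. \<integral>\<^sup>+\<omega>. ennreal ((f \<omega> - max (- real N) (min (f \<omega>) (real N)))\<^sup>2) \<partial>M) \<longlonglongrightarrow> (\<integral>\<^sup>+\<omega>. 0 \<partial>M)"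
  proof (rule nn_integral_dominated_convergence[where w="\<lambda>\<omega>. ennreal ((f \<omega>)\<^sup>2)"])
    show "(\<integral>\<^sup>+\<omega>. ennreal ((f \<omega>)\<^sup>2) \<partial>M) < \<infinity>" using fin by (simp add: msq_def)
    have "\<bar>y - max (- real N) (min y (real N))\<bar> \<le> \<bar>y\<bar>" for y N by (auto simp: max_def min_def)
    then have "(y - max (- real N) (min y (real N)))\<^sup>2 \<le> y\<^sup>2" for y N
      using abs_le_square_iff by blast
    then show "AE \<omega> in M. ennreal ((f \<omega> - max (- real N) (min (f \<omega>) (real N)))\<^sup>2) \<le> ennreal ((f \<omega>)\<^sup>2)" for N
      by (intro AE_I2 ennreal_leI)
    show "AE \<omega> in M. (\<lambda>N. ennreal ((f \<omega> - max (- real N) (min (f \<omega>) (real N)))\<^sup>2)) \<longlonglongrightarrow> 0"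
    proof (rule AE_I2)
      fix \<omega>
      obtain N0 where "\<bar>f \<omega>\<bar> \<le> real N0" using real_arch_simple by blast
      then have "eventually (\<lambda>N. ennreal ((f \<omega> - max (- real N) (min (f \<omega>) (real N)))\<^sup>2) = 0) sequentially"
        by (intro eventually_sequentiallyI[of N0]) (auto simp: max_def min_def)
      then show "(\<lambda>N. ennreal ((f \<omega> - max (- real N) (min (f \<omega>) (real N)))\<^sup>2)) \<longlonglongrightarrow> 0"
        by (rule tendsto_eventually)
    qed
  qed auto
  then have "(\<lambda>N. msq M (\<lambda>\<omega>. f \<omega> - max (- real N) (min (f \<omega>) (real N)))) \<longlonglongrightarrow> 0"
    by (simp add: msq_def)
  then have "eventually (\<lambda>N. msq M (\<lambda>\<omega>. f \<omega> - max (- real N) (min (f \<omega>) (real N))) < \<epsilon>) sequentially"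
    by (rule order_tendstoD(2)) (rule \<epsilon>)
  then show ?thesis by (auto simp: eventually_sequentially)
qed


section \<open>The explicit formula solves the equation\<close>

lemma set_integral_singleton [simp]: "(LBINT s:{q::real}. f s :: real) = 0"
  unfolding set_lebesgue_integral_def
  by (rule integral_eq_zero_AE) (use AE_lborel_singleton[of q] in \<open>eventually_elim, auto split: split_indicator\<close>)

lemma sol_msq_finite:
  assumes "u \<in> L2F M W" "0 \<le> t"
  shows "msq M (sol a c x u t) < \<infinity>"
proof -
  obtain K where "\<forall>s. 0 \<le> s \<longrightarrow> s \<le> t \<longrightarrow> msq M (sol a c x u s) \<le> ennreal K"
    using sol_bounds[OF assms, of a c x] by (elim exE conjE)
  then have "msq M (sol a c x u t) \<le> ennreal K" using assms(2) by simp
  also have "\<dots> < \<infinity>" by simp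
  finally show ?thesis .
qed

lemma sol_pnorm_finite:
  assumes u: "u \<in> L2F M W"
  shows "pnorm T (sol a c x u) < \<infinity>"
proof (cases "0 \<le> T")
  case True
  obtain K where K: "\<forall>s. 0 \<le> s \<longrightarrow> s \<le> T \<longrightarrow> msq M (sol a c x u s) \<le> ennreal K"
    using sol_bounds[OF u True, of a c x] by (elim exE conjE)
  have "pnorm T (sol a c x u) = (\<integral>\<^sup>+s\<in>{0..T}. msq M (sol a c x u s) \<partial>lborel)"
    by (intro pnorm_eq sol_joint_measurable u) simp
  also have "\<dots> \<le> (\<integral>\<^sup>+s. ennreal K * indicator {0..T} s \<partial>lborel)"
    using K by (intro nn_integral_mono) (auto split: split_indicator)
  also have "\<dots> = ennreal K * ennreal T" using True by (simp add: nn_integral_cmult)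
  also have "\<dots> < \<infinity>" by (simp add: ennreal_mult_less_top)
  finally show ?thesis .
qed (simp add: pnorm_def)

lemma elementary_process_eq:
  assumes "strict_mono t" "i < n" "t i < s" "s \<le> t (Suc i)"
  shows "elementary_process n t \<xi> s \<omega> = \<xi> i \<omega>"
proof -
  have "\<xi> j \<omega> * indicator {t j<..t (Suc j)} s = (if j = i then \<xi> i \<omega> else 0)" for j
  proof (cases j i rule: linorder_cases)
    case less
    then have "t (Suc j) \<le> t i" using strict_mono_less_eq[OF assms(1)] by simp
    then show ?thesis using less assms by simp
  next
    case greater
    then have "t (Suc i) \<le> t j" using strict_mono_less_eq[OF assms(1)] by simp
    then show ?thesis using greater assms by simp
  qed (use assms in simp)
  then show ?thesis using assms(2) unfolding elementary_process_def by simp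
qed

lemma grid_interval:
  assumes "0 < T" "0 < n" "0 < s" "s \<le> T"
  obtains i where "i < n" "real i * (T / real n) < s" "s \<le> real (Suc i) * (T / real n)"
proof
  define h where "h = T / real n"
  have h: "0 < h" using assms by (simp add: h_def)
  \<comment> \<open>The cells are open on the left and closed on the right, so a grid point belongs
    to the cell that ends there: ceiling minus one, not floor.\<close>
  define i where "i = nat (\<lceil>s / h\<rceil> - 1)"
  have pos: "0 < s / h" using assms h by simp
  then have c: "0 < \<lceil>s / h\<rceil>" by simp
  have i: "real i = of_int \<lceil>s / h\<rceil> - 1" using c by (simp add: i_def)
  have 1: "real i < s / h" "s / h \<le> real i + 1" unfolding i by linarith+
  then show "real i * (T / real n) < s" "s \<le> real (Suc i) * (T / real n)"
    using h by (simp_all add: h_def[symmetric] field_simps)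
  have "s / h \<le> real n" using assms h by (simp add: h_def field_simps)
  then have "real i < real n" using 1 by linarith
  then show "i < n" by simp
qed

text \<open>The same grid process has to approximate the integrand while its elementary integral
  approximates the residual of the equation. With \<open>n\<close> equal steps both squared errors
  are of order \<open>1 / n\<close>.\<close>

lemma sol_ito_approx:
  assumes u: "u \<in> L2F M W" and T: "0 < T" and \<epsilon>: "0 < \<epsilon>"
  shows "\<exists>n t \<xi>. elementary_data M W T n t \<xi> \<and>
    pnorm T (\<lambda>s \<omega>. c * sol a c x u s \<omega> - elementary_process n t \<xi> s \<omega>) \<le> ennreal \<epsilon> \<and>
    msq M (\<lambda>\<omega>. sol a c x u T \<omega> - x - (LBINT s:{0..T}. a * sol a c x u s \<omega> + u s \<omega>)
      - elementary_integral W n t \<xi> \<omega>) \<le> ennreal \<epsilon>"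
proof -
  let ?X = "sol a c x u"
  have T0: "0 \<le> T" using T by simp
  obtain Ka where Ka: "0 \<le> Ka" and Ka': "\<forall>s t. 0 \<le> s \<longrightarrow> s \<le> t \<longrightarrow> t \<le> T \<longrightarrow>
      msq M (\<lambda>\<omega>. gexp a c (t - s) (W t \<omega> - W s \<omega>)) \<le> ennreal Ka \<and>
      msq M (\<lambda>\<omega>. gexp a c (t - s) (W t \<omega> - W s \<omega>) - 1) \<le> ennreal (Ka * (t - s)) \<and>
      msq M (\<lambda>\<omega>. gres a c (t - s) (W t \<omega> - W s \<omega>)) \<le> ennreal (Ka * (t - s)\<^sup>2)"
    using moment_bounds[OF T0, of a c] by (elim exE conjE)
  note Ka2 = Ka'[rule_format, THEN conjunct2, THEN conjunct2]
  obtain Ks where Ks: "0 \<le> Ks" and Ks1: "\<forall>t. 0 \<le> t \<longrightarrow> t \<le> T \<longrightarrow> msq M (?X t) \<le> ennreal Ks"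
    and Ks2: "\<forall>s t. 0 \<le> s \<longrightarrow> s \<le> t \<longrightarrow> t \<le> T \<longrightarrow> msq M (\<lambda>\<omega>. ?X t \<omega> - ?X s \<omega>) \<le> ennreal (Ks * (t - s))"
    using sol_bounds[OF u T0, of a c x] by (elim exE conjE)
  obtain Kz where Kz: "0 \<le> Kz" and Kz': "\<forall>p q. 0 \<le> p \<longrightarrow> p \<le> q \<longrightarrow> q \<le> T \<longrightarrow> (\<exists>Z\<in>borel_measurable M.
    (AE \<omega> in M. ?X q \<omega> - ?X p \<omega> - (LBINT s:{p..q}. a * ?X s \<omega> + u s \<omega>) - c * ?X p \<omega> * (W q \<omega> - W p \<omega>)
      = ?X p \<omega> * gres a c (q - p) (W q \<omega> - W p \<omega>) + Z \<omega>) \<and>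
    msq M Z \<le> ennreal (Kz * (q - p) ^ 3) + ennreal (Kz * (q - p)\<^sup>2) * umass u p q)"
    using sol_step[OF u T0, of a c x] by (elim exE conjE)
  obtain B where B: "0 \<le> B" "pnorm T u = ennreal B"
    using L2F_pnorm[OF u, of T] by (cases "pnorm T u") auto
  \<comment> \<open>\<open>C1 / n\<close> and \<open>C2 / n\<close> are the bounds reached at the
    end for the residual and for the integrand; \<open>n\<close> is chosen to push both below
    \<epsilon>.\<close>
  define C1 where "C1 = 3 * (Ks * Ka * T\<^sup>2 + (Kz * T ^ 3 + Kz * T\<^sup>2 * B) + c\<^sup>2 * T)"
  define C2 where "C2 = 2 * (c\<^sup>2 * Ks * T + c\<^sup>2) * T"
  obtain n :: nat where n: "0 < n" "C1 / real n \<le> \<epsilon>" "C2 / real n \<le> \<epsilon>"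
  proof -
    obtain n :: nat where n: "max 1 (max (C1 / \<epsilon>) (C2 / \<epsilon>)) < real n" using reals_Archimedean2 by blast
    then show thesis using \<epsilon> by (intro that[of n]) (auto simp: field_simps)
  qed
  have rn: "0 < real n" using n by simp
  define h where "h = T / real n"
  have h: "0 < h" "h \<le> T" "real n * h = T" using T n by (auto simp: h_def field_simps)
  define t where "t i = real i * h" for i :: nat
  have tS: "t (Suc i) - t i = h" and t0: "0 \<le> t i" and tm: "t i \<le> t (Suc i)" for i
    using h by (auto simp: t_def algebra_simps)
  have tT: "t i \<le> T" if "i \<le> n" for i
    using that h(1) h(3)[symmetric] by (simp add: t_def mult_right_mono)
  have tn: "t n = T" "t 0 = 0" using h by (auto simp: t_def)
  have tmono: "strict_mono t" using h by (auto simp: strict_mono_def t_def)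
  \<comment> \<open>The truncation level depends on the grid point. Tolerance \<open>1 / n\<close>
    puts the truncation error at the order of the discretisation error.\<close>
  have "\<forall>i. \<exists>N::nat. msq M (\<lambda>\<omega>. ?X (t i) \<omega> - max (- real N) (min (?X (t i) \<omega>) (real N))) < ennreal (1 / real n)"
    using rn by (intro allI clamp_approx sol_measurable u t0 sol_msq_finite) auto
  then obtain N where N: "\<And>i. msq M (\<lambda>\<omega>. ?X (t i) \<omega> - max (- real (N i)) (min (?X (t i) \<omega>) (real (N i)))) < ennreal (1 / real n)"
    by metis
  define Y where "Y i \<omega> = max (- real (N i)) (min (?X (t i) \<omega>) (real (N i)))" for i \<omega>
  have Y1: "msq M (\<lambda>\<omega>. ?X (t i) \<omega> - Y i \<omega>) \<le> ennreal (1 / real n)" for i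
    using N[of i] by (simp add: Y_def)
  have XF: "?X (t i) \<in> borel_measurable (F (t i))" for i by (rule sol_measurable_F[OF u t0])
  have YF: "Y i \<in> borel_measurable (F (t i))" for i
    unfolding Y_def[abs_def] using XF by measurable
  note XM = measurable_F_M[OF XF] and YM = measurable_F_M[OF YF]
  define \<xi> where "\<xi> i \<omega> = c * Y i \<omega>" for i \<omega>
  have data: "elementary_data M W T n t \<xi>"
    unfolding elementary_data_def
  proof (intro conjI allI impI)
    fix i
    show "\<xi> i \<in> borel_measurable (F (t i))" unfolding \<xi>_def[abs_def] using YF by measurable
    have "\<bar>Y i \<omega>\<bar> \<le> real (N i)" for \<omega> by (auto simp: Y_def max_def min_def)
    then show "\<exists>K. \<forall>\<omega>\<in>space M. \<bar>\<xi> i \<omega>\<bar> \<le> K"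
      by (intro exI[of _ "\<bar>c\<bar> * real (N i)"]) (auto simp: \<xi>_def abs_mult mult_left_mono)
  qed (use t0 tm tn in auto)
  define step where "step i Z \<longleftrightarrow> Z \<in> borel_measurable M \<and>
    (AE \<omega> in M. ?X (t (Suc i)) \<omega> - ?X (t i) \<omega> - (LBINT s:{t i..t (Suc i)}. a * ?X s \<omega> + u s \<omega>)
      - c * ?X (t i) \<omega> * (W (t (Suc i)) \<omega> - W (t i) \<omega>)
      = ?X (t i) \<omega> * gres a c h (W (t (Suc i)) \<omega> - W (t i) \<omega>) + Z \<omega>) \<and>
    msq M Z \<le> ennreal (Kz * h ^ 3) + ennreal (Kz * h\<^sup>2) * umass u (t i) (t (Suc i))" for i Z
  have "\<forall>i. \<exists>Z. i < n \<longrightarrow> step i Z"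
  proof
    fix i
    show "\<exists>Z. i < n \<longrightarrow> step i Z"
      using Kz'[rule_format, OF t0[of i] tm[of i] tT[of "Suc i"]] unfolding tS step_def by (cases "i < n") auto
  qed
  from choice[OF this] obtain Z where Z': "\<forall>i. i < n \<longrightarrow> step i (Z i)" by (elim exE)
  note Z = Z'[rule_format, unfolded step_def, THEN conjunct1]
    Z'[rule_format, unfolded step_def, THEN conjunct2, THEN conjunct1]
    Z'[rule_format, unfolded step_def, THEN conjunct2, THEN conjunct2]
  let ?D = "\<lambda>i \<omega>. W (t (Suc i)) \<omega> - W (t i) \<omega>"
  \<comment> \<open>The error splits into centred residuals and truncation errors, both sums of
    orthogonal terms, and the remainders \<open>Z\<close> of the single steps.\<close>
  let ?S1 = "\<lambda>\<omega>. \<Sum>i<n. ?X (t i) \<omega> * gres a c h (?D i \<omega>)"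
  let ?S2 = "\<lambda>\<omega>. \<Sum>i<n. Z i \<omega>"
  let ?S3 = "\<lambda>\<omega>. \<Sum>i<n. (c * (?X (t i) \<omega> - Y i \<omega>)) * ?D i \<omega>"
  let ?E = "\<lambda>\<omega>. ?X T \<omega> - x - (LBINT s:{0..T}. a * ?X s \<omega> + u s \<omega>) - elementary_integral W n t \<xi> \<omega>"
  have "AE \<omega> in M. \<forall>i\<in>{..<n}. ?X (t (Suc i)) \<omega> - ?X (t i) \<omega> - (LBINT s:{t i..t (Suc i)}. a * ?X s \<omega> + u s \<omega>)
      - c * ?X (t i) \<omega> * ?D i \<omega> = ?X (t i) \<omega> * gres a c h (?D i \<omega>) + Z i \<omega>"
    by (rule AE_finite_allI) (use Z(2) in auto)
  then have "AE \<omega> in M. ?E \<omega> = ?S1 \<omega> + ?S2 \<omega> + ?S3 \<omega>"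
    using AE_u_integrable[OF u] AE_sol_integrable[OF u, of a c x]
  proof eventually_elim
    case (elim \<omega>)
    let ?f = "\<lambda>s. a * ?X s \<omega> + u s \<omega>"
    have fi: "set_integrable lborel {0..q} ?f" for q
      using elim(3) set_integrable_Icc_nat[OF elim(2), of 0 q] by (intro set_integral_add) auto
    have sumI: "(\<Sum>i<k. (LBINT s:{t i..t (Suc i)}. ?f s)) = (LBINT s:{0..t k}. ?f s)" for k
    proof (induct k)
      case (Suc k)
      then show ?case
        using set_integral_combine_Icc[OF fi[of "t (Suc k)"] t0[of k] tm[of k]] by simp
    qed (simp add: tn)
    have "(\<Sum>i<n. ?X (t (Suc i)) \<omega> - ?X (t i) \<omega> - (LBINT s:{t i..t (Suc i)}. ?f s) - c * ?X (t i) \<omega> * ?D i \<omega>)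
        = (\<Sum>i<n. ?X (t i) \<omega> * gres a c h (?D i \<omega>) + Z i \<omega>)"
      by (intro sum.cong refl) (use elim(1) in blast)
    moreover have "(\<Sum>i<n. ?X (t (Suc i)) \<omega> - ?X (t i) \<omega>) = ?X T \<omega> - x"
      using sum_lessThan_telescope[of "\<lambda>i. ?X (t i) \<omega>" n] by (simp add: tn sol_0)
    ultimately have "?X T \<omega> - x - (LBINT s:{0..T}. ?f s) - (\<Sum>i<n. c * ?X (t i) \<omega> * ?D i \<omega>) = ?S1 \<omega> + ?S2 \<omega>"
      using sumI[of n] by (simp add: sum_subtractf sum.distrib tn)
    moreover have "elementary_integral W n t \<xi> \<omega> = (\<Sum>i<n. c * ?X (t i) \<omega> * ?D i \<omega>) - ?S3 \<omega>"
      by (simp add: elementary_integral_def \<xi>_def sum_subtractf[symmetric] algebra_simps)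
    ultimately show ?case by simp
  qed
  then have "msq M ?E = msq M (\<lambda>\<omega>. ?S1 \<omega> + ?S2 \<omega> + ?S3 \<omega>)" by (rule msq_cong_AE)
  also have "\<dots> \<le> 3 * (msq M ?S1 + msq M ?S2 + msq M ?S3)"
  proof (rule msq_add3)
    have D: "?D i \<in> borel_measurable M" for i
      using t0 by (intro borel_measurable_diff W_measurable)
    show "?S1 \<in> borel_measurable M"
      by (intro borel_measurable_sum borel_measurable_times XM measurable_compose[OF D] gres_measurable)
    show "?S2 \<in> borel_measurable M" using Z(1) by (intro borel_measurable_sum) auto
    show "?S3 \<in> borel_measurable M"
      by (intro borel_measurable_sum borel_measurable_times borel_measurable_diff borel_measurable_const XM YM D)
  qed
  also have "\<dots> \<le> 3 * (ennreal (Ks * Ka * T\<^sup>2 / real n) + ennreal ((Kz * T ^ 3 + Kz * T\<^sup>2 * B) / real n) + ennreal (c\<^sup>2 * T / real n))"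
  proof (intro mult_left_mono add_mono)
    have "msq M ?S1 = (\<Sum>i<n. msq M (?X (t i)) * msq M (\<lambda>\<omega>. gres a c h (?D i \<omega>)))"
    proof (rule msq_orthogonal_sum[THEN conjunct2])
      show "has_bochner_integral M (\<lambda>\<omega>. gres a c h (?D i \<omega>)) 0" for i
        using gres_mean[OF t0[of i] tm[of i], of a c] unfolding tS .
      show "msq M (\<lambda>\<omega>. gres a c h (?D i \<omega>)) < \<infinity>" for i
        using msq_gres[OF t0[of i] tm[of i], of a c] unfolding tS by simp
    qed (use t0 tm XF sol_msq_finite[OF u] in auto)
    also have "\<dots> \<le> of_nat (card {..<n}) * (ennreal Ks * ennreal (Ka * h\<^sup>2))"
    proof (rule sum_bounded_above)
      fix i assume "i \<in> {..<n}"
      then have i: "t i \<le> T" "t (Suc i) \<le> T" using tT by auto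
      show "msq M (?X (t i)) * msq M (\<lambda>\<omega>. gres a c h (?D i \<omega>)) \<le> ennreal Ks * ennreal (Ka * h\<^sup>2)"
        using Ks1 t0 i Ka2[OF t0 tm i(2)] unfolding tS by (intro mult_mono) auto
    qed
    also have "\<dots> = ennreal (real n * (Ks * (Ka * h\<^sup>2)))"
      using Ka Ks by (simp add: ennreal_mult ennreal_of_nat_eq_real_of_nat)
    also have "real n * (Ks * (Ka * h\<^sup>2)) = Ks * Ka * T\<^sup>2 / real n"
      using rn by (simp add: h_def power2_eq_square field_simps)
    finally show "msq M ?S1 \<le> ennreal (Ks * Ka * T\<^sup>2 / real n)" .
    \<comment> \<open>Cauchy-Schwarz costs a factor \<open>n\<close>, which is affordable:
      \<open>n * n * h^3\<close> and \<open>n * h^2\<close> are both of order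
      \<open>1 / n\<close>.\<close>
    have "msq M ?S2 \<le> ennreal (real n) * (\<Sum>i<n. msq M (Z i))"
      by (rule msq_sum[OF Z(1)])
    also have "(\<Sum>i<n. msq M (Z i)) \<le> (\<Sum>i<n. ennreal (Kz * h ^ 3) + ennreal (Kz * h\<^sup>2) * umass u (t i) (t (Suc i)))"
      by (intro sum_mono Z(3)) auto
    also have "\<dots> = ennreal (real n) * ennreal (Kz * h ^ 3) + ennreal (Kz * h\<^sup>2) * (\<Sum>i<n. umass u (t i) (t (Suc i)))"
      by (simp add: sum.distrib sum_distrib_left ennreal_of_nat_eq_real_of_nat)
    also have "(\<Sum>i<k. umass u (t i) (t (Suc i))) = umass u 0 (t k)" for k
    proof (induct k)
      case 0
      have "umass u 0 0 = 0"
        unfolding umass_def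
        by (subst nn_integral_0_iff_AE[OF umass_measurable[OF u order_refl]])
           (use AE_lborel_singleton[of 0] in \<open>eventually_elim, auto split: split_indicator\<close>)
      then show ?case by (simp add: tn)
    next
      case (Suc k)
      then show ?case using umass_add[OF u order_refl t0[of k] tm[of k]] by simp
    qed
    note this[of n]
    also have "umass u 0 (t n) \<le> ennreal B"
      using umass_le_pnorm[OF u order_refl, of T T] B by (simp add: tn)
    finally have "msq M ?S2 \<le> ennreal (real n) * (ennreal (real n) * ennreal (Kz * h ^ 3) + ennreal (Kz * h\<^sup>2) * ennreal B)"
      by (simp add: mult_left_mono)
    also have "\<dots> = ennreal (real n * (real n * (Kz * h ^ 3) + Kz * h\<^sup>2 * B))"
      using Kz h(1) B(1) rn
      by (simp only: ennreal_mult ennreal_plus mult_nonneg_nonneg add_nonneg_nonneg less_imp_le zero_le_power zero_le_power2)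
    also have "real n * (real n * (Kz * h ^ 3) + Kz * h\<^sup>2 * B) = (Kz * T ^ 3 + Kz * T\<^sup>2 * B) / real n"
      using rn by (simp add: h_def power2_eq_square power3_eq_cube field_simps)
    finally show "msq M ?S2 \<le> ennreal ((Kz * T ^ 3 + Kz * T\<^sup>2 * B) / real n)" .
    have Rm: "(\<lambda>\<omega>. c * (?X (t i) \<omega> - Y i \<omega>)) \<in> borel_measurable (F (t i))" for i
      by (intro borel_measurable_times borel_measurable_diff borel_measurable_const XF YF)
    have R: "msq M (\<lambda>\<omega>. c * (?X (t i) \<omega> - Y i \<omega>)) \<le> ennreal (c\<^sup>2 * (1 / real n))" for i
    proof -
      have "msq M (\<lambda>\<omega>. c * (?X (t i) \<omega> - Y i \<omega>)) = ennreal (c\<^sup>2) * msq M (\<lambda>\<omega>. ?X (t i) \<omega> - Y i \<omega>)"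
        by (intro msq_cmult borel_measurable_diff XM YM)
      also have "\<dots> \<le> ennreal (c\<^sup>2) * ennreal (1 / real n)" by (intro mult_left_mono Y1) simp
      also have "\<dots> = ennreal (c\<^sup>2 * (1 / real n))" by (intro ennreal_mult[symmetric]) auto
      finally show ?thesis .
    qed
    have "msq M ?S3 = (\<Sum>i<n. msq M (\<lambda>\<omega>. c * (?X (t i) \<omega> - Y i \<omega>)) * msq M (?D i))"
    proof (rule msq_orthogonal_sum[where g="\<lambda>i y. y", THEN conjunct2])
      show "msq M (\<lambda>\<omega>. c * (?X (t i) \<omega> - Y i \<omega>)) < \<infinity>" for i
        using R[of i] by (rule le_less_trans) simp
    qed (use t0 tm Rm increment_mean msq_increment in auto)
    also have "\<dots> \<le> of_nat (card {..<n}) * (ennreal (c\<^sup>2 * (1 / real n)) * ennreal h)"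
      using msq_increment[OF t0 tm] unfolding tS by (intro sum_bounded_above mult_mono R) auto
    also have "\<dots> = ennreal (real n) * (ennreal (c\<^sup>2 * (1 / real n)) * ennreal h)"
      by (simp add: ennreal_of_nat_eq_real_of_nat)
    also have "\<dots> = ennreal (real n * (c\<^sup>2 * (1 / real n) * h))"
      using h(1) rn by (simp only: ennreal_mult mult_nonneg_nonneg zero_le_power2 less_imp_le zero_le_divide_1_iff)
    also have "real n * (c\<^sup>2 * (1 / real n) * h) = c\<^sup>2 * T / real n" using rn by (simp add: h_def)
    finally show "msq M ?S3 \<le> ennreal (c\<^sup>2 * T / real n)" .
  qed simp
  also have "\<dots> = ennreal (3 * (Ks * Ka * T\<^sup>2 / real n + (Kz * T ^ 3 + Kz * T\<^sup>2 * B) / real n + c\<^sup>2 * T / real n))"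
  proof -
    have "0 \<le> Ks * Ka * T\<^sup>2 / real n" "0 \<le> (Kz * T ^ 3 + Kz * T\<^sup>2 * B) / real n" "0 \<le> c\<^sup>2 * T / real n"
      using Ks Ka Kz B T by auto
    then show ?thesis by (simp only: ennreal_mult ennreal_plus ennreal_numeral add_nonneg_nonneg zero_le_numeral)
  qed
  also have "3 * (Ks * Ka * T\<^sup>2 / real n + (Kz * T ^ 3 + Kz * T\<^sup>2 * B) / real n + c\<^sup>2 * T / real n) = C1 / real n"
    by (simp add: C1_def add_divide_distrib distrib_left)
  finally have E: "msq M ?E \<le> ennreal \<epsilon>"
    using n(2) by (elim order_trans) (simp add: ennreal_leI)

  have "pnorm T (\<lambda>s \<omega>. c * ?X s \<omega> - elementary_process n t \<xi> s \<omega>)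
      = (\<integral>\<^sup>+s\<in>{0..T}. msq M (\<lambda>\<omega>. c * ?X s \<omega> - elementary_process n t \<xi> s \<omega>) \<partial>lborel)"
  proof (rule pnorm_eq)
    note m = sol_joint_measurable[OF u order_refl, of T a c x] elementary_joint_measurable[OF data, of "{0..T}"]
    have "(\<lambda>z. c * (indicator {0..T} (fst z) * ?X (fst z) (snd z)) - indicator {0..T} (fst z) * elementary_process n t \<xi> (fst z) (snd z))
        \<in> borel_measurable (lborel \<Otimes>\<^sub>M M)"
      using m by (intro borel_measurable_diff borel_measurable_times[OF borel_measurable_const]) auto
    then show "(\<lambda>z. indicator {0..T} (fst z) * (c * ?X (fst z) (snd z) - elementary_process n t \<xi> (fst z) (snd z)))
        \<in> borel_measurable (lborel \<Otimes>\<^sub>M M)"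
      by (simp add: algebra_simps)
  qed
  also have "\<dots> \<le> (\<integral>\<^sup>+s. ennreal (2 * (c\<^sup>2 * Ks * h + c\<^sup>2 * (1 / real n))) * indicator {0..T} s \<partial>lborel)"
  proof (rule nn_integral_mono_AE)
    show "AE s in lborel. msq M (\<lambda>\<omega>. c * ?X s \<omega> - elementary_process n t \<xi> s \<omega>) * indicator {0..T} s
        \<le> ennreal (2 * (c\<^sup>2 * Ks * h + c\<^sup>2 * (1 / real n))) * indicator {0..T} s"
      \<comment> \<open>Time 0 lies in none of the left-open cells.\<close>
      using AE_lborel_singleton[of 0]
    proof eventually_elim
      case (elim s)
      show ?case
      proof (cases "s \<in> {0..T}")
        case True
        then have s: "0 < s" "s \<le> T" using elim by auto
        obtain i where i: "i < n" "t i < s" "s \<le> t (Suc i)"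
          using grid_interval[OF T n(1) s] by (auto simp: t_def h_def)
        have sm: "?X s \<in> borel_measurable M" using s by (intro sol_measurable u) auto
        have "msq M (\<lambda>\<omega>. c * ?X s \<omega> - elementary_process n t \<xi> s \<omega>)
            = msq M (\<lambda>\<omega>. c * (?X s \<omega> - ?X (t i) \<omega>) + c * (?X (t i) \<omega> - Y i \<omega>))"
          by (simp add: elementary_process_eq[OF tmono i] \<xi>_def algebra_simps)
        also have "\<dots> \<le> 2 * (msq M (\<lambda>\<omega>. c * (?X s \<omega> - ?X (t i) \<omega>)) + msq M (\<lambda>\<omega>. c * (?X (t i) \<omega> - Y i \<omega>)))"
          by (intro msq_add borel_measurable_times borel_measurable_diff borel_measurable_const sm XM YM)
        also have "\<dots> = 2 * (ennreal (c\<^sup>2) * msq M (\<lambda>\<omega>. ?X s \<omega> - ?X (t i) \<omega>) + ennreal (c\<^sup>2) * msq M (\<lambda>\<omega>. ?X (t i) \<omega> - Y i \<omega>))"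
          by (subst (1 2) msq_cmult) (auto intro!: borel_measurable_diff sm XM YM)
        also have "\<dots> \<le> 2 * (ennreal (c\<^sup>2) * ennreal (Ks * h) + ennreal (c\<^sup>2) * ennreal (1 / real n))"
        proof (intro mult_left_mono add_mono Y1)
          have "msq M (\<lambda>\<omega>. ?X s \<omega> - ?X (t i) \<omega>) \<le> ennreal (Ks * (s - t i))"
            using Ks2 t0 i s by auto
          also have "\<dots> \<le> ennreal (Ks * h)"
            using i(3) tS[of i] Ks by (intro ennreal_leI mult_left_mono) auto
          finally show "msq M (\<lambda>\<omega>. ?X s \<omega> - ?X (t i) \<omega>) \<le> ennreal (Ks * h)" .
        qed auto
        also have "\<dots> = ennreal (2 * (c\<^sup>2 * (Ks * h) + c\<^sup>2 * (1 / real n)))"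
          using Ks h(1) rn
          by (simp only: ennreal_mult ennreal_plus ennreal_numeral add_nonneg_nonneg mult_nonneg_nonneg zero_le_power2
              less_imp_le zero_le_divide_1_iff zero_le_numeral)
        finally show ?thesis using True by (simp add: mult.assoc)
      qed simp
    qed
  qed
  also have "\<dots> = ennreal (2 * (c\<^sup>2 * Ks * h + c\<^sup>2 * (1 / real n))) * ennreal T"
    using T by (simp add: nn_integral_cmult)
  also have "\<dots> = ennreal (2 * (c\<^sup>2 * Ks * h + c\<^sup>2 * (1 / real n)) * T)"
    using Ks h(1) rn T by (intro ennreal_mult[symmetric]) auto
  also have "2 * (c\<^sup>2 * Ks * h + c\<^sup>2 * (1 / real n)) * T = C2 / real n"
    using rn by (simp add: C2_def h_def field_simps)
  finally have P: "pnorm T (\<lambda>s \<omega>. c * ?X s \<omega> - elementary_process n t \<xi> s \<omega>) \<le> ennreal \<epsilon>"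
    using n(3) by (elim order_trans) (simp add: ennreal_leI)
  show ?thesis using data P E by blast
qed

lemma ito_residual_measurable:
  assumes u: "u \<in> L2F M W" and T: "0 \<le> T"
  shows "(\<lambda>\<omega>. sol a c x u T \<omega> - x - (LBINT s:{0..T}. a * sol a c x u s \<omega> + u s \<omega>)) \<in> borel_measurable M"
proof -
  have "progressive M W (\<lambda>s \<omega>. a * sol a c x u s \<omega> + u s \<omega>)"
    using progressive_linear[OF progressive_sol[OF L2F_D(1)[OF u]] L2F_D(1)[OF u], of a a c x 1] by simp
  then show ?thesis
    using T by (intro borel_measurable_diff sol_measurable u borel_measurable_const set_integral_measurable
        progressive_joint_measurable_Icc) auto
qed

text \<open>With the Ito integral taken to be the residual, the equation holds by construction. What
  has to be shown is that this residual is a limit of elementary integrals.\<close>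

lemma sol_has_ito_integral:
  assumes u: "u \<in> L2F M W" and T: "0 \<le> T"
  shows "has_ito_integral M W T (\<lambda>s \<omega>. c * sol a c x u s \<omega>)
    (\<lambda>\<omega>. sol a c x u T \<omega> - x - (LBINT s:{0..T}. a * sol a c x u s \<omega> + u s \<omega>))"
proof -
  let ?X = "sol a c x u"
  let ?I = "\<lambda>\<omega>. ?X T \<omega> - x - (LBINT s:{0..T}. a * ?X s \<omega> + u s \<omega>)"
  define approx where "approx k n t \<xi> \<longleftrightarrow> elementary_data M W T n t \<xi> \<and>
    pnorm T (\<lambda>s \<omega>. c * ?X s \<omega> - elementary_process n t \<xi> s \<omega>) \<le> ennreal (1 / real (Suc k)) \<and>
    msq M (\<lambda>\<omega>. ?I \<omega> - elementary_integral W n t \<xi> \<omega>) \<le> ennreal (1 / real (Suc k))" for k n t \<xi>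
  have ex: "\<exists>n t \<xi>. approx k n t \<xi>" for k
  \<comment> \<open>A grid requires a positive horizon; on \<open>[0,0]\<close> the residual is 0
    and the empty elementary process is exact.\<close>
  proof (cases "T = 0")
    case True
    have "pnorm 0 \<phi> = 0" for \<phi>
    proof -
      have "(\<integral>\<^sup>+s\<in>{0..0}. ennreal ((\<phi> s \<omega>)\<^sup>2) \<partial>lborel) = (\<integral>\<^sup>+s. 0 \<partial>(lborel :: real measure))" for \<omega>
        by (intro nn_integral_cong_AE)
           (use AE_lborel_singleton[of 0] in \<open>eventually_elim, auto split: split_indicator\<close>)
      then show ?thesis by (simp add: pnorm_def)
    qed
    then show ?thesis
      using True
      by (intro exI[of _ 0] exI[of _ "\<lambda>_. 0"] exI[of _ "\<lambda>_ _. 0"])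
         (simp add: approx_def elementary_data_def elementary_integral_def sol_0 msq_def)
  next
    case False
    then show ?thesis using T unfolding approx_def by (intro sol_ito_approx u) auto
  qed
  have "\<forall>k. \<exists>p. approx k (fst p) (fst (snd p)) (snd (snd p))" using ex by simp
  from choice[OF this] obtain p where p: "\<forall>k. approx k (fst (p k)) (fst (snd (p k))) (snd (snd (p k)))"
    by (elim exE)
  define n where "n k = fst (p k)" for k
  define t where "t k = fst (snd (p k))" for k
  define \<xi> where "\<xi> k = snd (snd (p k))" for k
  have d: "elementary_data M W T (n k) (t k) (\<xi> k)"
    and p: "pnorm T (\<lambda>s \<omega>. c * ?X s \<omega> - elementary_process (n k) (t k) (\<xi> k) s \<omega>) \<le> ennreal (1 / real (Suc k))"
    and m: "msq M (\<lambda>\<omega>. ?I \<omega> - elementary_integral W (n k) (t k) (\<xi> k) \<omega>) \<le> ennreal (1 / real (Suc k))" for k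
    using p unfolding approx_def n_def t_def \<xi>_def by blast+
  have lim: "(\<lambda>k. ennreal (1 / real (Suc k))) \<longlonglongrightarrow> 0"
    using tendsto_ennrealI[OF LIMSEQ_inverse_real_of_nat] by (simp add: inverse_eq_divide del: of_nat_Suc)
  have sq: "f \<longlonglongrightarrow> 0" if "\<And>k. f k \<le> ennreal (1 / real (Suc k))" for f
    by (rule tendsto_sandwich[OF _ _ tendsto_const lim]) (use that in auto)
  have pr: "progressive M W (\<lambda>s \<omega>. c * ?X s \<omega>)"
    by (intro progressive_mult progressive_const progressive_sol L2F_D(1)[OF u])
  show ?thesis
    unfolding has_ito_integral_def
  proof (intro conjI exI allI)
    show "elementary_data M W T (n k) (t k) (\<xi> k)" for k by (rule d)
    show "(\<lambda>k. \<integral>\<^sup>+\<omega>. (\<integral>\<^sup>+s\<in>{0..T}. ennreal ((c * ?X s \<omega> - elementary_process (n k) (t k) (\<xi> k) s \<omega>)\<^sup>2) \<partial>lborel) \<partial>M) \<longlonglongrightarrow> 0"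
      using sq[OF p] unfolding pnorm_def .
    show "(\<lambda>k. \<integral>\<^sup>+\<omega>. ennreal ((?I \<omega> - elementary_integral W (n k) (t k) (\<xi> k) \<omega>)\<^sup>2) \<partial>M) \<longlonglongrightarrow> 0"
      using sq[OF m] unfolding msq_def .
  qed (use pr ito_residual_measurable[OF u T] in auto)
qed

theorem sol_solves_sde:
  assumes u: "u \<in> L2F M W"
  shows "solves_sde M W a 1 c 0 x u (sol a c x u)"
  unfolding solves_sde_def
proof (intro conjI allI impI)
  show "progressive M W (sol a c x u)" by (rule progressive_sol[OF L2F_D(1)[OF u]])
  show "AE \<omega> in M. continuous_on {0..} (\<lambda>t. sol a c x u t \<omega>)"
    using AE_u_integrable[OF u] AE_space by eventually_elim (rule sol_continuous)
  show "(\<integral>\<^sup>+\<omega>. (\<integral>\<^sup>+t\<in>{0..T}. ennreal ((sol a c x u t \<omega>)\<^sup>2) \<partial>lborel) \<partial>M) < \<infinity>" for T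
    using sol_pnorm_finite[OF u, of T a c x] by (simp add: pnorm_def)
  fix t :: real assume "0 \<le> t"
  then show "\<exists>I. has_ito_integral M W t (\<lambda>s \<omega>. c * sol a c x u s \<omega> + 0 * u s \<omega>) I \<and>
      (AE \<omega> in M. sol a c x u t \<omega> = x + (LBINT s:{0..t}. a * sol a c x u s \<omega> + 1 * u s \<omega>) + I \<omega>)"
    using sol_has_ito_integral[OF u, of t c a x] by (intro exI conjI) auto
qed

end

section \<open>The energy balance\<close>

lemma integrable_lborel_prod_mult:
  fixes f g :: "real \<Rightarrow> real"
  assumes f: "integrable lborel f" and g: "integrable lborel g"
  shows "integrable (lborel \<Otimes>\<^sub>M lborel) (\<lambda>z. f (fst z) * g (snd z))"
proof (rule lborel_pair.Fubini_integrable)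
  have [measurable]: "f \<in> borel_measurable borel" "g \<in> borel_measurable borel" using f g by auto
  show "(\<lambda>z. f (fst z) * g (snd z)) \<in> borel_measurable (lborel \<Otimes>\<^sub>M lborel)" by measurable
  show "integrable lborel (\<lambda>x. \<integral>y. norm (f (fst (x, y)) * g (snd (x, y))) \<partial>lborel)"
    using f by (simp add: abs_mult)
  show "AE x in lborel. integrable lborel (\<lambda>y. f (fst (x, y)) * g (snd (x, y)))"
    using g by simp
qed

text \<open>The square of the integral is an integral over \<open>[0,T] x [0,T]\<close>. The
  diagonal is null and the two triangles contribute equally. This is the chain rule for the square
  of an absolutely continuous function.\<close>

lemma set_integral_square:
  fixes g :: "real \<Rightarrow> real"
  assumes g: "set_integrable lborel {0..T} g"
  shows "(LBINT s:{0..T}. g s)\<^sup>2 = 2 * (LBINT s:{0..T}. (LBINT r:{0..s}. g r) * g s)"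
proof -
  define G where "G s = indicator {0..T} s * g s" for s
  have G: "integrable lborel G" using g by (simp add: set_integrable_def G_def[abs_def])
  then have [measurable]: "G \<in> borel_measurable borel" by auto
  have P: "integrable (lborel \<Otimes>\<^sub>M lborel) (\<lambda>z. G (fst z) * G (snd z))"
    by (rule integrable_lborel_prod_mult[OF G G])
  let ?a = "\<lambda>s r. G s * G r * (if r \<le> s then 1 else 0)"
  let ?b = "\<lambda>s r. G s * G r * (if s < r then 1 else 0)"
  have ia: "integrable (lborel \<Otimes>\<^sub>M lborel) (case_prod ?a)"
    by (rule Bochner_Integration.integrable_bound[OF P]) (auto simp: case_prod_beta')
  have ib: "integrable (lborel \<Otimes>\<^sub>M lborel) (case_prod ?b)"
    by (rule Bochner_Integration.integrable_bound[OF P]) (auto simp: case_prod_beta')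
  have "(LBINT s:{0..T}. g s)\<^sup>2 = (\<integral>s. \<integral>r. G s * G r \<partial>lborel \<partial>lborel)"
    by (simp add: set_lebesgue_integral_def G_def[abs_def] power2_eq_square)
  also have "\<dots> = (\<integral>s. G s * (\<integral>r. G r \<partial>lborel) \<partial>lborel)" by simp
  also have "\<dots> = (\<integral>s. (\<integral>r. ?a s r \<partial>lborel) + (\<integral>r. ?b s r \<partial>lborel) \<partial>lborel)"
  proof (rule Bochner_Integration.integral_cong[OF refl])
    fix s
    have i: "integrable lborel (\<lambda>r. G r * (if r \<le> s then 1 else 0))" "integrable lborel (\<lambda>r. G r * (if s < r then 1 else 0))"
      by (rule Bochner_Integration.integrable_bound[OF G], simp_all)+
    have "(\<integral>r. G r \<partial>lborel) = (\<integral>r. G r * (if r \<le> s then 1 else 0) + G r * (if s < r then 1 else 0) \<partial>lborel)"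
      by (intro Bochner_Integration.integral_cong) auto
    also have "\<dots> = (\<integral>r. G r * (if r \<le> s then 1 else 0) \<partial>lborel) + (\<integral>r. G r * (if s < r then 1 else 0) \<partial>lborel)"
      by (rule Bochner_Integration.integral_add[OF i])
    finally show "G s * (\<integral>r. G r \<partial>lborel) = (\<integral>r. ?a s r \<partial>lborel) + (\<integral>r. ?b s r \<partial>lborel)"
      by (simp add: distrib_left mult.assoc)
  qed
  also have "\<dots> = (\<integral>s. \<integral>r. ?a s r \<partial>lborel \<partial>lborel) + (\<integral>s. \<integral>r. ?b s r \<partial>lborel \<partial>lborel)"
    by (rule Bochner_Integration.integral_add[OF lborel_pair.integrable_fst[OF ia] lborel_pair.integrable_fst[OF ib]])
  also have "(\<integral>s. \<integral>r. ?b s r \<partial>lborel \<partial>lborel) = (\<integral>r. \<integral>s. ?b s r \<partial>lborel \<partial>lborel)"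
    by (rule lborel_pair.Fubini_integral[OF ib, symmetric])
  also have "\<dots> = (\<integral>s. \<integral>r. ?a s r \<partial>lborel \<partial>lborel)"
  proof (rule Bochner_Integration.integral_cong[OF refl])
    fix r :: real
    show "(\<integral>s. ?b s r \<partial>lborel) = (\<integral>s. ?a r s \<partial>lborel)"
    proof (rule integral_cong_AE)
      show "AE s in lborel. ?b s r = ?a r s"
        using AE_lborel_singleton[of r] by eventually_elim auto
    qed auto
  qed
  also have "(\<integral>s. \<integral>r. ?a s r \<partial>lborel \<partial>lborel) = (LBINT s:{0..T}. (LBINT r:{0..s}. g r) * g s)"
    unfolding set_lebesgue_integral_def[of _ "{0..T}"]
  proof (rule Bochner_Integration.integral_cong[OF refl])
    fix s
    have "(\<integral>r. ?a s r \<partial>lborel) = (\<integral>r. G s * (indicator {0..s} r * g r) \<partial>lborel)"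
      by (intro Bochner_Integration.integral_cong) (auto simp: G_def split: split_indicator)
    also have "\<dots> = G s * (LBINT r:{0..s}. g r)"
      by (simp add: set_lebesgue_integral_def)
    finally show "(\<integral>r. ?a s r \<partial>lborel) = indicator {0..T} s *\<^sub>R ((LBINT r:{0..s}. g r) * g s)"
      by (simp add: G_def mult_ac)
  qed
  finally show ?thesis by simp
qed

text \<open>A positive limit would put a rectangle of arbitrary length and height
  \<open>L / 2\<close> under the graph.\<close>

lemma set_integrable_tendsto_zero:
  fixes y :: "real \<Rightarrow> real"
  assumes y: "set_integrable lborel {0..} y" and lim: "(y \<longlongrightarrow> L) at_top" and nn: "\<And>t. 0 \<le> y t"
  shows "L = 0"
proof (rule ccontr)
  assume "L \<noteq> 0"
  moreover have "0 \<le> L" by (rule tendsto_lowerbound[OF lim]) (use nn in auto)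
  ultimately have L: "0 < L" by simp
  then have "eventually (\<lambda>t. L / 2 < y t) at_top" by (intro order_tendstoD(1)[OF lim]) auto
  then obtain N where N: "\<And>t. N \<le> t \<Longrightarrow> L / 2 < y t" by (auto simp: eventually_at_top_linorder)
  define N' where "N' = max N 0"
  \<comment> \<open>This length gives the rectangle the area of the whole integral plus 1.\<close>
  define b where "b = N' + 2 * ((LBINT s:{0..}. y s) + 1) / L"
  have I: "0 \<le> (LBINT s:{0..}. y s)"
    unfolding set_lebesgue_integral_def by (intro Bochner_Integration.integral_nonneg) (auto simp: nn)
  have b: "N' \<le> b" using I L by (simp add: b_def)
  have "(LBINT s:{N'..b}. L / 2) \<le> (LBINT s:{N'..b}. y s)"
  proof (rule set_integral_mono)
    show "set_integrable lborel {N'..b} (\<lambda>s. L / 2)"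
      by (intro borel_integrable_atLeastAtMost' continuous_on_const)
    show "set_integrable lborel {N'..b} y" by (rule set_integrable_subset[OF y]) (auto simp: N'_def)
    show "L / 2 \<le> y t" if "t \<in> {N'..b}" for t using N[of t] that by (auto simp: N'_def)
  qed
  also have "\<dots> \<le> (LBINT s:{0..}. y s)"
    unfolding set_lebesgue_integral_def
    using y set_integrable_subset[OF y, of "{N'..b}"]
    by (intro integral_mono) (auto simp: set_integrable_def N'_def nn split: split_indicator)
  finally have "(b - N') * (L / 2) \<le> (LBINT s:{0..}. y s)"
    using b by (simp add: set_lebesgue_integral_def)
  then show False using L by (simp add: b_def)
qed

text \<open>For the linear equation \<open>y' = m * y + 2 * k\<close> this passes from variation of
  constants to the integrated form, by Fubini on the triangle \<open>s \<le> t\<close>. Only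
  integrability of \<open>k\<close> is assumed, so differentiating is not an option.\<close>

lemma mild_integrated:
  fixes k :: "real \<Rightarrow> real" and m v T :: real
  assumes T: "0 \<le> T" and k: "set_integrable lborel {0..T} k"
    and y: "\<And>t. 0 \<le> t \<Longrightarrow> t \<le> T \<Longrightarrow> y t = v * exp (m * t) + 2 * (LBINT s:{0..t}. exp (m * (t - s)) * k s)"
  shows "set_integrable lborel {0..T} y"
    and "y T = v + m * (LBINT t:{0..T}. y t) + 2 * (LBINT s:{0..T}. k s)"
proof -
  define G where "G s = indicator {0..T} s * k s" for s
  have G: "integrable lborel G" using k by (simp add: set_integrable_def G_def[abs_def])
  then have [measurable]: "G \<in> borel_measurable borel" by auto
  let ?h = "\<lambda>s t. (if 0 \<le> s \<and> s \<le> t \<and> t \<le> T then exp (m * (t - s)) * G s else 0)"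
  have ih: "integrable (lborel \<Otimes>\<^sub>M lborel) (case_prod ?h)"
  proof (rule Bochner_Integration.integrable_bound)
    show "integrable (lborel \<Otimes>\<^sub>M lborel) (\<lambda>z. G (fst z) * (exp (\<bar>m\<bar> * T) * indicator {0..T} (snd z)))"
      using G T by (intro integrable_lborel_prod_mult) auto
    show "case_prod ?h \<in> borel_measurable (lborel \<Otimes>\<^sub>M lborel)"
      unfolding case_prod_beta' by measurable
    have "exp (m * (t - s)) \<le> exp (\<bar>m\<bar> * T)" if "0 \<le> s" "s \<le> t" "t \<le> T" for s t
      using that abs_ge_self[of "m * (t - s)"] mult_left_mono[of "t - s" T "\<bar>m\<bar>"] by (simp add: abs_mult)
    then show "AE z in lborel \<Otimes>\<^sub>M lborel. norm (case_prod ?h z) \<le> norm (G (fst z) * (exp (\<bar>m\<bar> * T) * indicator {0..T} (snd z)))"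
      by (intro AE_I2) (auto simp: abs_mult mult.commute mult_left_mono split: split_indicator)
  qed
  have hk: "(\<integral>s. ?h s t \<partial>lborel) = indicator {0..T} t * (LBINT s:{0..t}. exp (m * (t - s)) * k s)" for t
  proof (cases "t \<in> {0..T}")
    case True
    have "(\<integral>s. ?h s t \<partial>lborel) = (LBINT s:{0..t}. exp (m * (t - s)) * k s)"
      unfolding set_lebesgue_integral_def using True
      by (intro Bochner_Integration.integral_cong) (auto simp: G_def split: split_indicator)
    then show ?thesis using True by simp
  next
    case False
    then have "(\<integral>s. ?h s t \<partial>lborel) = (\<integral>s. 0 \<partial>(lborel :: real measure))"
      by (intro Bochner_Integration.integral_cong) auto
    then show ?thesis using False by simp
  qed
  have ye: "indicator {0..T} t * y t = v * (indicator {0..T} t * exp (m * t)) + 2 * (\<integral>s. ?h s t \<partial>lborel)" for t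
    unfolding hk by (auto simp: y split: split_indicator)
  have ie: "set_integrable lborel {0..T} (\<lambda>t. exp (m * t))"
    by (intro borel_integrable_atLeastAtMost' continuous_intros)
  have i1: "integrable lborel (\<lambda>t. v * (indicator {0..T} t * exp (m * t)))"
    using ie by (simp add: set_integrable_def)
  have i2: "integrable lborel (\<lambda>t. 2 * (\<integral>s. ?h s t \<partial>lborel))"
    using lborel_pair.integrable_snd[OF ih] by simp
  show "set_integrable lborel {0..T} y"
    unfolding set_integrable_def using Bochner_Integration.integrable_add[OF i1 i2] by (simp add: ye)
  \<comment> \<open>The factor \<open>m\<close> stays on the left, so that \<open>m = 0\<close> is
    covered without a case distinction.\<close>
  have FTC: "m * (LBINT t:{p..T}. exp (m * (t - p))) = exp (m * (T - p)) - 1" if "p \<le> T" for p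
  proof -
    have "(\<integral>t. (m * exp (m * (t - p))) * indicator {p..T} t \<partial>lborel) = exp (m * (T - p)) - exp (m * (p - p))"
      by (rule integral_FTC_Icc_real[OF that]) (auto intro!: derivative_eq_intros continuous_intros)
    then show ?thesis
      by (simp add: set_lebesgue_integral_def mult_ac flip: integral_mult_right_zero)
  qed
  have "(LBINT t:{0..T}. y t) = (\<integral>t. indicator {0..T} t * y t \<partial>lborel)" by (simp add: set_lebesgue_integral_def)
  also have "\<dots> = (\<integral>t. v * (indicator {0..T} t * exp (m * t)) \<partial>lborel) + (\<integral>t. 2 * (\<integral>s. ?h s t \<partial>lborel) \<partial>lborel)"
    unfolding ye by (rule Bochner_Integration.integral_add[OF i1 i2])
  also have "(\<integral>t. 2 * (\<integral>s. ?h s t \<partial>lborel) \<partial>lborel) = 2 * (\<integral>s. \<integral>t. ?h s t \<partial>lborel \<partial>lborel)"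
    using lborel_pair.Fubini_integral[OF ih] by simp
  finally have "m * (LBINT t:{0..T}. y t) = v * (m * (LBINT t:{0..T}. exp (m * (t - 0)))) + 2 * (m * (\<integral>s. \<integral>t. ?h s t \<partial>lborel \<partial>lborel))"
    by (simp add: set_lebesgue_integral_def algebra_simps)
  also have "m * (LBINT t:{0..T}. exp (m * (t - 0))) = exp (m * T) - 1" using FTC[OF T] by simp
  also have "m * (\<integral>s. \<integral>t. ?h s t \<partial>lborel \<partial>lborel) = (\<integral>s. m * (\<integral>t. ?h s t \<partial>lborel) \<partial>lborel)" by simp
  also have "\<dots> = (\<integral>s. indicator {0..T} s *\<^sub>R (exp (m * (T - s)) * k s) - indicator {0..T} s *\<^sub>R k s \<partial>lborel)"
  proof (rule Bochner_Integration.integral_cong[OF refl])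
    fix s
    show "m * (\<integral>t. ?h s t \<partial>lborel) = indicator {0..T} s *\<^sub>R (exp (m * (T - s)) * k s) - indicator {0..T} s *\<^sub>R k s"
    proof (cases "s \<in> {0..T}")
      case True
      have "(\<integral>t. ?h s t \<partial>lborel) = (\<integral>t. k s * (indicator {s..T} t * exp (m * (t - s))) \<partial>lborel)"
        using True by (intro Bochner_Integration.integral_cong) (auto simp: G_def split: split_indicator)
      then have "m * (\<integral>t. ?h s t \<partial>lborel) = k s * (m * (LBINT t:{s..T}. exp (m * (t - s))))"
        by (simp add: set_lebesgue_integral_def)
      also have "\<dots> = k s * (exp (m * (T - s)) - 1)" using FTC[of s] True by simp
      finally show ?thesis using True by (simp add: algebra_simps)
    next
      case False
      then have "(\<integral>t. ?h s t \<partial>lborel) = (\<integral>t. 0 \<partial>(lborel :: real measure))"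
        by (intro Bochner_Integration.integral_cong) (auto simp: G_def)
      then show ?thesis using False by simp
    qed
  qed
  also have "\<dots> = (LBINT s:{0..T}. exp (m * (T - s)) * k s) - (LBINT s:{0..T}. k s)"
    unfolding set_lebesgue_integral_def
  proof (rule Bochner_Integration.integral_diff)
    have "set_integrable lborel {0..T} (\<lambda>s. k s * exp (m * (T - s)))"
      by (rule set_integrable_mult_continuous[OF k]) (intro continuous_intros)
    then show "integrable lborel (\<lambda>s. indicator {0..T} s *\<^sub>R (exp (m * (T - s)) * k s))"
      by (simp add: set_integrable_def mult_ac)
  qed (use k in \<open>simp add: set_integrable_def\<close>)
  finally show "y T = v + m * (LBINT t:{0..T}. y t) + 2 * (LBINT s:{0..T}. k s)"
    using y[OF T order_refl] by (simp add: algebra_simps)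
qed

context brownian_space
begin

text \<open>Along a path the solution is \<rho> times an absolutely continuous function, with \<rho>
  fixed at time \<open>T\<close>. \<open>set_integral_square\<close> therefore does the work of the
  Ito formula for the square.\<close>

lemma sol_square:
  assumes u: "\<forall>n::nat. set_integrable lborel {0..real n} (\<lambda>s. u s \<omega>)" and \<omega>: "\<omega> \<in> space M" and T: "0 \<le> T"
  shows "(sol a c x u T \<omega>)\<^sup>2 = x\<^sup>2 * (ratio a c 0 T \<omega>)\<^sup>2
    + 2 * (LBINT s:{0..T}. (ratio a c s T \<omega>)\<^sup>2 * (sol a c x u s \<omega> * u s \<omega>))"
proof -
  define g where "g s = u s \<omega> / ratio a c 0 s \<omega>" for s
  define \<rho> where "\<rho> = ratio a c 0 T \<omega>"
  have g: "set_integrable lborel {0..T} g"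
    unfolding g_def[abs_def] by (rule set_integrable_u_ratio(1)[where u=u and \<omega>=\<omega>, OF u \<omega> order_refl])
  have gn: "set_integrable lborel {0..real n} g" for n
    unfolding g_def[abs_def] by (rule set_integrable_u_ratio(1)[where u=u and \<omega>=\<omega>, OF u \<omega> order_refl])
  have cg: "continuous_on {0..T} (\<lambda>t. LBINT s:{0..t}. g s)"
    by (rule continuous_on_subset[OF continuous_on_set_integral_Icc[OF gn]]) auto
  have gg: "set_integrable lborel {0..T} (\<lambda>s. (LBINT r:{0..s}. g r) * g s)"
    using set_integrable_mult_continuous[OF g cg] by (simp add: mult.commute)
  have eq: "(ratio a c s T \<omega>)\<^sup>2 * (sol a c x u s \<omega> * u s \<omega>) = \<rho>\<^sup>2 * (x * g s + (LBINT r:{0..s}. g r) * g s)" for s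
  proof -
    have "\<rho> = ratio a c s T \<omega> * ratio a c 0 s \<omega>" unfolding \<rho>_def by (rule ratio_mult[symmetric])
    then show ?thesis
      unfolding sol_def g_def by (simp add: field_simps power2_eq_square)
  qed
  have "(LBINT s:{0..T}. (ratio a c s T \<omega>)\<^sup>2 * (sol a c x u s \<omega> * u s \<omega>))
      = \<rho>\<^sup>2 * (x * (LBINT s:{0..T}. g s) + (LBINT s:{0..T}. (LBINT r:{0..s}. g r) * g s))"
    unfolding eq using g gg by (simp add: set_integral_add)
  then have "x\<^sup>2 * \<rho>\<^sup>2 + 2 * (LBINT s:{0..T}. (ratio a c s T \<omega>)\<^sup>2 * (sol a c x u s \<omega> * u s \<omega>))
     = \<rho>\<^sup>2 * (x\<^sup>2 + 2 * x * (LBINT s:{0..T}. g s) + (LBINT s:{0..T}. g s)\<^sup>2)"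
    unfolding set_integral_square[OF g] by (simp add: algebra_simps)
  also have "\<dots> = (sol a c x u T \<omega>)\<^sup>2"
    unfolding sol_def \<rho>_def g_def[symmetric] by (simp add: power2_eq_square algebra_simps)
  finally show ?thesis by (simp add: \<rho>_def)
qed


section \<open>Integration over time and probability space together\<close>

abbreviation P :: "(real \<times> 'a) measure" where "P \<equiv> lborel \<Otimes>\<^sub>M M"

lemma msq_product:
  assumes f: "jointly_measurable A f"
  shows "msq P (\<lambda>z. indicator A (fst z) * f (fst z) (snd z)) = (\<integral>\<^sup>+s\<in>A. msq M (f s) \<partial>lborel)"
proof -
  have "msq P (\<lambda>z. indicator A (fst z) * f (fst z) (snd z))
      = (\<integral>\<^sup>+s. \<integral>\<^sup>+\<omega>. ennreal ((indicator A s * f s \<omega>)\<^sup>2) \<partial>M \<partial>lborel)"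
    unfolding msq_def using f by (subst nn_integral_fst[symmetric]) auto
  also have "\<dots> = (\<integral>\<^sup>+s\<in>A. msq M (f s) \<partial>lborel)"
    by (intro nn_integral_cong) (auto simp: msq_def split: split_indicator)
  finally show ?thesis .
qed

text \<open>A product of two square integrable functions on the product space is integrable; the
  remaining claims are Fubini in its two orders.\<close>

lemma
  fixes f g :: "real \<Rightarrow> 'a \<Rightarrow> real"
  assumes f: "jointly_measurable A f" "(\<integral>\<^sup>+s\<in>A. msq M (f s) \<partial>lborel) < \<infinity>"
    and g: "jointly_measurable A g" "(\<integral>\<^sup>+s\<in>A. msq M (g s) \<partial>lborel) < \<infinity>"
  shows product_integrable: "integrable P (\<lambda>z. indicator A (fst z) * (f (fst z) (snd z) * g (fst z) (snd z)))"
    and product_set_integrable: "set_integrable lborel A (\<lambda>s. \<integral>\<omega>. f s \<omega> * g s \<omega> \<partial>M)"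
    and product_integrable_snd: "integrable M (\<lambda>\<omega>. LBINT s:A. f s \<omega> * g s \<omega>)"
    and product_fst: "(LBINT s:A. (\<integral>\<omega>. f s \<omega> * g s \<omega> \<partial>M)) = (\<integral>z. indicator A (fst z) * (f (fst z) (snd z) * g (fst z) (snd z)) \<partial>P)"
    and product_snd: "(\<integral>\<omega>. (LBINT s:A. f s \<omega> * g s \<omega>) \<partial>M) = (\<integral>z. indicator A (fst z) * (f (fst z) (snd z) * g (fst z) (snd z)) \<partial>P)"
proof -
  interpret PS: pair_sigma_finite "lborel :: real measure" M by (rule pair_sigma_finite_lborel)
  let ?F = "\<lambda>s \<omega>. indicator A s * (f s \<omega> * g s \<omega>)"
  have "integrable P (\<lambda>z. (indicator A (fst z) * f (fst z) (snd z)) * (indicator A (fst z) * g (fst z) (snd z)))"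
    using f g by (intro integrable_mult_msq) (simp_all add: msq_product)
  also have "(\<lambda>z. (indicator A (fst z) * f (fst z) (snd z)) * (indicator A (fst z) * g (fst z) (snd z)))
      = (\<lambda>z. indicator A (fst z) * (f (fst z) (snd z) * g (fst z) (snd z)))"
    by (auto split: split_indicator)
  finally show 1: "integrable P (\<lambda>z. indicator A (fst z) * (f (fst z) (snd z) * g (fst z) (snd z)))" .
  then have 2: "integrable P (case_prod ?F)" by (simp add: case_prod_beta')
  show "set_integrable lborel A (\<lambda>s. \<integral>\<omega>. f s \<omega> * g s \<omega> \<partial>M)"
    using PS.integrable_fst[OF 2] by (simp add: set_integrable_def)
  show "integrable M (\<lambda>\<omega>. LBINT s:A. f s \<omega> * g s \<omega>)"
    using PS.integrable_snd[OF 2] by (simp add: set_lebesgue_integral_def)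
  show "(LBINT s:A. (\<integral>\<omega>. f s \<omega> * g s \<omega> \<partial>M)) = (\<integral>z. indicator A (fst z) * (f (fst z) (snd z) * g (fst z) (snd z)) \<partial>P)"
    using PS.integral_fst[OF 2] by (simp add: set_lebesgue_integral_def case_prod_beta')
  show "(\<integral>\<omega>. (LBINT s:A. f s \<omega> * g s \<omega>) \<partial>M) = (\<integral>z. indicator A (fst z) * (f (fst z) (snd z) * g (fst z) (snd z)) \<partial>P)"
    using PS.integral_snd[OF 2] by (simp add: set_lebesgue_integral_def case_prod_beta')
qed

lemma L2F_time_finite:
  assumes u: "u \<in> L2F M W" and A: "A \<subseteq> {0..}"
  shows "(\<integral>\<^sup>+s\<in>A. msq M (u s) \<partial>lborel) < \<infinity>"
proof -
  interpret PS: pair_sigma_finite "lborel :: real measure" M by (rule pair_sigma_finite_lborel)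
  have "(\<integral>\<^sup>+s\<in>A. msq M (u s) \<partial>lborel) \<le> (\<integral>\<^sup>+s\<in>{0..}. msq M (u s) \<partial>lborel)"
    using A by (intro nn_integral_mono) (auto split: split_indicator)
  also have "\<dots> = (\<integral>\<^sup>+\<omega>. (\<integral>\<^sup>+t\<in>{0..}. ennreal ((u t \<omega>)\<^sup>2) \<partial>lborel) \<partial>M)"
    by (rule PS.nn_integral_swap_set[OF progressive_joint_measurable[OF L2F_D(1)[OF u]], symmetric])
  also have "\<dots> < \<infinity>" by (rule L2F_D(2)[OF u])
  finally show ?thesis .
qed

text \<open>Single values of \<open>u\<close> may fail to be square integrable, so pointwise moment
  arguments involving the control hold only for almost every time.\<close>

lemma AE_msq_finite:
  assumes u: "u \<in> L2F M W"
  shows "AE s in lborel. 0 \<le> s \<longrightarrow> msq M (u s) < \<infinity>"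
proof -
  have "AE s in lborel. msq M (u s) * indicator {0..} s \<noteq> \<infinity>"
    using L2F_time_finite[OF u order_refl]
    by (intro nn_integral_PInf_AE measurable_msq_time progressive_joint_measurable[OF L2F_D(1)[OF u]]) auto
  then show ?thesis by eventually_elim (auto simp: less_top split: split_indicator_asm)
qed

lemma sol_time_finite:
  assumes u: "u \<in> L2F M W"
  shows "(\<integral>\<^sup>+s\<in>{0..T}. msq M (sol a c x u s) \<partial>lborel) < \<infinity>"
  using sol_pnorm_finite[OF u, of T a c x] pnorm_eq[OF sol_joint_measurable[OF u order_refl, of T a c x]] by simp

lemma ratio_mult_time_finite:
  assumes T: "0 \<le> T" and \<phi>: "progressive M W \<phi>" "(\<integral>\<^sup>+s\<in>{0..T}. msq M (\<phi> s) \<partial>lborel) < \<infinity>"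
  shows "(\<integral>\<^sup>+s\<in>{0..T}. msq M (\<lambda>\<omega>. ratio a c s T \<omega> * \<phi> s \<omega>) \<partial>lborel) < \<infinity>"
proof -
  obtain K where K: "0 \<le> K" and K': "\<forall>s t. 0 \<le> s \<longrightarrow> s \<le> t \<longrightarrow> t \<le> T \<longrightarrow>
      msq M (\<lambda>\<omega>. gexp a c (t - s) (W t \<omega> - W s \<omega>)) \<le> ennreal K \<and>
      msq M (\<lambda>\<omega>. gexp a c (t - s) (W t \<omega> - W s \<omega>) - 1) \<le> ennreal (K * (t - s)) \<and>
      msq M (\<lambda>\<omega>. gres a c (t - s) (W t \<omega> - W s \<omega>)) \<le> ennreal (K * (t - s)\<^sup>2)"
    using moment_bounds[OF T, of a c] by (elim exE conjE)
  have "(\<integral>\<^sup>+s\<in>{0..T}. msq M (\<lambda>\<omega>. ratio a c s T \<omega> * \<phi> s \<omega>) \<partial>lborel)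
      \<le> (\<integral>\<^sup>+s. ennreal K * (msq M (\<phi> s) * indicator {0..T} s) \<partial>lborel)"
  proof (rule nn_integral_mono)
    fix s
    show "msq M (\<lambda>\<omega>. ratio a c s T \<omega> * \<phi> s \<omega>) * indicator {0..T} s \<le> ennreal K * (msq M (\<phi> s) * indicator {0..T} s)"
    proof (cases "s \<in> {0..T}")
      case True
      then have s: "0 \<le> s" "s \<le> T" by auto
      have "msq M (\<lambda>\<omega>. ratio a c s T \<omega> * \<phi> s \<omega>) = msq M (\<phi> s) * msq M (\<lambda>\<omega>. gexp a c (T - s) (W T \<omega> - W s \<omega>))"
        using msq_mult_ratio_fun[OF s progressive_measurable_F[OF \<phi>(1) s(1)] gexp_measurable, of a c "T - s"]
        by (simp add: ratio_eq_gexp mult.commute)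
      also have "\<dots> \<le> msq M (\<phi> s) * ennreal K" using K' s by (intro mult_left_mono) auto
      finally show ?thesis using True by (simp add: mult.commute)
    qed simp
  qed
  also have "\<dots> = ennreal K * (\<integral>\<^sup>+s\<in>{0..T}. msq M (\<phi> s) \<partial>lborel)"
    by (rule nn_integral_cmult[OF measurable_msq_time[OF progressive_joint_measurable_Icc[OF \<phi>(1)]]])
  also have "\<dots> < \<infinity>" using \<phi>(2) by (simp add: ennreal_mult_less_top)
  finally show ?thesis .
qed

text \<open>Expectation of \<open>sol_square\<close>. The squared fundamental solution from
  \<open>s\<close> to \<open>T\<close> is independent of the past up to \<open>s\<close> and
  averages to the exponential, for almost every \<open>s\<close>.\<close>

lemma sol_second_moment:
  assumes u: "u \<in> L2F M W" and T: "0 \<le> T"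
  shows "(\<integral>\<omega>. (sol a c x u T \<omega>)\<^sup>2 \<partial>M) = x\<^sup>2 * exp ((2 * a + c\<^sup>2) * T)
    + 2 * (LBINT s:{0..T}. exp ((2 * a + c\<^sup>2) * (T - s)) * (\<integral>\<omega>. sol a c x u s \<omega> * u s \<omega> \<partial>M))"
proof -
  let ?X = "sol a c x u"
  let ?m = "2 * a + c\<^sup>2"
  \<comment> \<open>The squared ratio is shared between the two factors: each product has a finite
    second moment by independence, which makes the triple product integrable.\<close>
  let ?\<phi> = "\<lambda>s \<omega>. ratio a c s T \<omega> * ?X s \<omega>" and ?\<psi> = "\<lambda>s \<omega>. ratio a c s T \<omega> * u s \<omega>"
  note pu = L2F_D(1)[OF u] and pX = progressive_sol[OF L2F_D(1)[OF u], of a c x]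
  have \<phi>: "jointly_measurable {0..T} ?\<phi>"
      "(\<integral>\<^sup>+s\<in>{0..T}. msq M (?\<phi> s) \<partial>lborel) < \<infinity>"
    using progressive_ratio_mult_joint_measurable[OF pX order_refl T] ratio_mult_time_finite[OF T pX sol_time_finite[OF u]] by auto
  have "(\<integral>\<^sup>+s\<in>{0..T}. msq M (u s) \<partial>lborel) < \<infinity>" by (rule L2F_time_finite[OF u]) auto
  then have \<psi>: "jointly_measurable {0..T} ?\<psi>"
      "(\<integral>\<^sup>+s\<in>{0..T}. msq M (?\<psi> s) \<partial>lborel) < \<infinity>"
    using progressive_ratio_mult_joint_measurable[OF pu order_refl T] ratio_mult_time_finite[OF T pu] by auto
  have rsq: "has_bochner_integral M (\<lambda>\<omega>. (ratio a c 0 T \<omega>)\<^sup>2) (exp (?m * T))"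
  proof -
    have "has_bochner_integral M (\<lambda>\<omega>. (gexp a c (T - 0) (W T \<omega> - W 0 \<omega>))\<^sup>2) (exp (?m * (T - 0)))"
      by (rule gexp_square_mean[OF order_refl T])
    moreover have "has_bochner_integral M (\<lambda>\<omega>. (ratio a c 0 T \<omega>)\<^sup>2) (exp (?m * T))
        = has_bochner_integral M (\<lambda>\<omega>. (gexp a c (T - 0) (W T \<omega> - W 0 \<omega>))\<^sup>2) (exp (?m * T))"
    proof (rule has_bochner_integral_cong_AE)
      show "(\<lambda>\<omega>. (ratio a c 0 T \<omega>)\<^sup>2) \<in> borel_measurable M"
        using T by (intro borel_measurable_power ratio_measurable) auto
      show "(\<lambda>\<omega>. (gexp a c (T - 0) (W T \<omega> - W 0 \<omega>))\<^sup>2) \<in> borel_measurable M"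
        using T by (intro borel_measurable_power measurable_compose[OF _ gexp_measurable] borel_measurable_diff W_measurable) auto
      show "AE \<omega> in M. (ratio a c 0 T \<omega>)\<^sup>2 = (gexp a c (T - 0) (W T \<omega> - W 0 \<omega>))\<^sup>2"
        using V_AE by eventually_elim (simp add: ratio_eq_gexp)
    qed
    ultimately show ?thesis by simp
  qed
  have J: "integrable M (\<lambda>\<omega>. LBINT s:{0..T}. ?\<phi> s \<omega> * ?\<psi> s \<omega>)"
    by (rule product_integrable_snd[OF \<phi> \<psi>])
  have "(\<integral>\<omega>. (?X T \<omega>)\<^sup>2 \<partial>M) = (\<integral>\<omega>. x\<^sup>2 * (ratio a c 0 T \<omega>)\<^sup>2 + 2 * (LBINT s:{0..T}. ?\<phi> s \<omega> * ?\<psi> s \<omega>) \<partial>M)"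
  proof (rule integral_cong_AE)
    show "AE \<omega> in M. (?X T \<omega>)\<^sup>2 = x\<^sup>2 * (ratio a c 0 T \<omega>)\<^sup>2 + 2 * (LBINT s:{0..T}. ?\<phi> s \<omega> * ?\<psi> s \<omega>)"
      using AE_u_integrable[OF u] AE_space
    proof eventually_elim
      case (elim \<omega>)
      have eq: "?\<phi> s \<omega> * ?\<psi> s \<omega> = (ratio a c s T \<omega>)\<^sup>2 * (?X s \<omega> * u s \<omega>)" for s
        by (simp add: power2_eq_square)
      show ?case unfolding eq by (rule sol_square[where u=u and \<omega>=\<omega>, OF elim T])
    qed
    show "(\<lambda>\<omega>. (?X T \<omega>)\<^sup>2) \<in> borel_measurable M" by (intro borel_measurable_power sol_measurable u T)
    show "(\<lambda>\<omega>. x\<^sup>2 * (ratio a c 0 T \<omega>)\<^sup>2 + 2 * (LBINT s:{0..T}. ?\<phi> s \<omega> * ?\<psi> s \<omega>)) \<in> borel_measurable M"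
      using J T by (intro borel_measurable_add borel_measurable_times borel_measurable_const borel_measurable_power ratio_measurable) auto
  qed
  also have "\<dots> = x\<^sup>2 * exp (?m * T) + 2 * (\<integral>\<omega>. (LBINT s:{0..T}. ?\<phi> s \<omega> * ?\<psi> s \<omega>) \<partial>M)"
    using J rsq by (simp add: has_bochner_integral_iff)
  also have "(\<integral>\<omega>. (LBINT s:{0..T}. ?\<phi> s \<omega> * ?\<psi> s \<omega>) \<partial>M) = (LBINT s:{0..T}. (\<integral>\<omega>. ?\<phi> s \<omega> * ?\<psi> s \<omega> \<partial>M))"
    unfolding product_fst[OF \<phi> \<psi>] product_snd[OF \<phi> \<psi>] ..
  also have "\<dots> = (LBINT s:{0..T}. exp (?m * (T - s)) * (\<integral>\<omega>. ?X s \<omega> * u s \<omega> \<partial>M))"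
    unfolding set_lebesgue_integral_def
  proof (rule integral_cong_AE)
    show "(\<lambda>s. indicator {0..T} s *\<^sub>R (\<integral>\<omega>. ?\<phi> s \<omega> * ?\<psi> s \<omega> \<partial>M)) \<in> borel_measurable lborel"
      using product_set_integrable[OF \<phi> \<psi>] unfolding set_integrable_def by (rule borel_measurable_integrable)
    have "set_integrable lborel {0..T} (\<lambda>s. \<integral>\<omega>. ?X s \<omega> * u s \<omega> \<partial>M)"
      by (rule product_set_integrable[OF sol_joint_measurable[OF u order_refl] sol_time_finite[OF u]
            L2F_joint_measurable[OF u order_refl] L2F_time_finite[OF u]]) auto
    then have "set_integrable lborel {0..T} (\<lambda>s. (\<integral>\<omega>. ?X s \<omega> * u s \<omega> \<partial>M) * exp (?m * (T - s)))"
      by (rule set_integrable_mult_continuous) (intro continuous_intros)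
    then show "(\<lambda>s. indicator {0..T} s *\<^sub>R (exp (?m * (T - s)) * (\<integral>\<omega>. ?X s \<omega> * u s \<omega> \<partial>M))) \<in> borel_measurable lborel"
      unfolding set_integrable_def by (simp add: mult.commute[of "exp _"] borel_measurable_integrable)
    show "AE s in lborel. indicator {0..T} s *\<^sub>R (\<integral>\<omega>. ?\<phi> s \<omega> * ?\<psi> s \<omega> \<partial>M)
        = indicator {0..T} s *\<^sub>R (exp (?m * (T - s)) * (\<integral>\<omega>. ?X s \<omega> * u s \<omega> \<partial>M))"
      using AE_msq_finite[OF u]
    proof eventually_elim
      case (elim s)
      show ?case
      proof (cases "s \<in> {0..T}")
        case True
        then have s: "0 \<le> s" "s \<le> T" by auto
        have \<xi>: "(\<lambda>\<omega>. ?X s \<omega> * u s \<omega>) \<in> borel_measurable (F s)"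
          by (intro borel_measurable_times sol_measurable_F u s progressive_measurable_F[OF pu])
        have \<xi>i: "integrable M (\<lambda>\<omega>. ?X s \<omega> * u s \<omega>)"
          using elim s by (intro integrable_mult_msq sol_measurable u progressive_measurable[OF pu] sol_msq_finite) auto
        have f: "(\<lambda>y. (gexp a c (T - s) y)\<^sup>2) \<in> borel_measurable borel" by measurable
        note g = gexp_square_mean[OF s, of a c, unfolded has_bochner_integral_iff]
        have "(\<integral>\<omega>. ?\<phi> s \<omega> * ?\<psi> s \<omega> \<partial>M) = (\<integral>\<omega>. (?X s \<omega> * u s \<omega>) * (gexp a c (T - s) (W T \<omega> - W s \<omega>))\<^sup>2 \<partial>M)"
        proof (rule integral_cong_AE)
          show "AE \<omega> in M. ?\<phi> s \<omega> * ?\<psi> s \<omega> = (?X s \<omega> * u s \<omega>) * (gexp a c (T - s) (W T \<omega> - W s \<omega>))\<^sup>2"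
            using V_AE by eventually_elim (simp add: ratio_eq_gexp power2_eq_square)
          show "(\<lambda>\<omega>. ?\<phi> s \<omega> * ?\<psi> s \<omega>) \<in> borel_measurable M"
            by (intro borel_measurable_times ratio_measurable sol_measurable u s T progressive_measurable[OF pu])
          show "(\<lambda>\<omega>. (?X s \<omega> * u s \<omega>) * (gexp a c (T - s) (W T \<omega> - W s \<omega>))\<^sup>2) \<in> borel_measurable M"
            using integrable_mult_increment[OF s \<xi> f \<xi>i g[THEN conjunct1]] by auto
        qed
        also have "\<dots> = (\<integral>\<omega>. ?X s \<omega> * u s \<omega> \<partial>M) * exp (?m * (T - s))"
          using expectation_mult_increment[OF s \<xi> f \<xi>i g[THEN conjunct1]] g by simp
        finally show ?thesis by simp
      qed simp
    qed
  qed
  finally show ?thesis .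
qed

text \<open>The weights \<open>exp (m (T - s))\<close> of the second moment formula are removed by
  \<open>mild_integrated\<close>. In this form the horizon can be sent to infinity.\<close>

lemma sol_energy:
  assumes u: "u \<in> L2F M W" and T: "0 \<le> T"
  shows "(\<integral>\<omega>. (sol a c x u T \<omega>)\<^sup>2 \<partial>M) = x\<^sup>2 + (2 * a + c\<^sup>2) * (LBINT s:{0..T}. (\<integral>\<omega>. (sol a c x u s \<omega>)\<^sup>2 \<partial>M))
    + 2 * (LBINT s:{0..T}. (\<integral>\<omega>. sol a c x u s \<omega> * u s \<omega> \<partial>M))"
proof (rule mild_integrated(2)[OF T])
  show "set_integrable lborel {0..T} (\<lambda>s. \<integral>\<omega>. sol a c x u s \<omega> * u s \<omega> \<partial>M)"
    by (rule product_set_integrable[OF sol_joint_measurable[OF u order_refl] sol_time_finite[OF u]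
          L2F_joint_measurable[OF u order_refl] L2F_time_finite[OF u]]) auto
qed (rule sol_second_moment[OF u])

text \<open>Energy estimate: with \<open>m > 0\<close> the decay rate, Young's inequality lets half
  of the dissipation absorb the mixed term, leaving a bound uniform in the horizon.\<close>

lemma sol_in_L2F:
  assumes u: "u \<in> L2F M W" and m: "2 * a + c\<^sup>2 < 0"
  shows "sol a c x u \<in> L2F M W"
proof -
  interpret PS: pair_sigma_finite "lborel :: real measure" M by (rule pair_sigma_finite_lborel)
  let ?X = "sol a c x u"
  define m where "m = - (2 * a + c\<^sup>2)"
  have m0: "0 < m" using m by (simp add: m_def)
  define y where "y s = (\<integral>\<omega>. (?X s \<omega>)\<^sup>2 \<partial>M)" for s
  define k where "k s = (\<integral>\<omega>. ?X s \<omega> * u s \<omega> \<partial>M)" for s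
  define n where "n s = (\<integral>\<omega>. (u s \<omega>)\<^sup>2 \<partial>M)" for s
  note pX = progressive_sol[OF L2F_D(1)[OF u], of a c x]
  have n0: "0 \<le> n s" for s by (simp add: n_def)
  have yi: "set_integrable lborel {0..T} y" for T
    using product_set_integrable[OF sol_joint_measurable[OF u order_refl] sol_time_finite[OF u] sol_joint_measurable[OF u order_refl] sol_time_finite[OF u], of T a c x a c x]
    by (simp add: y_def[abs_def] power2_eq_square)
  have ki: "set_integrable lborel {0..T} k" for T
    unfolding k_def[abs_def]
    by (rule product_set_integrable[OF sol_joint_measurable[OF u order_refl] sol_time_finite[OF u]
          L2F_joint_measurable[OF u order_refl] L2F_time_finite[OF u]]) auto
  have ni: "set_integrable lborel {0..} n"
    using product_set_integrable[OF progressive_joint_measurable[OF L2F_D(1)[OF u]] L2F_time_finite[OF u order_refl]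
        progressive_joint_measurable[OF L2F_D(1)[OF u]] L2F_time_finite[OF u order_refl]]
    by (simp add: n_def[abs_def] power2_eq_square)
  have niT: "set_integrable lborel {0..T} n" for T by (rule set_integrable_subset[OF ni]) auto
  define N where "N = (LBINT s:{0..}. n s)"
  \<comment> \<open>Solves \<open>(m / 2) * I \<le> x^2 + (2 / m) * N\<close> for the time integral
    \<open>I\<close>; this inequality is the energy balance after dropping the nonnegative
    \<open>y T\<close>.\<close>
  define K where "K = (x\<^sup>2 + (2 / m) * N) * (2 / m)"
  have bound: "(LBINT s:{0..T}. y s) \<le> K" if T: "0 \<le> T" for T
  proof -
    have "2 * (LBINT s:{0..T}. k s) = (LBINT s:{0..T}. 2 * k s)" by simp
    also have "\<dots> \<le> (LBINT s:{0..T}. (m / 2) * y s + (2 / m) * n s)"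
      unfolding set_lebesgue_integral_def
    proof (rule integral_mono_AE)
      show "integrable lborel (\<lambda>s. indicator {0..T} s *\<^sub>R (2 * k s))"
        using set_integrable_mult_right[of 2 lborel "{0..T}" k] ki[of T] by (simp add: set_integrable_def)
      have "set_integrable lborel {0..T} (\<lambda>s. (m / 2) * y s + (2 / m) * n s)"
        by (intro set_integral_add set_integrable_mult_right yi niT)
      then show "integrable lborel (\<lambda>s. indicator {0..T} s *\<^sub>R ((m / 2) * y s + (2 / m) * n s))"
        by (simp add: set_integrable_def)
      show "AE s in lborel. indicator {0..T} s *\<^sub>R (2 * k s) \<le> indicator {0..T} s *\<^sub>R ((m / 2) * y s + (2 / m) * n s)"
        using AE_msq_finite[OF u]
      proof eventually_elim
        case (elim s)
        have "2 * k s \<le> (m / 2) * y s + (2 / m) * n s" if s: "s \<in> {0..T}"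
        proof -
          have sm: "?X s \<in> borel_measurable M" "u s \<in> borel_measurable M" "msq M (?X s) < \<infinity>" "msq M (u s) < \<infinity>"
            using s elim sol_msq_finite[OF u, of s a c x]
            by (auto intro!: sol_measurable u progressive_measurable[OF L2F_D(1)[OF u]])
          have "2 * k s = (\<integral>\<omega>. 2 * (?X s \<omega> * u s \<omega>) \<partial>M)" by (simp add: k_def)
          also have "\<dots> \<le> (\<integral>\<omega>. (m / 2) * (?X s \<omega>)\<^sup>2 + (2 / m) * (u s \<omega>)\<^sup>2 \<partial>M)"
          proof (rule integral_mono)
            show "integrable M (\<lambda>\<omega>. 2 * (?X s \<omega> * u s \<omega>))"
              using integrable_mult_msq[of "?X s" M "u s"] sm by simp
            show "integrable M (\<lambda>\<omega>. (m / 2) * (?X s \<omega>)\<^sup>2 + (2 / m) * (u s \<omega>)\<^sup>2)"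
              using sm by (intro Bochner_Integration.integrable_add integrable_mult_right integrable_power2_iff_msq[THEN iffD2])
            fix \<omega>
            \<comment> \<open>The weights \<open>m / 2\<close> and \<open>2 / m\<close> have product
              1, so the difference is a perfect square.\<close>
            have "(m / 2) * p\<^sup>2 + (2 / m) * q\<^sup>2 - 2 * (p * q) = (m * p - 2 * q)\<^sup>2 / (2 * m)" for p q :: real
              using m0 by (simp add: power2_eq_square field_simps)
            moreover have "0 \<le> (m * p - 2 * q)\<^sup>2 / (2 * m)" for p q :: real using m0 by simp
            ultimately show "2 * (?X s \<omega> * u s \<omega>) \<le> (m / 2) * (?X s \<omega>)\<^sup>2 + (2 / m) * (u s \<omega>)\<^sup>2"
              by (metis diff_ge_0_iff_ge)
          qed
          also have "\<dots> = (m / 2) * y s + (2 / m) * n s"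
            using sm by (simp add: y_def n_def integrable_power2_iff_msq)
          finally show ?thesis .
        qed
        then show ?case by (auto split: split_indicator)
      qed
    qed
    also have "\<dots> = (m / 2) * (LBINT s:{0..T}. y s) + (2 / m) * (LBINT s:{0..T}. n s)"
      using yi[of T] niT[of T] by (simp only: set_integral_add(2) set_integrable_mult_right set_integral_mult_right)
    also have "(LBINT s:{0..T}. n s) \<le> N"
      unfolding N_def set_lebesgue_integral_def using ni niT[of T]
      by (intro integral_mono) (auto simp: set_integrable_def n0 split: split_indicator)
    finally have "2 * (LBINT s:{0..T}. k s) \<le> (m / 2) * (LBINT s:{0..T}. y s) + (2 / m) * N"
      using m0 by (simp add: divide_right_mono)
    moreover have "y T = x\<^sup>2 - m * (LBINT s:{0..T}. y s) + 2 * (LBINT s:{0..T}. k s)"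
    proof -
      have "2 * a + c\<^sup>2 = - m" by (simp add: m_def)
      note sol_energy[OF u T, of a c x, unfolded this, folded y_def k_def]
      then show ?thesis by simp
    qed
    moreover have "0 \<le> y T" by (simp add: y_def)
    ultimately have "(m / 2) * (LBINT s:{0..T}. y s) \<le> x\<^sup>2 + (2 / m) * N" by linarith
    then show ?thesis using m0 by (simp add: K_def field_simps)
  qed
  have "(\<integral>\<^sup>+s\<in>{0..}. msq M (?X s) \<partial>lborel) \<le> ennreal K"
  proof -
    \<comment> \<open>Monotone convergence along integer horizons carries the uniform bound to the
      half line.\<close>
    let ?f = "\<lambda>j s. msq M (?X s) * indicator {0..real j} s"
    have "(\<integral>\<^sup>+s\<in>{0..}. msq M (?X s) \<partial>lborel) = (\<integral>\<^sup>+s. (SUP j. ?f j s) \<partial>lborel)"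
    proof (rule nn_integral_cong)
      fix s :: real
      show "msq M (?X s) * indicator {0..} s = (SUP j. ?f j s)"
      proof (rule antisym)
        obtain j :: nat where "s \<le> real j" using real_arch_simple by blast
        then have "msq M (?X s) * indicator {0..} s \<le> ?f j s" by (auto split: split_indicator)
        also have "\<dots> \<le> (SUP j. ?f j s)" by (rule SUP_upper) simp
        finally show "msq M (?X s) * indicator {0..} s \<le> (SUP j. ?f j s)" .
        show "(SUP j. ?f j s) \<le> msq M (?X s) * indicator {0..} s"
          by (rule SUP_least) (auto split: split_indicator)
      qed
    qed
    also have "\<dots> = (SUP j. (\<integral>\<^sup>+s. ?f j s \<partial>lborel))"
    proof (rule nn_integral_monotone_convergence_SUP)
      show "incseq ?f" by (auto simp: incseq_def le_fun_def split: split_indicator)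
      show "?f j \<in> borel_measurable lborel" for j
        by (rule measurable_msq_time[OF sol_joint_measurable[OF u order_refl]])
    qed
    also have "\<dots> \<le> ennreal K"
    proof (rule SUP_least)
      fix j :: nat
      have "(\<integral>\<^sup>+s. ?f j s \<partial>lborel) = (\<integral>\<^sup>+s. ennreal (indicator {0..real j} s *\<^sub>R y s) \<partial>lborel)"
      proof (rule nn_integral_cong)
        fix s :: real
        have "msq M (?X s) = ennreal (y s)" if "0 \<le> s"
          unfolding y_def using that by (intro msq_eq_integral sol_measurable sol_msq_finite u)
        then show "?f j s = ennreal (indicator {0..real j} s *\<^sub>R y s)" by (simp split: split_indicator)
      qed
      also have "\<dots> = ennreal (LBINT s:{0..real j}. y s)"
        unfolding set_lebesgue_integral_def using yi[of "real j"]
        by (intro nn_integral_eq_integral) (auto simp: set_integrable_def y_def split: split_indicator)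
      also have "\<dots> \<le> ennreal K" by (intro ennreal_leI bound) simp
      finally show "(\<integral>\<^sup>+s. ?f j s \<partial>lborel) \<le> ennreal K" .
    qed
    finally show ?thesis .
  qed
  then have "(\<integral>\<^sup>+s\<in>{0..}. msq M (?X s) \<partial>lborel) < \<infinity>" by (rule le_less_trans) simp
  then show ?thesis
    using PS.nn_integral_swap_set[OF progressive_joint_measurable[OF pX]] pX by (simp add: L2F_def)
qed

text \<open>As the horizon grows, the right side of \<open>sol_energy\<close> converges, hence so
  does the second moment. Being integrable over time, it can only tend to 0.\<close>

lemma sol_identity:
  assumes u: "u \<in> L2F M W" and X: "sol a c x u \<in> L2F M W"
  shows "(2 * a + c\<^sup>2) * (LBINT s:{0..}. (\<integral>\<omega>. (sol a c x u s \<omega>)\<^sup>2 \<partial>M))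
    + 2 * (LBINT s:{0..}. (\<integral>\<omega>. sol a c x u s \<omega> * u s \<omega> \<partial>M)) = - x\<^sup>2"
proof -
  let ?X = "sol a c x u"
  let ?m = "2 * a + c\<^sup>2"
  define y where "y s = (\<integral>\<omega>. (?X s \<omega>)\<^sup>2 \<partial>M)" for s
  define k where "k s = (\<integral>\<omega>. ?X s \<omega> * u s \<omega> \<partial>M)" for s
  note jX = progressive_joint_measurable[OF L2F_D(1)[OF X]] L2F_time_finite[OF X order_refl]
  note ju = progressive_joint_measurable[OF L2F_D(1)[OF u]] L2F_time_finite[OF u order_refl]
  have yi: "set_integrable lborel {0..} y"
    using product_set_integrable[OF jX jX] by (simp add: y_def[abs_def] power2_eq_square)
  have ki: "set_integrable lborel {0..} k"
    using product_set_integrable[OF jX ju] by (simp add: k_def[abs_def])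
  have "((\<lambda>T. x\<^sup>2 + ?m * (LBINT s:{0..T}. y s) + 2 * (LBINT s:{0..T}. k s))
      \<longlongrightarrow> x\<^sup>2 + ?m * (LBINT s:{0..}. y s) + 2 * (LBINT s:{0..}. k s)) at_top"
    by (intro tendsto_add tendsto_mult tendsto_const tendsto_set_lebesgue_integral_at_top yi ki) auto
  moreover have "eventually (\<lambda>T. x\<^sup>2 + ?m * (LBINT s:{0..T}. y s) + 2 * (LBINT s:{0..T}. k s) = y T) at_top"
    using eventually_ge_at_top[of 0]
    by eventually_elim (simp add: y_def[abs_def] k_def[abs_def] sol_energy[OF u])
  ultimately have "(y \<longlongrightarrow> x\<^sup>2 + ?m * (LBINT s:{0..}. y s) + 2 * (LBINT s:{0..}. k s)) at_top"
    by (rule Lim_transform_eventually)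
  then have "x\<^sup>2 + ?m * (LBINT s:{0..}. y s) + 2 * (LBINT s:{0..}. k s) = 0"
    by (rule set_integrable_tendsto_zero[OF yi]) (simp add: y_def)
  then show ?thesis by (simp add: y_def[abs_def] k_def[abs_def])
qed


section \<open>Processes as vectors of the square integrable functions on the product space\<close>

definition ext :: "(real \<Rightarrow> 'a \<Rightarrow> real) \<Rightarrow> real \<times> 'a \<Rightarrow> real" where
  "ext \<phi> z = indicator {0..} (fst z) * \<phi> (fst z) (snd z)"

text \<open>The inner product of the processes on \<open>[0,\<infinity>)\<close>, each extended by
  zero. It is degenerate as a form on functions: vanishing norm means vanishing almost everywhere,
  which is why statements about optimal controls hold up to null sets.\<close>

definition ip :: "(real \<Rightarrow> 'a \<Rightarrow> real) \<Rightarrow> (real \<Rightarrow> 'a \<Rightarrow> real) \<Rightarrow> real" where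
  "ip \<phi> \<psi> = (\<integral>z. ext \<phi> z * ext \<psi> z \<partial>P)"

lemma ext_measurable: "progressive M W \<phi> \<Longrightarrow> ext \<phi> \<in> borel_measurable P"
  using progressive_joint_measurable unfolding ext_def[abs_def] .

lemma L2F_iff: "\<phi> \<in> L2F M W \<longleftrightarrow> progressive M W \<phi> \<and> msq P (ext \<phi>) < \<infinity>"
proof -
  interpret PS: pair_sigma_finite "lborel :: real measure" M by (rule pair_sigma_finite_lborel)
  have "(\<integral>\<^sup>+\<omega>. (\<integral>\<^sup>+t\<in>{0..}. ennreal ((\<phi> t \<omega>)\<^sup>2) \<partial>lborel) \<partial>M) = msq P (ext \<phi>)" if "progressive M W \<phi>"
    using PS.nn_integral_swap_set[OF progressive_joint_measurable[OF that]]
      msq_product[OF progressive_joint_measurable[OF that]]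
    by (simp add: ext_def[abs_def])
  then show ?thesis by (auto simp: L2F_def)
qed

lemma ext_integrable:
  "\<phi> \<in> L2F M W \<Longrightarrow> \<psi> \<in> L2F M W \<Longrightarrow> integrable P (\<lambda>z. ext \<phi> z * ext \<psi> z)"
  by (intro integrable_mult_msq ext_measurable) (auto simp: L2F_iff)

lemma ext_linear: "ext (\<lambda>t \<omega>. a * \<phi> t \<omega> + b * \<psi> t \<omega>) z = a * ext \<phi> z + b * ext \<psi> z"
  by (simp add: ext_def algebra_simps)

lemma L2F_linear:
  assumes "\<phi> \<in> L2F M W" "\<psi> \<in> L2F M W"
  shows "(\<lambda>t \<omega>. a * \<phi> t \<omega> + b * \<psi> t \<omega>) \<in> L2F M W"
proof -
  note m = ext_measurable[of \<phi>] ext_measurable[of \<psi>]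
  have m: "ext \<phi> \<in> borel_measurable P" "ext \<psi> \<in> borel_measurable P" "msq P (ext \<phi>) < \<infinity>" "msq P (ext \<psi>) < \<infinity>"
    using assms m by (auto simp: L2F_iff)
  have "msq P (\<lambda>z. a * ext \<phi> z + b * ext \<psi> z) \<le> 2 * (msq P (\<lambda>z. a * ext \<phi> z) + msq P (\<lambda>z. b * ext \<psi> z))"
    by (intro msq_add borel_measurable_times borel_measurable_const m)
  also have "\<dots> = 2 * (ennreal (a\<^sup>2) * msq P (ext \<phi>) + ennreal (b\<^sup>2) * msq P (ext \<psi>))"
    by (simp add: msq_cmult m)
  also have "\<dots> < \<infinity>" using m by (simp add: ennreal_mult_less_top)
  finally show ?thesis using assms by (simp add: L2F_iff progressive_linear ext_linear[abs_def])
qed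

lemma zero_L2F: "(\<lambda>_ _. 0) \<in> L2F M W"
  by (simp add: L2F_def progressive_const)

lemma ip_linear_left:
  assumes "\<phi> \<in> L2F M W" "\<psi> \<in> L2F M W" "\<eta> \<in> L2F M W"
  shows "ip (\<lambda>t \<omega>. a * \<phi> t \<omega> + b * \<psi> t \<omega>) \<eta> = a * ip \<phi> \<eta> + b * ip \<psi> \<eta>"
  using ext_integrable[OF assms(1,3)] ext_integrable[OF assms(2,3)]
  by (simp add: ip_def ext_linear distrib_right mult.assoc)

lemma ip_commute: "ip \<phi> \<psi> = ip \<psi> \<phi>" by (simp add: ip_def mult.commute)

lemma ip_nonneg: "0 \<le> ip \<phi> \<phi>" unfolding ip_def by (rule Bochner_Integration.integral_nonneg) simp

lemma ip_eq_0_imp: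
  assumes "\<phi> \<in> L2F M W" "ip \<phi> \<phi> = 0"
  shows "AE z in P. ext \<phi> z = 0"
  using assms integral_nonneg_eq_0_iff_AE[OF ext_integrable[OF assms(1,1)]] by (simp add: ip_def)

lemma ip_cong_AE:
  assumes "progressive M W \<phi>" "progressive M W \<phi>'" "progressive M W \<psi>" "progressive M W \<psi>'"
    and "AE z in P. ext \<phi> z = ext \<phi>' z" "AE z in P. ext \<psi> z = ext \<psi>' z"
  shows "ip \<phi> \<psi> = ip \<phi>' \<psi>'"
  unfolding ip_def
proof (rule integral_cong_AE)
  show "AE z in P. ext \<phi> z * ext \<psi> z = ext \<phi>' z * ext \<psi>' z"
    using assms(5,6) by eventually_elim simp
qed (intro borel_measurable_times ext_measurable assms)+

text \<open>Uniqueness yields equality almost surely at each fixed time; joint measurability and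
  Fubini turn this into equality almost everywhere on the product.\<close>

lemma ext_AE_eq:
  assumes p: "progressive M W X" "progressive M W Y" and eq: "\<And>t. 0 \<le> t \<Longrightarrow> AE \<omega> in M. X t \<omega> = Y t \<omega>"
  shows "AE z in P. ext X z = ext Y z"
proof -
  interpret PS: pair_sigma_finite "lborel :: real measure" M by (rule pair_sigma_finite_lborel)
  have "AE z in P. (\<lambda>z. ext X z = ext Y z) z"
  proof (rule PS.AE_pair_measure)
    show "{z \<in> space P. ext X z = ext Y z} \<in> sets P"
      using ext_measurable[OF p(1)] ext_measurable[OF p(2)] by measurable
    show "AE t in lborel. AE \<omega> in M. ext X (t, \<omega>) = ext Y (t, \<omega>)"
    proof (rule AE_I2)
      fix t :: real
      show "AE \<omega> in M. ext X (t, \<omega>) = ext Y (t, \<omega>)"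
        using eq[of t] by (cases "0 \<le> t") (auto simp: ext_def)
    qed
  qed
  then show ?thesis .
qed

section \<open>Transfer from the explicit solution to the state, the cost and the
  stabilizers\<close>

lemma L2F_cong_AE:
  assumes "progressive M W X" "progressive M W Y" "AE z in P. ext X z = ext Y z"
  shows "X \<in> L2F M W \<longleftrightarrow> Y \<in> L2F M W"
  using assms msq_cong_AE[OF assms(3)] by (simp add: L2F_iff)

text \<open>Existence makes the \<open>SOME\<close> choice a genuine solution, and uniqueness
  identifies it with \<open>sol\<close> almost everywhere. From here on only these properties of the
  state are used, never its representative.\<close>

lemma state_properties:
  assumes u: "u \<in> L2F M W"
  shows "progressive M W (state M W a 1 c 0 x u)"
    and "solves_sde M W a 1 c 0 x u (state M W a 1 c 0 x u)"
    and "AE z in P. ext (state M W a 1 c 0 x u) z = ext (sol a c x u) z"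
    and "state M W a 1 c 0 x u \<in> L2F M W \<longleftrightarrow> sol a c x u \<in> L2F M W"
proof -
  note s = sol_solves_sde[OF u, of a c x]
  show st: "solves_sde M W a 1 c 0 x u (state M W a 1 c 0 x u)"
    unfolding state_def by (rule someI[of "solves_sde M W a 1 c 0 x u", OF s])
  show p: "progressive M W (state M W a 1 c 0 x u)" using st by (simp add: solves_sde_def)
  have "AE \<omega> in M. state M W a 1 c 0 x u t \<omega> = sol a c x u t \<omega>" if "0 \<le> t" for t
    by (rule sde_unique[OF st s u that])
  then show ae: "AE z in P. ext (state M W a 1 c 0 x u) z = ext (sol a c x u) z"
    by (intro ext_AE_eq p progressive_sol L2F_D(1)[OF u])
  show "state M W a 1 c 0 x u \<in> L2F M W \<longleftrightarrow> sol a c x u \<in> L2F M W"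
    by (intro L2F_cong_AE p progressive_sol L2F_D(1)[OF u] ae)
qed

lemma state_in_L2F:
  "u \<in> L2F M W \<Longrightarrow> 2 * a + c\<^sup>2 < 0 \<Longrightarrow> state M W a 1 c 0 x u \<in> L2F M W"
  by (simp add: state_properties sol_in_L2F)

lemma ip_fst:
  assumes "\<phi> \<in> L2F M W" "\<psi> \<in> L2F M W"
  shows "ip \<phi> \<psi> = (LBINT t:{0..}. (\<integral>\<omega>. \<phi> t \<omega> * \<psi> t \<omega> \<partial>M))"
proof -
  have "ext \<phi> z * ext \<psi> z = indicator {0..} (fst z) * (\<phi> (fst z) (snd z) * \<psi> (fst z) (snd z))" for z
    by (simp add: ext_def split: split_indicator)
  then show ?thesis
    using product_fst[OF progressive_joint_measurable[OF L2F_D(1)[OF assms(1)]] L2F_time_finite[OF assms(1) order_refl]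
        progressive_joint_measurable[OF L2F_D(1)[OF assms(2)]] L2F_time_finite[OF assms(2) order_refl]]
    by (simp add: ip_def)
qed

lemma state_identity:
  assumes u: "u \<in> L2F M W" and X: "state M W a 1 c 0 x u \<in> L2F M W"
  shows "(2 * a + c\<^sup>2) * ip (state M W a 1 c 0 x u) (state M W a 1 c 0 x u)
    + 2 * ip (state M W a 1 c 0 x u) u = - x\<^sup>2"
proof -
  let ?X = "state M W a 1 c 0 x u" and ?Y = "sol a c x u"
  have Y: "?Y \<in> L2F M W" using X state_properties(4)[OF u] by blast
  note p = state_properties(1)[OF u, of a c x] L2F_D(1)[OF Y]
  have "ip ?X ?X = ip ?Y ?Y" by (intro ip_cong_AE p state_properties(3) u)
  moreover have "ip ?X u = ip ?Y u" by (intro ip_cong_AE p state_properties(3) u L2F_D(1)) auto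
  ultimately show ?thesis
    using sol_identity[OF u Y] by (simp add: ip_fst Y u power2_eq_square)
qed

lemma admissible_iff:
  "u \<in> admissible M W a 1 c 0 x \<longleftrightarrow> u \<in> L2F M W \<and> state M W a 1 c 0 x u \<in> L2F M W"
  using state_properties(1) by (auto simp: admissible_def L2F_def)

lemma cost_eq:
  assumes u: "u \<in> L2F M W" and X: "state M W a 1 c 0 x u \<in> L2F M W"
  shows "cost M W a 1 c 0 Q S R x u
    = Q * ip (state M W a 1 c 0 x u) (state M W a 1 c 0 x u) + 2 * S * ip (state M W a 1 c 0 x u) u + R * ip u u"
proof -
  interpret PS: pair_sigma_finite "lborel :: real measure" M by (rule pair_sigma_finite_lborel)
  let ?X = "state M W a 1 c 0 x u"
  let ?G = "\<lambda>z. Q * (ext ?X z * ext ?X z) + 2 * S * (ext ?X z * ext u z) + R * (ext u z * ext u z)"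
  have i: "integrable P ?G"
    by (intro Bochner_Integration.integrable_add integrable_mult_right ext_integrable u X)
  then have i': "integrable P (case_prod (\<lambda>t \<omega>. ?G (t, \<omega>)))" by (simp add: case_prod_beta')
  have G: "?G (t, \<omega>) = indicator {0..} t *\<^sub>R (Q * (?X t \<omega>)\<^sup>2 + 2 * S * ?X t \<omega> * u t \<omega> + R * (u t \<omega>)\<^sup>2)" for t \<omega>
    by (simp add: ext_def power2_eq_square split: split_indicator)
  have "cost M W a 1 c 0 Q S R x u = (\<integral>\<omega>. \<integral>t. ?G (t, \<omega>) \<partial>lborel \<partial>M)"
    by (simp add: cost_def Let_def set_lebesgue_integral_def G)
  also have "\<dots> = (\<integral>z. ?G z \<partial>P)" using PS.integral_snd[OF i'] by (simp add: case_prod_beta')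
  also have "\<dots> = Q * ip ?X ?X + 2 * S * ip ?X u + R * ip u u"
    using ext_integrable[OF X X] ext_integrable[OF X u] ext_integrable[OF u u] by (simp add: ip_def)
  finally show ?thesis .
qed

text \<open>For necessity, the identity with zero control and \<open>x = 1\<close> equates the rate
  times a nonnegative number with -1, which forces the rate to be negative.\<close>

lemma stabilizer_iff: "stabilizer M W a 1 c 0 \<Theta> \<longleftrightarrow> 2 * (a + \<Theta>) + c\<^sup>2 < 0"
proof -
  \<comment> \<open>Under zero control the equations with control coefficient 0 and 1 have the same
    solutions, so the results for coefficient 1 apply.\<close>
  have st: "state M W (a + 1 * \<Theta>) 0 (c + 0 * \<Theta>) 0 x (\<lambda>_ _. 0) = state M W (a + \<Theta>) 1 c 0 x (\<lambda>_ _. 0)" for x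
    by (simp add: state_def solves_sde_def)
  have "stabilizer M W a 1 c 0 \<Theta> \<longleftrightarrow> (\<forall>x. state M W (a + \<Theta>) 1 c 0 x (\<lambda>_ _. 0) \<in> L2F M W)"
    unfolding stabilizer_def st using state_properties(1)[OF zero_L2F] by (auto simp: L2F_def)
  also have "\<dots> \<longleftrightarrow> 2 * (a + \<Theta>) + c\<^sup>2 < 0"
  proof
    assume *: "\<forall>x. state M W (a + \<Theta>) 1 c 0 x (\<lambda>_ _. 0) \<in> L2F M W"
    let ?X = "state M W (a + \<Theta>) 1 c 0 1 (\<lambda>_ _. 0)"
    have "ip ?X (\<lambda>_ _. 0) = 0" by (simp add: ip_def ext_def)
    then have "(2 * (a + \<Theta>) + c\<^sup>2) * ip ?X ?X = - 1"
      using state_identity[OF zero_L2F *[rule_format, of 1]] by simp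
    then show "2 * (a + \<Theta>) + c\<^sup>2 < 0"
      using mult_nonneg_nonneg[OF _ ip_nonneg[of ?X], of "2 * (a + \<Theta>) + c\<^sup>2"] by linarith
  qed (use state_in_L2F[OF zero_L2F] in blast)
  finally show ?thesis .
qed

text \<open>Two states are in play: that of the closed-loop equation driven by \<open>v\<close>,
  from which the control is built, and that of the original equation under the resulting control.
  The first solves the second equation, so uniqueness makes them agree.\<close>

lemma closed_loop_properties:
  fixes x :: real
  assumes v: "v \<in> L2F M W" and \<Theta>: "2 * (a + \<Theta>) + c\<^sup>2 < 0"
  defines "u \<equiv> closed_loop_control M W a 1 c 0 \<Theta> v x"
  defines "X \<equiv> state M W a 1 c 0 x u"
  shows "u \<in> admissible M W a 1 c 0 x" and "AE z in P. ext u z = \<Theta> * ext X z + ext v z"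
proof -
  define Y where "Y = state M W (a + \<Theta>) 1 c 0 x v"
  have u_eq: "u = (\<lambda>t \<omega>. \<Theta> * Y t \<omega> + v t \<omega>)"
    by (simp add: u_def closed_loop_control_def Y_def)
  have Y: "Y \<in> L2F M W" unfolding Y_def by (rule state_in_L2F[OF v \<Theta>])
  have u: "u \<in> L2F M W" using L2F_linear[OF Y v, of \<Theta> 1] by (simp add: u_eq)
  have "solves_sde M W (a + \<Theta>) 1 c 0 x v Y" unfolding Y_def by (rule state_properties(2)[OF v])
  then have Ys: "solves_sde M W a 1 c 0 x u Y"
    by (simp add: solves_sde_def u_eq algebra_simps)
  have Xs: "solves_sde M W a 1 c 0 x u X" unfolding X_def by (rule state_properties(2)[OF u])
  have p: "progressive M W X" "progressive M W Y" using Xs Ys by (auto simp: solves_sde_def)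
  have ae: "AE z in P. ext X z = ext Y z"
    by (rule ext_AE_eq[OF p]) (rule sde_unique[OF Xs Ys u])
  have "X \<in> L2F M W" using L2F_cong_AE[OF p ae] Y by simp
  then show "u \<in> admissible M W a 1 c 0 x" using u by (simp add: admissible_iff X_def)
  show "AE z in P. ext u z = \<Theta> * ext X z + ext v z"
    using ae by eventually_elim (use ext_linear[of \<Theta> Y 1 v] in \<open>simp add: u_eq\<close>)
qed

end

section \<open>The control problem\<close>

text \<open>The value equals \<open>d / t + R * m / 2 + R * t / 4\<close>. A negative
  \<open>R\<close> drives it down as \<open>t\<close> grows; with \<open>R\<close> nonnegative, a
  negative \<open>d\<close> does so as \<open>t\<close> shrinks.\<close>

lemma feedback_value_unbounded:
  fixes m q R K :: real
  assumes "R < 0 \<or> (0 \<le> R \<and> R * m\<^sup>2 + 4 * q < 0)"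
  obtains t where "0 < t" "(q + R * ((m + t) / 2)\<^sup>2) / t < K"
proof -
  define d where "d = q + R * m\<^sup>2 / 4"
  have f: "(q + R * ((m + t) / 2)\<^sup>2) / t = d / t + R * m / 2 + R * t / 4" if "0 < t" for t
    using that by (simp add: d_def power2_eq_square field_simps)
  from assms show thesis
  proof
    assume R: "R < 0"
    \<comment> \<open>Large enough for \<open>- R * t / 4\<close> to exceed
      \<open>\<bar>d\<bar> + R * m / 2 - K\<close>, and at least 1 so that \<open>d / t\<close> is
      at most \<open>\<bar>d\<bar>\<close>.\<close>
    define t where "t = max 1 (4 * (\<bar>d\<bar> + R * m / 2 - K) / - R + 1)"
    have t: "1 \<le> t" by (simp add: t_def)
    have "4 * (\<bar>d\<bar> + R * m / 2 - K) / - R < t" by (simp add: t_def)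
    then have "4 * (\<bar>d\<bar> + R * m / 2 - K) < t * - R" using R by (subst (asm) pos_divide_less_eq) auto
    moreover have "d / t \<le> \<bar>d\<bar>"
    proof -
      have "d / t \<le> \<bar>d\<bar> / t" using t by (intro divide_right_mono) auto
      also have "\<dots> \<le> \<bar>d\<bar> / 1" using t by (intro divide_left_mono) auto
      finally show ?thesis by simp
    qed
    moreover have "R * t / 4 = - (t * - R) / 4" by simp
    ultimately have "d / t + R * m / 2 + R * t / 4 < K" by argo
    then show thesis using that[of t] f[of t] t by simp
  next
    assume R: "0 \<le> R \<and> R * m\<^sup>2 + 4 * q < 0"
    then have d: "d < 0" by (simp add: d_def)
    \<comment> \<open>With \<open>t \<le> 1\<close> the other terms are at most
      \<open>R * m / 2 + R / 4\<close>; with \<open>t \<le> - d / L\<close> the first is at most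
      \<open>- L\<close>, which brings the sum below \<open>K\<close>.\<close>
    define L where "L = \<bar>R * m / 2 + R / 4 - K\<bar> + 1"
    define t where "t = min 1 (- d / L)"
    have L: "0 < L" by (simp add: L_def)
    have t: "0 < t" "t \<le> 1" "t \<le> - d / L" using divide_neg_pos[OF d L] by (auto simp: t_def)
    have "t * L \<le> - d" by (rule iffD1[OF pos_le_divide_eq[OF L] t(3)])
    then have "d \<le> - L * t" by (simp add: mult.commute)
    then have "d / t \<le> - L" using t(1) by (simp add: divide_le_eq)
    moreover have "R * t \<le> R" using R t mult_left_mono[of t 1 R] by simp
    ultimately have "d / t + R * m / 2 + R * t / 4 < K" unfolding L_def by linarith
    then show thesis using that[of t] f[of t] t by simp
  qed
qed

context brownian_space
begin

lemma ip_feedback: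
  assumes \<phi>: "\<phi> \<in> L2F M W" and u: "u \<in> L2F M W" and ae: "AE z in P. ext u z = \<Theta> * ext \<phi> z"
  shows "ip \<phi> u = \<Theta> * ip \<phi> \<phi>" and "ip u u = \<Theta>\<^sup>2 * ip \<phi> \<phi>"
proof -
  note m = ext_measurable[OF L2F_D(1)[OF \<phi>]] ext_measurable[OF L2F_D(1)[OF u]]
  have "ip \<phi> u = (\<integral>z. \<Theta> * (ext \<phi> z * ext \<phi> z) \<partial>P)"
    unfolding ip_def
  proof (rule integral_cong_AE)
    show "AE z in P. ext \<phi> z * ext u z = \<Theta> * (ext \<phi> z * ext \<phi> z)"
      using ae by eventually_elim simp
  qed (intro borel_measurable_times borel_measurable_const m)+
  then show "ip \<phi> u = \<Theta> * ip \<phi> \<phi>" by (simp add: ip_def)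
  have "ip u u = (\<integral>z. \<Theta>\<^sup>2 * (ext \<phi> z * ext \<phi> z) \<partial>P)"
    unfolding ip_def
  proof (rule integral_cong_AE)
    show "AE z in P. ext u z * ext u z = \<Theta>\<^sup>2 * (ext \<phi> z * ext \<phi> z)"
      using ae by eventually_elim (simp add: power2_eq_square)
  qed (intro borel_measurable_times borel_measurable_const m)+
  then show "ip u u = \<Theta>\<^sup>2 * ip \<phi> \<phi>" by (simp add: ip_def)
qed

lemma cost_reduced:
  assumes "u \<in> admissible M W a 1 c 0 x"
  shows "cost M W a 1 c 0 Q S R x u = - S * x\<^sup>2
    + (Q - S * (2 * a + c\<^sup>2)) * ip (state M W a 1 c 0 x u) (state M W a 1 c 0 x u) + R * ip u u"
proof -
  let ?X = "state M W a 1 c 0 x u"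
  have u: "u \<in> L2F M W" "?X \<in> L2F M W" using assms by (auto simp: admissible_iff)
  have "2 * S * ip ?X u = S * (2 * ip ?X u)" by simp
  also have "2 * ip ?X u = - x\<^sup>2 - (2 * a + c\<^sup>2) * ip ?X ?X"
    using state_identity[OF u] by simp
  finally show ?thesis unfolding cost_eq[OF u] by (simp add: algebra_simps)
qed

text \<open>Parametrises the stabilizing feedbacks by the decay rate \<open>t = - (2 * a + c\<^sup>2 + 2 * \<Theta>)\<close>
  of the closed-loop second moment.\<close>

lemma feedback_cost:
  assumes t: "0 < t"
  obtains u where "u \<in> admissible M W a 1 c 0 x"
    and "cost M W a 1 c 0 Q S R x u = - S * x\<^sup>2
      + (Q - S * (2 * a + c\<^sup>2) + R * ((2 * a + c\<^sup>2 + t) / 2)\<^sup>2) / t * x\<^sup>2"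
proof -
  define \<Theta> where "\<Theta> = - (2 * a + c\<^sup>2 + t) / 2"
  have rate: "2 * a + c\<^sup>2 + 2 * \<Theta> = - t" by (simp add: \<Theta>_def field_simps)
  then have \<Theta>: "2 * (a + \<Theta>) + c\<^sup>2 < 0" using t by simp
  define u where "u = closed_loop_control M W a 1 c 0 \<Theta> (\<lambda>_ _. 0) x"
  let ?X = "state M W a 1 c 0 x u"
  have u: "u \<in> admissible M W a 1 c 0 x" and ae: "AE z in P. ext u z = \<Theta> * ext ?X z + ext (\<lambda>_ _. 0) z"
    using closed_loop_properties[OF zero_L2F \<Theta>] by (auto simp: u_def)
  have ae: "AE z in P. ext u z = \<Theta> * ext ?X z" using ae by (simp add: ext_def[of "\<lambda>_ _. 0"])
  have L: "u \<in> L2F M W" "?X \<in> L2F M W" using u by (auto simp: admissible_iff)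
  note f = ip_feedback[OF L(2,1) ae]
  have "(2 * a + c\<^sup>2 + 2 * \<Theta>) * ip ?X ?X = - x\<^sup>2"
    using state_identity[OF L] by (simp add: f algebra_simps)
  then have XX: "ip ?X ?X = x\<^sup>2 / t" unfolding rate using t by (simp add: field_simps)
  have "\<Theta>\<^sup>2 = ((2 * a + c\<^sup>2 + t) / 2)\<^sup>2"
    unfolding \<Theta>_def minus_divide_left[symmetric] by (rule power2_minus)
  then have "cost M W a 1 c 0 Q S R x u = - S * x\<^sup>2
      + (Q - S * (2 * a + c\<^sup>2) + R * ((2 * a + c\<^sup>2 + t) / 2)\<^sup>2) / t * x\<^sup>2"
    unfolding cost_reduced[OF u] f XX using t by (simp add: field_simps)
  then show thesis using u that by blast
qed

lemma closed_loop_optimal_imp: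
  assumes "closed_loop_optimal M W a 1 c 0 Q S R \<Theta> v"
  shows "v \<in> L2F M W" and "2 * (a + \<Theta>) + c\<^sup>2 < 0"
    and "closed_loop_control M W a 1 c 0 \<Theta> v x \<in> admissible M W a 1 c 0 x"
    and "u \<in> admissible M W a 1 c 0 x \<Longrightarrow>
      cost M W a 1 c 0 Q S R x (closed_loop_control M W a 1 c 0 \<Theta> v x) \<le> cost M W a 1 c 0 Q S R x u"
proof -
  show v: "v \<in> L2F M W" and \<Theta>: "2 * (a + \<Theta>) + c\<^sup>2 < 0"
    using assms by (auto simp: closed_loop_optimal_def stabilizer_iff)
  show "closed_loop_control M W a 1 c 0 \<Theta> v x \<in> admissible M W a 1 c 0 x"
    by (rule closed_loop_properties(1)[OF v \<Theta>])
  show "u \<in> admissible M W a 1 c 0 x \<Longrightarrow>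
      cost M W a 1 c 0 Q S R x (closed_loop_control M W a 1 c 0 \<Theta> v x) \<le> cost M W a 1 c 0 Q S R x u"
    using assms by (auto simp: closed_loop_optimal_def)
qed

lemma closed_loop_imp_open_loop:
  assumes "closed_loop_solvable M W a 1 c 0 Q S R"
  shows "open_loop_solvable M W a 1 c 0 Q S R"
proof -
  obtain \<Theta> v where cl: "closed_loop_optimal M W a 1 c 0 Q S R \<Theta> v"
    using assms unfolding closed_loop_solvable_def by (elim exE)
  show ?thesis
    unfolding open_loop_solvable_def
    by (intro allI bexI[OF _ closed_loop_optimal_imp(3)[OF cl]] ballI closed_loop_optimal_imp(4)[OF cl])
qed

section \<open>Unsolvable and solvable cases\<close>

lemma not_solvable_unbounded:
  assumes "R < 0 \<or> (0 \<le> R \<and> R * (2 * a + c\<^sup>2)\<^sup>2 + 4 * (Q - S * (2 * a + c\<^sup>2)) < 0)"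
  shows "\<not> open_loop_solvable M W a 1 c 0 Q S R"
proof
  assume "open_loop_solvable M W a 1 c 0 Q S R"
  then obtain u\<^sub>0 where opt: "\<forall>u\<in>admissible M W a 1 c 0 1. cost M W a 1 c 0 Q S R 1 u\<^sub>0 \<le> cost M W a 1 c 0 Q S R 1 u"
    unfolding open_loop_solvable_def by blast
  \<comment> \<open>The summand \<open>S\<close> compensates the term \<open>- S * x^2\<close> of
    the cost at \<open>x = 1\<close>.\<close>
  obtain t where t: "0 < t" "(Q - S * (2 * a + c\<^sup>2) + R * ((2 * a + c\<^sup>2 + t) / 2)\<^sup>2) / t < cost M W a 1 c 0 Q S R 1 u\<^sub>0 + S"
    by (rule feedback_value_unbounded[OF assms])
  obtain u where "u \<in> admissible M W a 1 c 0 1" "cost M W a 1 c 0 Q S R 1 u = - S * 1\<^sup>2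
      + (Q - S * (2 * a + c\<^sup>2) + R * ((2 * a + c\<^sup>2 + t) / 2)\<^sup>2) / t * 1\<^sup>2"
    by (rule feedback_cost[OF t(1)])
  then show False using opt t(2) by fastforce
qed

text \<open>If the state vanished almost everywhere, both inner products in the identity would be 0,
  whereas their combination is -1.\<close>

lemma ip_state_pos:
  assumes u: "u \<in> admissible M W a 1 c 0 1"
  shows "0 < ip (state M W a 1 c 0 1 u) (state M W a 1 c 0 1 u)"
proof (rule ccontr)
  let ?X = "state M W a 1 c 0 1 u"
  have L: "u \<in> L2F M W" "?X \<in> L2F M W" using u by (auto simp: admissible_iff)
  assume "\<not> ?thesis"
  then have 0: "ip ?X ?X = 0" using ip_nonneg[of ?X] by simp
  have "AE z in P. ext ?X z * ext u z = 0" using ip_eq_0_imp[OF L(2) 0] by eventually_elim simp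
  then have "ip ?X u = 0" unfolding ip_def by (rule integral_eq_zero_AE)
  then show False using state_identity[OF L] 0 by simp
qed

text \<open>The cost is a positive multiple of the squared norm \<open>p\<close> of the state, up to
  a constant. A feedback of decay rate \<open>2 / p\<close> has squared norm \<open>p / 2\<close>,
  so every candidate is beaten.\<close>

lemma not_solvable_R0_pos:
  assumes q: "0 < Q - S * (2 * a + c\<^sup>2)"
  shows "\<not> open_loop_solvable M W a 1 c 0 Q S 0"
proof
  assume "open_loop_solvable M W a 1 c 0 Q S 0"
  then obtain u\<^sub>0 where u0: "u\<^sub>0 \<in> admissible M W a 1 c 0 1"
    and opt: "\<forall>u\<in>admissible M W a 1 c 0 1. cost M W a 1 c 0 Q S 0 1 u\<^sub>0 \<le> cost M W a 1 c 0 Q S 0 1 u"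
    unfolding open_loop_solvable_def by blast
  define p where "p = ip (state M W a 1 c 0 1 u\<^sub>0) (state M W a 1 c 0 1 u\<^sub>0)"
  have p: "0 < p" unfolding p_def by (rule ip_state_pos[OF u0])
  have "0 < 2 / p" using p by simp
  then obtain u where u: "u \<in> admissible M W a 1 c 0 1" "cost M W a 1 c 0 Q S 0 1 u = - S * 1\<^sup>2
      + (Q - S * (2 * a + c\<^sup>2) + 0 * ((2 * a + c\<^sup>2 + 2 / p) / 2)\<^sup>2) / (2 / p) * 1\<^sup>2"
    by (rule feedback_cost)
  have "(Q - S * (2 * a + c\<^sup>2)) * p \<le> (Q - S * (2 * a + c\<^sup>2)) / (2 / p)"
    using opt u cost_reduced[OF u0, of Q S 0] by (fastforce simp: p_def)
  moreover have "(Q - S * (2 * a + c\<^sup>2)) / (2 / p) = (Q - S * (2 * a + c\<^sup>2)) * p / 2" by simp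
  ultimately show False using mult_pos_pos[OF q p] by linarith
qed

text \<open>The explicit factor 1 keeps the difference in the shape of \<open>L2F_linear\<close>,
  \<open>ip_linear_left\<close> and \<open>ext_linear\<close>.\<close>

lemma ip_diff_expand:
  assumes "u \<in> L2F M W" "X \<in> L2F M W"
  shows "ip (\<lambda>t \<omega>. 1 * u t \<omega> + (- \<Theta>) * X t \<omega>) (\<lambda>t \<omega>. 1 * u t \<omega> + (- \<Theta>) * X t \<omega>)
    = ip u u - 2 * \<Theta> * ip X u + \<Theta>\<^sup>2 * ip X X"
proof -
  let ?w = "\<lambda>t \<omega>. 1 * u t \<omega> + (- \<Theta>) * X t \<omega>"
  have w: "?w \<in> L2F M W" by (rule L2F_linear[OF assms])
  have "ip ?w ?w = 1 * ip u ?w + (- \<Theta>) * ip X ?w" by (rule ip_linear_left[OF assms w])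
  also have "ip u ?w = 1 * ip u u + (- \<Theta>) * ip X u"
    by (rule trans[OF ip_commute ip_linear_left[OF assms assms(1)]])
  also have "ip X ?w = 1 * ip u X + (- \<Theta>) * ip X X"
    by (rule trans[OF ip_commute ip_linear_left[OF assms assms(2)]])
  also have "ip u X = ip X u" by (rule ip_commute)
  finally show ?thesis by (simp add: power2_eq_square algebra_simps)
qed

text \<open>Completion of the square: \<open>\<Theta>\<close> solves the algebraic Riccati equation
  (with \<open>P = - R * \<Theta>\<close>).\<close>

lemma cost_completed_square:
  assumes u: "u \<in> admissible M W a 1 c 0 x"
    and riccati: "Q - S * (2 * a + c\<^sup>2) = R * \<Theta> * (\<Theta> + (2 * a + c\<^sup>2))"
  defines "X \<equiv> state M W a 1 c 0 x u"
  shows "cost M W a 1 c 0 Q S R x u = (- S - R * \<Theta>) * x\<^sup>2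
    + R * ip (\<lambda>t \<omega>. 1 * u t \<omega> + (- \<Theta>) * X t \<omega>) (\<lambda>t \<omega>. 1 * u t \<omega> + (- \<Theta>) * X t \<omega>)"
proof -
  have L: "u \<in> L2F M W" "X \<in> L2F M W" using u by (auto simp: admissible_iff X_def)
  have id: "2 * ip X u = - x\<^sup>2 - (2 * a + c\<^sup>2) * ip X X"
    using state_identity[OF L(1) L(2)[unfolded X_def]] by (simp add: X_def)
  have "R * (ip u u - 2 * \<Theta> * ip X u + \<Theta>\<^sup>2 * ip X X)
      = R * (ip u u - \<Theta> * (- x\<^sup>2 - (2 * a + c\<^sup>2) * ip X X) + \<Theta>\<^sup>2 * ip X X)"
    unfolding id[symmetric] by simp
  then show ?thesis
    unfolding cost_reduced[OF u] ip_diff_expand[OF L] riccati X_def[symmetric]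
    by (simp add: power2_eq_square algebra_simps)
qed

text \<open>The Riccati equation has the double root \<open>- m / 2\<close>, on the boundary of the
  stabilizers. Feedbacks with small decay rate bring the completed square arbitrarily close to 0, so
  an optimal control would have to be \<open>- m / 2\<close> times its state; the identity then
  reads \<open>0 = -1\<close>.\<close>

lemma not_solvable_degenerate:
  assumes R: "0 < R" and \<Sigma>: "R * (2 * a + c\<^sup>2)\<^sup>2 + 4 * (Q - S * (2 * a + c\<^sup>2)) = 0"
  shows "\<not> open_loop_solvable M W a 1 c 0 Q S R"
proof
  assume "open_loop_solvable M W a 1 c 0 Q S R"
  then obtain u where u: "u \<in> admissible M W a 1 c 0 1"
    and opt: "\<forall>u'\<in>admissible M W a 1 c 0 1. cost M W a 1 c 0 Q S R 1 u \<le> cost M W a 1 c 0 Q S R 1 u'"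
    unfolding open_loop_solvable_def by blast
  define m where "m = 2 * a + c\<^sup>2"
  let ?X = "state M W a 1 c 0 1 u"
  let ?w = "\<lambda>t \<omega>. 1 * u t \<omega> + (- (- m / 2)) * ?X t \<omega>"
  have q: "Q - S * m = - R * m\<^sup>2 / 4" using \<Sigma> by (simp add: m_def field_simps)
  have "Q - S * (2 * a + c\<^sup>2) = R * (- m / 2) * (- m / 2 + (2 * a + c\<^sup>2))"
    unfolding m_def[symmetric] q by (simp add: power2_eq_square field_simps)
  note sq = cost_completed_square[OF u this]
  have L: "u \<in> L2F M W" "?X \<in> L2F M W" using u by (auto simp: admissible_iff)
  have w: "?w \<in> L2F M W" by (rule L2F_linear[OF L])
  have le: "ip ?w ?w \<le> t / 4" if t: "0 < t" for t
  proof -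
    obtain u' where u': "u' \<in> admissible M W a 1 c 0 1" "cost M W a 1 c 0 Q S R 1 u' = - S * 1\<^sup>2
        + (Q - S * (2 * a + c\<^sup>2) + R * ((2 * a + c\<^sup>2 + t) / 2)\<^sup>2) / t * 1\<^sup>2"
      by (rule feedback_cost[OF t])
    have "(Q - S * (2 * a + c\<^sup>2) + R * ((2 * a + c\<^sup>2 + t) / 2)\<^sup>2) / t = R * m / 2 + R * t / 4"
      unfolding m_def[symmetric] q using t by (simp add: power2_eq_square field_simps)
    moreover have "cost M W a 1 c 0 Q S R 1 u \<le> cost M W a 1 c 0 Q S R 1 u'" using opt u'(1) by blast
    ultimately have "R * ip ?w ?w \<le> R * (t / 4)" unfolding u'(2) sq by simp
    then show ?thesis using R by (simp only: mult_le_cancel_left_pos)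
  qed
  \<comment> \<open>If positive, the value itself is an allowed rate, and it would be at most a
    quarter of itself.\<close>
  have "ip ?w ?w = 0"
    using le[of "ip ?w ?w"] ip_nonneg[of ?w] by (cases "ip ?w ?w = 0") auto
  then have "AE z in P. ext u z = (- m / 2) * ext ?X z"
    using ip_eq_0_imp[OF w] unfolding ext_linear
    by (auto elim!: eventually_mono simp: eq_neg_iff_add_eq_0)
  from ip_feedback(1)[OF L(2,1) this] have "2 * ip ?X u = - (m * ip ?X ?X)" by simp
  then show False using state_identity[OF L] unfolding m_def[symmetric] by simp
qed

text \<open>All admissible controls have the same cost, so optimality reduces to
  admissibility.\<close>

lemma optimal_R_zero:
  assumes q: "Q = S * (2 * a + c\<^sup>2)"
  shows "open_loop_solvable M W a 1 c 0 Q S 0"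
    and "closed_loop_optimal M W a 1 c 0 Q S 0 \<Theta> v \<longleftrightarrow> \<Theta> < - (2 * a + c\<^sup>2) / 2 \<and> v \<in> L2F M W"
proof -
  have cost: "cost M W a 1 c 0 Q S 0 x u = - S * x\<^sup>2" if "u \<in> admissible M W a 1 c 0 x" for x u
    using cost_reduced[OF that, of Q S 0] q by simp
  show "open_loop_solvable M W a 1 c 0 Q S 0"
    unfolding open_loop_solvable_def
  proof
    fix x
    obtain u where "u \<in> admissible M W a 1 c 0 x" by (rule feedback_cost[of 1 a c x]) auto
    then show "\<exists>u\<^sub>0\<in>admissible M W a 1 c 0 x. \<forall>u\<in>admissible M W a 1 c 0 x.
        cost M W a 1 c 0 Q S 0 x u\<^sub>0 \<le> cost M W a 1 c 0 Q S 0 x u"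
      using cost by (metis order_refl)
  qed
  have eq: "\<Theta> < - (2 * a + c\<^sup>2) / 2 \<longleftrightarrow> 2 * (a + \<Theta>) + c\<^sup>2 < 0" by (simp add: field_simps) linarith
  show "closed_loop_optimal M W a 1 c 0 Q S 0 \<Theta> v \<longleftrightarrow> \<Theta> < - (2 * a + c\<^sup>2) / 2 \<and> v \<in> L2F M W"
    unfolding eq
  proof
    assume "closed_loop_optimal M W a 1 c 0 Q S 0 \<Theta> v"
    then show "2 * (a + \<Theta>) + c\<^sup>2 < 0 \<and> v \<in> L2F M W" using closed_loop_optimal_imp by blast
  next
    assume *: "2 * (a + \<Theta>) + c\<^sup>2 < 0 \<and> v \<in> L2F M W"
    then show "closed_loop_optimal M W a 1 c 0 Q S 0 \<Theta> v"
      using cost closed_loop_properties(1)[of v a \<Theta> c]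
      by (auto simp: closed_loop_optimal_def stabilizer_iff)
  qed
qed

lemma ext_eq_0_iff:
  "(AE z in P. ext v z = 0) \<longleftrightarrow> (AE (t, \<omega>) in P. 0 \<le> t \<longrightarrow> v t \<omega> = 0)"
  by (intro AE_cong) (auto simp: ext_def split: split_indicator)

text \<open>\<open>r\<close> stands for \<open>sqrt (\<Sigma> / R)\<close>. Of the two Riccati
  roots, \<open>\<Theta>s\<close> is the one with \<open>m + 2 * \<Theta>s = - r\<close>, hence the
  stabilizing one. Its cost attains the lower bound given by the completed square, so any optimal
  control is \<open>\<Theta>s\<close> times its state.\<close>

lemma optimal_R_pos_iff:
  assumes R: "0 < R" and r: "0 < r"
    and \<Sigma>: "R * r\<^sup>2 = R * (2 * a + c\<^sup>2)\<^sup>2 + 4 * (Q - S * (2 * a + c\<^sup>2))"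
  shows "closed_loop_optimal M W a 1 c 0 Q S R \<Theta> v \<longleftrightarrow>
    \<Theta> = - (2 * a + c\<^sup>2 + r) / 2 \<and> v \<in> L2F M W \<and> (AE z in P. ext v z = 0)"
proof -
  define m where "m = 2 * a + c\<^sup>2"
  define \<Theta>s where "\<Theta>s = - (m + r) / 2"
  let ?X = "\<lambda>x u. state M W a 1 c 0 x u"
  let ?w = "\<lambda>x u t \<omega>. 1 * u t \<omega> + (- \<Theta>s) * ?X x u t \<omega>"
  let ?ad = "admissible M W a 1 c 0"
  let ?J = "cost M W a 1 c 0 Q S R"
  \<comment> \<open>The root times its sum with \<open>m\<close> is \<open>(r^2 - m^2) / 4\<close>,
    which makes the Riccati equation a restatement of the hypothesis on \<open>r\<close>.\<close>
  have "4 * (Q - S * m) = 4 * (R * \<Theta>s * (\<Theta>s + m))"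
    using \<Sigma> unfolding m_def[symmetric] by (simp add: \<Theta>s_def power2_eq_square field_simps)
  then have "Q - S * (2 * a + c\<^sup>2) = R * \<Theta>s * (\<Theta>s + (2 * a + c\<^sup>2))" by (simp add: m_def)
  note J = cost_completed_square[OF _ this]
  have L: "u \<in> L2F M W" "?X x u \<in> L2F M W" if "u \<in> ?ad x" for x u
    using that by (auto simp: admissible_iff)
  have w: "?w x u \<in> L2F M W" if "u \<in> ?ad x" for x u by (rule L2F_linear[OF L[OF that]])
  have \<Theta>s: "2 * (a + \<Theta>s) + c\<^sup>2 < 0" using r by (simp add: \<Theta>s_def m_def field_simps)
  have opt: "?J x (closed_loop_control M W a 1 c 0 \<Theta>s v x) = (- S - R * \<Theta>s) * x\<^sup>2"
    if v: "v \<in> L2F M W" "AE z in P. ext v z = 0" for v x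
  proof -
    define u where "u = closed_loop_control M W a 1 c 0 \<Theta>s v x"
    note p = closed_loop_properties[OF v(1) \<Theta>s, of x, folded u_def]
    have "AE z in P. ext (?w x u) z * ext (?w x u) z = 0"
      using p(2) v(2) by eventually_elim (simp only: ext_linear, simp)
    then have "ip (?w x u) (?w x u) = 0" unfolding ip_def by (rule integral_eq_zero_AE)
    then show ?thesis using J[OF p(1)] unfolding u_def by simp
  qed
  have lower: "(- S - R * \<Theta>s) * x\<^sup>2 \<le> ?J x u" if "u \<in> ?ad x" for x u
    using J[OF that] R ip_nonneg[of "?w x u"] by simp
  have "closed_loop_optimal M W a 1 c 0 Q S R \<Theta> v \<longleftrightarrow> \<Theta> = \<Theta>s \<and> v \<in> L2F M W \<and> (AE z in P. ext v z = 0)"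
  proof
    assume "\<Theta> = \<Theta>s \<and> v \<in> L2F M W \<and> (AE z in P. ext v z = 0)"
    then show "closed_loop_optimal M W a 1 c 0 Q S R \<Theta> v"
      using \<Theta>s opt lower by (auto simp: closed_loop_optimal_def stabilizer_iff)
  next
    assume cl: "closed_loop_optimal M W a 1 c 0 Q S R \<Theta> v"
    note v = closed_loop_optimal_imp(1)[OF cl] and \<Theta> = closed_loop_optimal_imp(2)[OF cl]
    define u where "u x = closed_loop_control M W a 1 c 0 \<Theta> v x" for x
    have u: "u x \<in> ?ad x" for x unfolding u_def by (rule closed_loop_optimal_imp(3)[OF cl])
    have fb: "AE z in P. ext (u x) z = \<Theta>s * ext (?X x (u x)) z" for x
    proof -
      have z: "AE z in P. ext (\<lambda>_ _. 0) z = 0" by (simp add: ext_def)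
      have "?J x (u x) \<le> ?J x (closed_loop_control M W a 1 c 0 \<Theta>s (\<lambda>_ _. 0) x)"
        unfolding u_def by (rule closed_loop_optimal_imp(4)[OF cl closed_loop_properties(1)[OF zero_L2F \<Theta>s]])
      then have "?J x (u x) \<le> (- S - R * \<Theta>s) * x\<^sup>2" using opt[OF zero_L2F z] by simp
      then have "R * ip (?w x (u x)) (?w x (u x)) \<le> 0" using J[OF u[of x]] by simp
      then have "ip (?w x (u x)) (?w x (u x)) = 0"
        using R ip_nonneg[of "?w x (u x)"] by (simp add: mult_le_0_iff)
      from ip_eq_0_imp[OF w[OF u] this] show ?thesis unfolding ext_linear by eventually_elim simp
    qed
    \<comment> \<open>Two feedback descriptions of one control: the given one with
      \<open>\<Theta>\<close> and \<open>v\<close>, and the optimal one with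
      \<open>\<Theta>s\<close>.\<close>
    have v_eq: "AE z in P. ext v z = (\<Theta>s - \<Theta>) * ext (?X x (u x)) z" for x
      using closed_loop_properties(2)[OF v \<Theta>, of x, folded u_def] fb[of x]
      by eventually_elim (simp add: algebra_simps)
    have XX: "(m + 2 * \<Theta>s) * ip (?X x (u x)) (?X x (u x)) = - x\<^sup>2" for x
      using state_identity[OF L[OF u[of x]]] ip_feedback(1)[OF L(2,1)[OF u[of x]] fb[of x]]
      by (simp add: m_def algebra_simps)
    \<comment> \<open>The process \<open>v\<close> is the same for all initial values, while the
      norm of the state is zero for \<open>x = 0\<close> and nonzero for
      \<open>x = 1\<close>.\<close>
    have "\<Theta> = \<Theta>s"
    proof (rule ccontr)
      assume ne: "\<Theta> \<noteq> \<Theta>s"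
      have vv: "ip v v = (\<Theta>s - \<Theta>)\<^sup>2 * ip (?X x (u x)) (?X x (u x))" for x
        by (rule ip_feedback(2)[OF L(2)[OF u] v v_eq])
      have "ip (?X 0 (u 0)) (?X 0 (u 0)) = ip (?X 1 (u 1)) (?X 1 (u 1))"
        using vv[of 0] vv[of 1] ne by simp
      then show False using XX[of 0] XX[of 1] by simp
    qed
    then show "\<Theta> = \<Theta>s \<and> v \<in> L2F M W \<and> (AE z in P. ext v z = 0)"
      using v v_eq by simp
  qed
  then show ?thesis by (simp add: \<Theta>s_def m_def)
qed

lemma solvable_R_pos_iff:
  fixes a c Q S R :: real
  assumes R: "0 < R"
  defines "\<Sigma> \<equiv> R * (2 * a + c\<^sup>2)\<^sup>2 - 4 * S * (2 * a + c\<^sup>2) + 4 * Q"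
  shows "open_loop_solvable M W a 1 c 0 Q S R \<longleftrightarrow> \<Sigma> > 0"
    and "closed_loop_solvable M W a 1 c 0 Q S R \<longleftrightarrow> \<Sigma> > 0"
    and "\<Sigma> > 0 \<Longrightarrow> closed_loop_optimal M W a 1 c 0 Q S R \<Theta> v \<longleftrightarrow>
      \<Theta> = - (2 * a + c\<^sup>2 + sqrt (\<Sigma> / R)) / 2 \<and> v \<in> L2F M W \<and>
      (AE (t, \<omega>) in P. 0 \<le> t \<longrightarrow> v t \<omega> = 0)"
proof -
  have \<Sigma>: "\<Sigma> = R * (2 * a + c\<^sup>2)\<^sup>2 + 4 * (Q - S * (2 * a + c\<^sup>2))" by (simp add: \<Sigma>_def algebra_simps)
  have opt: "closed_loop_optimal M W a 1 c 0 Q S R \<Theta> v \<longleftrightarrow>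
      \<Theta> = - (2 * a + c\<^sup>2 + sqrt (\<Sigma> / R)) / 2 \<and> v \<in> L2F M W \<and> (AE z in P. ext v z = 0)"
    if "\<Sigma> > 0" for \<Theta> v
  proof -
    have "R * (sqrt (\<Sigma> / R))\<^sup>2 = \<Sigma>" using R that by simp
    then show ?thesis using R that by (intro optimal_R_pos_iff trans[OF _ \<Sigma>]) auto
  qed
  have pos: "closed_loop_solvable M W a 1 c 0 Q S R" if "\<Sigma> > 0"
    unfolding closed_loop_solvable_def using opt[OF that] zero_L2F by (fastforce simp: ext_def)
  have neg: "\<Sigma> > 0" if "open_loop_solvable M W a 1 c 0 Q S R"
  proof (rule ccontr)
    assume "\<not> \<Sigma> > 0"
    then consider "\<Sigma> < 0" | "\<Sigma> = 0" by linarith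
    then show False
      using that not_solvable_unbounded[of R a c Q S] not_solvable_degenerate[of R a c Q S] R
      by cases (auto simp: \<Sigma>)
  qed
  show "open_loop_solvable M W a 1 c 0 Q S R \<longleftrightarrow> \<Sigma> > 0"
    using pos neg closed_loop_imp_open_loop by blast
  show "closed_loop_solvable M W a 1 c 0 Q S R \<longleftrightarrow> \<Sigma> > 0"
    using pos neg closed_loop_imp_open_loop by blast
  show "\<Sigma> > 0 \<Longrightarrow> closed_loop_optimal M W a 1 c 0 Q S R \<Theta> v \<longleftrightarrow>
      \<Theta> = - (2 * a + c\<^sup>2 + sqrt (\<Sigma> / R)) / 2 \<and> v \<in> L2F M W \<and>
      (AE (t, \<omega>) in P. 0 \<le> t \<longrightarrow> v t \<omega> = 0)"
    using opt by (simp add: ext_eq_0_iff)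
qed

lemma solvable_R_zero_iff:
  shows "open_loop_solvable M W a 1 c 0 Q S 0 \<longleftrightarrow> Q = S * (2 * a + c\<^sup>2)"
    and "closed_loop_solvable M W a 1 c 0 Q S 0 \<longleftrightarrow> Q = S * (2 * a + c\<^sup>2)"
proof -
  have neg: "Q = S * (2 * a + c\<^sup>2)" if "open_loop_solvable M W a 1 c 0 Q S 0"
  proof (rule ccontr)
    assume "Q \<noteq> S * (2 * a + c\<^sup>2)"
    then consider "Q - S * (2 * a + c\<^sup>2) < 0" | "0 < Q - S * (2 * a + c\<^sup>2)" by linarith
    then show False
      using that not_solvable_unbounded[of 0 a c Q S] not_solvable_R0_pos[where a=a and c=c and Q=Q and S=S] by cases auto
  qed
  have pos: "closed_loop_solvable M W a 1 c 0 Q S 0" if q: "Q = S * (2 * a + c\<^sup>2)"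
  proof -
    have "- (2 * a + c\<^sup>2) / 2 - 1 < - (2 * a + c\<^sup>2) / 2" by linarith
    then have "closed_loop_optimal M W a 1 c 0 Q S 0 (- (2 * a + c\<^sup>2) / 2 - 1) (\<lambda>_ _. 0)"
      using optimal_R_zero(2)[OF q] zero_L2F by blast
    then show ?thesis unfolding closed_loop_solvable_def by blast
  qed
  show "open_loop_solvable M W a 1 c 0 Q S 0 \<longleftrightarrow> Q = S * (2 * a + c\<^sup>2)"
    using optimal_R_zero(1) neg by blast
  show "closed_loop_solvable M W a 1 c 0 Q S 0 \<longleftrightarrow> Q = S * (2 * a + c\<^sup>2)"
    using pos neg closed_loop_imp_open_loop by blast
qed

end

theorem theorem7p1:
  fixes M :: "'a measure" and W :: "real \<Rightarrow> 'a \<Rightarrow> real"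
    and A B C D Q S R :: real
  assumes "brownian_space M W" and "D = 0" and "B = 1"
  shows
    "(R < 0 \<longrightarrow>
        \<not> open_loop_solvable M W A B C D Q S R \<and> \<not> closed_loop_solvable M W A B C D Q S R) \<and>
     (R = 0 \<longrightarrow>
        (open_loop_solvable M W A B C D Q S R \<longleftrightarrow> Q = S * (2 * A + C\<^sup>2)) \<and>
        (closed_loop_solvable M W A B C D Q S R \<longleftrightarrow> Q = S * (2 * A + C\<^sup>2)) \<and>
        (Q = S * (2 * A + C\<^sup>2) \<longrightarrow>
          (\<forall>\<Theta> v. closed_loop_optimal M W A B C D Q S R \<Theta> v \<longleftrightarrow>
             \<Theta> < - (2 * A + C\<^sup>2) / 2 \<and> v \<in> L2F M W))) \<and>
     (R > 0 \<longrightarrow>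
        (let \<Sigma> = R * (2 * A + C\<^sup>2)\<^sup>2 - 4 * S * (2 * A + C\<^sup>2) + 4 * Q in
          (open_loop_solvable M W A B C D Q S R \<longleftrightarrow> \<Sigma> > 0) \<and>
          (closed_loop_solvable M W A B C D Q S R \<longleftrightarrow> \<Sigma> > 0) \<and>
          (\<Sigma> > 0 \<longrightarrow>
            (\<forall>\<Theta> v. closed_loop_optimal M W A B C D Q S R \<Theta> v \<longleftrightarrow>
               \<Theta> = - (2 * A + C\<^sup>2 + sqrt (\<Sigma> / R)) / 2 \<and> v \<in> L2F M W \<and>
               (AE (t, \<omega>) in lborel \<Otimes>\<^sub>M M. 0 \<le> t \<longrightarrow> v t \<omega> = 0)))))"
proof -
  interpret brownian_space M W by fact
  show ?thesis
    unfolding \<open>D = 0\<close> \<open>B = 1\<close> Let_def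
  proof (intro conjI impI allI)
    assume "R < 0"
    then show "\<not> open_loop_solvable M W A 1 C 0 Q S R" by (simp add: not_solvable_unbounded)
    then show "\<not> closed_loop_solvable M W A 1 C 0 Q S R" using closed_loop_imp_open_loop by blast
  qed (use solvable_R_zero_iff optimal_R_zero(2) solvable_R_pos_iff in \<open>simp_all\<close>)
qed

end
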